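(* Let $R$ be a one-dimensional Cohen-Macaulay local ring with infinite residue field and conductor ideal $\mathfrak{c}$. Assume that either (1) $\ell(R/\mathfrak{c})\le 3$, or (2) $\ell(R/\mathfrak{c})=4$ and $R$ has minimal multiplicity. Then the category of regular reflexive ideals of $R$ is of finite type.
   Context: All rings are commutative Noetherian with unity. $Q(R)$ is the total ring of fractions of $R$, $\overline R$ is the integral closure of $R$ in $Q(R)$, and the conductor ideal is $\mathfrak c=R:\overline R=\{a\in Q(R): a\overline R\subseteq R\}$. $\ell$ denotes length. $R$ with maximal ideal $\mathfrak m$ has minimal multiplicity if the Hilbert-Samuel multiplicity $e(R)$ equals $\mu(\mathfrak m)$, the minimal number of generators of $\mathfrak m$. An ideal is regular if it contains a nonzerodivisor. A module $M$ is reflexive if the natural map $M\to M^{**}$ is an isomorphism, with $M^*=\mathrm{Hom}_R(M,R)$. A class of finitely generated $R$-modules is of finite type if there is a finite set of finitely generated $R$-modules such that every member of the class is isomorphic to a direct sum of modules from that set. *)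

theory Defs
  imports "HOL-Algebra.Algebra" "HOL-Library.Extended_Nat"
begin

section \<open>Local rings, dimension and depth\<close>

definition nonzerodivisors :: "('a, 'r) ring_scheme \<Rightarrow> 'a set" where
  "nonzerodivisors R =
     {s \<in> carrier R. \<forall>x\<in>carrier R. s \<otimes>\<^bsub>R\<^esub> x = \<zero>\<^bsub>R\<^esub> \<longrightarrow> x = \<zero>\<^bsub>R\<^esub>}"

definition local_ring :: "('a, 'r) ring_scheme \<Rightarrow> bool" where
  "local_ring R \<longleftrightarrow> cring R \<and> (\<exists>!m. maximalideal m R)"

definition max_ideal :: "('a, 'r) ring_scheme \<Rightarrow> 'a set" where
  "max_ideal R = (THE m. maximalideal m R)"

definition residue_field :: "('a, 'r) ring_scheme \<Rightarrow> 'a set ring" where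
  "residue_field R = R Quot max_ideal R"

definition krull_dim :: "('a, 'r) ring_scheme \<Rightarrow> enat" where
  "krull_dim R = Sup {enat n | n. \<exists>P :: nat \<Rightarrow> 'a set.
     (\<forall>i\<le>n. primeideal (P i) R) \<and> (\<forall>i<n. P i \<subset> P (Suc i))}"

definition regular_sequence :: "('a, 'r) ring_scheme \<Rightarrow> 'a list \<Rightarrow> bool" where
  "regular_sequence R xs \<longleftrightarrow>
     set xs \<subseteq> carrier R \<and>
     (\<forall>i<length xs. Idl\<^bsub>R\<^esub> (set (take i xs)) +>\<^bsub>R\<^esub> (xs ! i)
        \<in> nonzerodivisors (R Quot Idl\<^bsub>R\<^esub> (set (take i xs)))) \<and>
     Idl\<^bsub>R\<^esub> (set xs) \<noteq> carrier R"

definition ring_depth :: "('a, 'r) ring_scheme \<Rightarrow> enat" where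
  "ring_depth R = Sup {enat (length xs) | xs. regular_sequence R xs \<and> set xs \<subseteq> max_ideal R}"

definition cohen_macaulay_local_ring :: "('a, 'r) ring_scheme \<Rightarrow> bool" where
  "cohen_macaulay_local_ring R \<longleftrightarrow>
     noetherian_ring R \<and> local_ring R \<and> ring_depth R = krull_dim R"

section \<open>Modules\<close>

text \<open>
  The type of modules extends the type of rings, but the locale of modules puts no condition on
  the fields \<open>mult\<close> and \<open>one\<close>; most constructions below leave them undefined.
  An ideal \<open>I\<close> of \<open>R\<close>, seen as a module, is \<open>ring_module R\<lparr>carrier := I\<rparr>\<close>.
\<close>

definition ring_module :: "('a, 'r) ring_scheme \<Rightarrow> ('a, 'a) module" where
  "ring_module R = \<lparr>carrier = carrier R, monoid.mult = monoid.mult R, one = one R,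
     ring.zero = ring.zero R, add = add R, smult = monoid.mult R\<rparr>"

definition quotient_module ::
    "('a, 'r) ring_scheme \<Rightarrow> ('a, 'b) module \<Rightarrow> 'b set \<Rightarrow> ('a, 'b set) module" where
  "quotient_module R M N = \<lparr>carrier = a_rcosets\<^bsub>M\<^esub> N, monoid.mult = undefined, one = undefined,
     ring.zero = N, add = set_add M,
     smult = (\<lambda>a U. \<Union>x\<in>U. N +>\<^bsub>M\<^esub> (a \<odot>\<^bsub>M\<^esub> x))\<rparr>"

definition module_length :: "('a, 'r) ring_scheme \<Rightarrow> ('a, 'b) module \<Rightarrow> enat" where
  "module_length R M = Sup {enat n | n. \<exists>N :: nat \<Rightarrow> 'b set.
     (\<forall>i\<le>n. submodule (N i) R M) \<and> (\<forall>i<n. N i \<subset> N (Suc i))}"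

definition finitely_generated_module :: "('a, 'r) ring_scheme \<Rightarrow> ('a, 'b) module \<Rightarrow> bool" where
  "finitely_generated_module R M \<longleftrightarrow> module R M \<and>
     (\<exists>A \<subseteq> carrier M. finite A \<and> (\<forall>N. submodule N R M \<and> A \<subseteq> N \<longrightarrow> N = carrier M))"

text \<open>
  Homomorphisms are extensional functions, so that equality of homomorphisms is equality of
  functions.
\<close>

definition module_hom ::
    "('a, 'r) ring_scheme \<Rightarrow> ('a, 'b) module \<Rightarrow> ('a, 'c) module \<Rightarrow> ('b \<Rightarrow> 'c) set" where
  "module_hom R M N = {f \<in> carrier M \<rightarrow>\<^sub>E carrier N.
     (\<forall>x\<in>carrier M. \<forall>y\<in>carrier M. f (x \<oplus>\<^bsub>M\<^esub> y) = f x \<oplus>\<^bsub>N\<^esub> f y) \<and>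
     (\<forall>a\<in>carrier R. \<forall>x\<in>carrier M. f (a \<odot>\<^bsub>M\<^esub> x) = a \<odot>\<^bsub>N\<^esub> f x)}"

definition module_iso ::
    "('a, 'r) ring_scheme \<Rightarrow> ('a, 'b) module \<Rightarrow> ('a, 'c) module \<Rightarrow> ('b \<Rightarrow> 'c) set" where
  "module_iso R M N = {f \<in> module_hom R M N. bij_betw f (carrier M) (carrier N)}"

definition hom_module ::
    "('a, 'r) ring_scheme \<Rightarrow> ('a, 'b) module \<Rightarrow> ('a, 'c) module \<Rightarrow> ('a, 'b \<Rightarrow> 'c) module" where
  "hom_module R M N = \<lparr>carrier = module_hom R M N, monoid.mult = undefined, one = undefined,
     ring.zero = (\<lambda>x\<in>carrier M. \<zero>\<^bsub>N\<^esub>),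
     add = (\<lambda>f g. \<lambda>x\<in>carrier M. f x \<oplus>\<^bsub>N\<^esub> g x),
     smult = (\<lambda>a f. \<lambda>x\<in>carrier M. a \<odot>\<^bsub>N\<^esub> f x)\<rparr>"

definition dual_module :: "('a, 'r) ring_scheme \<Rightarrow> ('a, 'b) module \<Rightarrow> ('a, 'b \<Rightarrow> 'a) module" where
  "dual_module R M = hom_module R M (ring_module R)"

definition reflexive_module :: "('a, 'r) ring_scheme \<Rightarrow> ('a, 'b) module \<Rightarrow> bool" where
  "reflexive_module R M \<longleftrightarrow>
     (\<lambda>x\<in>carrier M. \<lambda>f\<in>carrier (dual_module R M). f x)
       \<in> module_iso R M (dual_module R (dual_module R M))"

definition direct_sum :: "('a, 'r) ring_scheme \<Rightarrow> ('a, 'b) module list \<Rightarrow> ('a, 'b list) module" where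
  "direct_sum R Ms = \<lparr>
     carrier = {xs. length xs = length Ms \<and> (\<forall>i<length Ms. xs ! i \<in> carrier (Ms ! i))},
     monoid.mult = undefined, one = undefined,
     ring.zero = map ring.zero Ms,
     add = (\<lambda>xs ys. map (\<lambda>i. xs ! i \<oplus>\<^bsub>Ms ! i\<^esub> ys ! i) [0..<length Ms]),
     smult = (\<lambda>a xs. map (\<lambda>i. a \<odot>\<^bsub>Ms ! i\<^esub> (xs ! i)) [0..<length Ms])\<rparr>"

text \<open>
  A class of modules is represented by a set \<open>C\<close>. Every finitely generated \<open>R\<close>-module is isomorphic
  to a quotient of some free module of rank \<open>n\<close>, whose elements are cosets of lists of length \<open>n\<close>.
  Hence modules with elements of type \<open>'a list set\<close> represent all finitely generated modules up to
  isomorphism, and restricting the finite set \<open>S\<close> to them loses no generality. Direct sums are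
  finite because the members of the class are finitely generated.
\<close>

definition finite_type :: "('a, 'r) ring_scheme \<Rightarrow> ('a, 'b) module set \<Rightarrow> bool" where
  "finite_type R C \<longleftrightarrow> (\<exists>S :: ('a, 'a list set) module set.
     finite S \<and> (\<forall>N\<in>S. finitely_generated_module R N) \<and>
     (\<forall>M\<in>C. \<exists>Ns. set Ns \<subseteq> S \<and> module_iso R M (direct_sum R Ns) \<noteq> {}))"

section \<open>Total ring of fractions and conductor\<close>

text \<open>
  The fraction \<open>a/s\<close> is the class of all pairs \<open>(b, t)\<close> with \<open>a t = b s\<close>. No further factor is needed
  because denominators are nonzerodivisors.
\<close>

definition fraction :: "('a, 'r) ring_scheme \<Rightarrow> 'a \<Rightarrow> 'a \<Rightarrow> ('a \<times> 'a) set" where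
  "fraction R a s =
     {(b, t). b \<in> carrier R \<and> t \<in> nonzerodivisors R \<and> a \<otimes>\<^bsub>R\<^esub> t = b \<otimes>\<^bsub>R\<^esub> s}"

definition total_fractions :: "('a, 'r) ring_scheme \<Rightarrow> ('a \<times> 'a) set ring" where
  "total_fractions R = \<lparr>
     carrier = {fraction R a s | a s. a \<in> carrier R \<and> s \<in> nonzerodivisors R},
     monoid.mult = (\<lambda>U V. \<Union>(a, s)\<in>U. \<Union>(b, t)\<in>V. fraction R (a \<otimes>\<^bsub>R\<^esub> b) (s \<otimes>\<^bsub>R\<^esub> t)),
     one = fraction R \<one>\<^bsub>R\<^esub> \<one>\<^bsub>R\<^esub>,
     ring.zero = fraction R \<zero>\<^bsub>R\<^esub> \<one>\<^bsub>R\<^esub>,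
     add = (\<lambda>U V. \<Union>(a, s)\<in>U. \<Union>(b, t)\<in>V.
       fraction R (a \<otimes>\<^bsub>R\<^esub> t \<oplus>\<^bsub>R\<^esub> b \<otimes>\<^bsub>R\<^esub> s) (s \<otimes>\<^bsub>R\<^esub> t))\<rparr>"

definition fraction_embed :: "('a, 'r) ring_scheme \<Rightarrow> 'a \<Rightarrow> ('a \<times> 'a) set" where
  "fraction_embed R a = fraction R a \<one>\<^bsub>R\<^esub>"

text \<open>
  Polynomials are coefficient lists without leading zeros, and the head of a nonempty list is the
  leading coefficient.
\<close>

definition integral_over :: "('a, 'r) ring_scheme \<Rightarrow> 'a set \<Rightarrow> 'a \<Rightarrow> bool" where
  "integral_over Q K x \<longleftrightarrow> (\<exists>p \<in> carrier (univ_poly Q K).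
     p \<noteq> [] \<and> lead_coeff p = \<one>\<^bsub>Q\<^esub> \<and> ring.eval Q p x = \<zero>\<^bsub>Q\<^esub>)"

definition integral_closure :: "('a, 'r) ring_scheme \<Rightarrow> ('a \<times> 'a) set set" where
  "integral_closure R = {x \<in> carrier (total_fractions R).
     integral_over (total_fractions R) (fraction_embed R ` carrier R) x}"

definition conductor :: "('a, 'r) ring_scheme \<Rightarrow> ('a \<times> 'a) set set" where
  "conductor R = {a \<in> carrier (total_fractions R). \<forall>x\<in>integral_closure R.
     a \<otimes>\<^bsub>total_fractions R\<^esub> x \<in> fraction_embed R ` carrier R}"

text \<open>
  Since \<open>1\<close> is integral over \<open>R\<close>, the conductor lies in the image of \<open>R\<close> in its total ring of
  fractions; the following is the corresponding ideal of \<open>R\<close>.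
\<close>

definition conductor_ideal :: "('a, 'r) ring_scheme \<Rightarrow> 'a set" where
  "conductor_ideal R = {r \<in> carrier R. fraction_embed R r \<in> conductor R}"

section \<open>Multiplicity and regular reflexive ideals\<close>

definition quotient_length :: "('a, 'r) ring_scheme \<Rightarrow> 'a set \<Rightarrow> enat" where
  "quotient_length R I = module_length R (quotient_module R (ring_module R) I)"

text \<open>
  For a Noetherian local ring \<open>R\<close> of dimension \<open>d\<close> with maximal ideal \<open>m\<close>, the multiplicity is the
  limit of \<open>d! length(R/m^n) / n^d\<close>; the lengths involved are finite.
\<close>

definition hilbert_samuel_multiplicity :: "('a, 'r) ring_scheme \<Rightarrow> real" where
  "hilbert_samuel_multiplicity R = (let d = the_enat (krull_dim R) in
     lim (\<lambda>n. fact d * real (the_enat (quotient_length R (max_ideal R [^]\<^bsub>ideals_set R\<^esub> n)))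
       / real n ^ d))"

definition min_generators :: "('a, 'r) ring_scheme \<Rightarrow> 'a set \<Rightarrow> nat" where
  "min_generators R I = (LEAST n. \<exists>A \<subseteq> carrier R. finite A \<and> card A = n \<and> Idl\<^bsub>R\<^esub> A = I)"

definition minimal_multiplicity :: "('a, 'r) ring_scheme \<Rightarrow> bool" where
  "minimal_multiplicity R \<longleftrightarrow>
     hilbert_samuel_multiplicity R = real (min_generators R (max_ideal R))"

definition regular_ideal :: "('a, 'r) ring_scheme \<Rightarrow> 'a set \<Rightarrow> bool" where
  "regular_ideal R I \<longleftrightarrow> ideal I R \<and> I \<inter> nonzerodivisors R \<noteq> {}"

definition regular_reflexive_ideals :: "('a, 'r) ring_scheme \<Rightarrow> ('a, 'a) module set" where
  "regular_reflexive_ideals R = {ring_module R\<lparr>carrier := I\<rparr> | I.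
     regular_ideal R I \<and> reflexive_module R (ring_module R\<lparr>carrier := I\<rparr>)}"

end

theory Submission
  imports Defs
begin

text \<open>
  Let \<open>S\<close> be the integral closure of \<open>R\<close>, \<open>c\<close> the conductor and \<open>I\<^sup>* = R : I\<close>.  Finite length of \<open>R/c\<close> makes \<open>c\<close>
  regular, and then only finitely many \<open>S\<close>-modules lie between \<open>c\<close> and \<open>S\<close>.  As the residue field is infinite,
  every regular ideal \<open>I\<close> contains some \<open>z\<close> with \<open>I \<subseteq> zS\<close>.  For reflexive \<open>I\<close> the ideal \<open>K = z I\<^sup>*\<close> then
  contains \<open>c\<close>, and \<open>I = z K\<^sup>*\<close>; so it suffices to classify the reflexive ideals \<open>K\<close> above \<open>c\<close> up to scaling.

  If \<open>K/c\<close> is nonzero and cyclic, then \<open>K\<close> is a multiple of \<open>R + z\<inverse>c\<close> for some \<open>z\<close> with \<open>c \<subseteq> zS\<close>, which leaves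
  finitely many cases.  For \<open>\<ell>(R/c) \<le> 3\<close> the other ideals are \<open>c\<close>, \<open>m\<close> and \<open>R\<close>.  For \<open>\<ell>(R/c) = 4\<close> the other ideals besides
  these have \<open>\<ell>(m/K) = 1\<close>.  Minimal multiplicity gives \<open>m\<^sup>2 = ym\<close>, so that \<open>y\<inverse>m\<close> is a ring.  It acts on \<open>K\<close> because
  \<open>K\<close> is reflexive and not principal; hence \<open>y\<inverse>K\<close> is one of its maximal ideals above \<open>y\<inverse>c\<close>, of which there are
  at most three.
\<close>

text \<open>No structure theory of the normalization \<open>S\<close> is developed. The work is done
  with submodules of the total ring of fractions \<open>Q\<close>, and a regular element of the
  conductor, which multiplies \<open>S\<close> into \<open>R\<close>, gives modules inside
  \<open>S\<close> the ascending chain condition of \<open>R\<close>. The detour through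
  \<open>K\<close> is made because \<open>I\<close> itself need not contain \<open>c\<close>.
  Multiplication by a unit of \<open>Q\<close> is an isomorphism of modules, so classes up to
  scaling are enough. The bounds 3 and 4 come from one chain. For \<open>w\<close> in
  \<open>K\<close> outside \<open>c\<close>, the modules \<open>c\<close>, \<open>c + wR\<close>,
  \<open>K\<close>, \<open>m\<close>, \<open>R\<close> form four strict steps unless two neighbours
  coincide. Length at most 3 forbids this, which puts \<open>K\<close> on the list. Length 4 allows
  it, but leaves no room for a further module between \<open>K\<close> and \<open>m\<close>; this is
  where \<open>\<ell>(m/K) = 1\<close> comes from and why \<open>y^-1 K\<close> is maximal in
  \<open>y^-1 m\<close>.\<close>

context cring
begin

section \<open>Submodules of a commutative ring, their sums and multiples\<close>

definition subm :: "'a set \<Rightarrow> 'a set \<Rightarrow> bool" where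
  "subm T M \<longleftrightarrow> M \<subseteq> carrier R \<and> \<zero> \<in> M \<and> (\<forall>x\<in>M. \<forall>y\<in>M. x \<oplus> y \<in> M) \<and> (\<forall>t\<in>T. \<forall>x\<in>M. t \<otimes> x \<in> M)"

lemma subm_carrier: "subm T M \<Longrightarrow> M \<subseteq> carrier R"
  and subm_zero: "subm T M \<Longrightarrow> \<zero> \<in> M"
  and subm_add: "subm T M \<Longrightarrow> x \<in> M \<Longrightarrow> y \<in> M \<Longrightarrow> x \<oplus> y \<in> M"
  and subm_smult: "subm T M \<Longrightarrow> t \<in> T \<Longrightarrow> x \<in> M \<Longrightarrow> t \<otimes> x \<in> M"
  by (auto simp: subm_def)

lemma subm_mono: "subm T M \<Longrightarrow> T' \<subseteq> T \<Longrightarrow> subm T' M"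
  by (auto simp: subm_def)

text \<open>Negation is not part of \<open>subm\<close>, whose scalars \<open>T\<close> form an
  arbitrary set; it is recovered from \<open>\<ominus> \<one> \<in> T\<close>, which holds for both
  \<open>A\<close> and \<open>S\<close>.\<close>

lemma subm_neg: "subm T M \<Longrightarrow> \<ominus> \<one> \<in> T \<Longrightarrow> x \<in> M \<Longrightarrow> \<ominus> x \<in> M"
  using subm_smult[of T M "\<ominus> \<one>" x] subm_carrier[of T M] by (auto simp: l_minus)

lemma subm_diff: "subm T M \<Longrightarrow> \<ominus> \<one> \<in> T \<Longrightarrow> x \<in> M \<Longrightarrow> y \<in> M \<Longrightarrow> x \<ominus> y \<in> M"
  by (simp add: a_minus_def subm_add subm_neg)

definition msum :: "'a set \<Rightarrow> 'a set \<Rightarrow> 'a set" where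
  "msum M N = {x \<oplus> y | x y. x \<in> M \<and> y \<in> N}"

definition scale :: "'a \<Rightarrow> 'a set \<Rightarrow> 'a set" where
  "scale u M = (\<lambda>x. u \<otimes> x) ` M"

lemma mem_msum: "z \<in> msum M Y \<longleftrightarrow> (\<exists>x\<in>M. \<exists>y\<in>Y. z = x \<oplus> y)"
  by (auto simp: msum_def)

lemma mem_scale: "z \<in> scale u M \<longleftrightarrow> (\<exists>x\<in>M. z = u \<otimes> x)"
  by (auto simp: scale_def)

lemma subm_msum:
  assumes T: "T \<subseteq> carrier R" and M: "subm T M" and Y: "subm T Y"
  shows "subm T (msum M Y)"
  unfolding subm_def
proof (intro conjI ballI)
  show "msum M Y \<subseteq> carrier R"
    using subm_carrier[OF M] subm_carrier[OF Y] by (auto simp: mem_msum subset_iff)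
  show "\<zero> \<in> msum M Y"
    using subm_zero[OF M] subm_zero[OF Y] by (force simp: mem_msum)
  fix z w assume "z \<in> msum M Y" "w \<in> msum M Y"
  then obtain a b c d where *: "a \<in> M" "b \<in> Y" "z = a \<oplus> b" "c \<in> M" "d \<in> Y" "w = c \<oplus> d"
    by (auto simp: mem_msum)
  have "z \<oplus> w = (a \<oplus> c) \<oplus> (b \<oplus> d)"
    using * subm_carrier[OF M] subm_carrier[OF Y] by (auto simp: a_ac subset_iff)
  then show "z \<oplus> w \<in> msum M Y"
    using * subm_add[OF M, of a c] subm_add[OF Y, of b d] unfolding mem_msum by auto
next
  fix t z assume "t \<in> T" "z \<in> msum M Y"
  then obtain a b where *: "a \<in> M" "b \<in> Y" "z = a \<oplus> b"
    by (auto simp: mem_msum)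
  then have "t \<otimes> z = t \<otimes> a \<oplus> t \<otimes> b"
    using subm_carrier[OF M] subm_carrier[OF Y] T \<open>t \<in> T\<close> by (auto simp: r_distr subset_iff)
  then show "t \<otimes> z \<in> msum M Y"
    using * subm_smult[OF M \<open>t \<in> T\<close>] subm_smult[OF Y \<open>t \<in> T\<close>] by (auto simp: mem_msum)
qed

lemma subm_scale:
  assumes T: "T \<subseteq> carrier R" and M: "subm T M" and u: "u \<in> carrier R"
  shows "subm T (scale u M)"
  unfolding subm_def
proof (intro conjI ballI)
  show "scale u M \<subseteq> carrier R"
    using subm_carrier[OF M] u by (auto simp: mem_scale subset_iff)
  show "\<zero> \<in> scale u M"
    using subm_zero[OF M] u by (force simp: mem_scale)
  fix z w assume "z \<in> scale u M" "w \<in> scale u M"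
  then obtain a c where *: "a \<in> M" "z = u \<otimes> a" "c \<in> M" "w = u \<otimes> c"
    by (auto simp: mem_scale)
  then have "z \<oplus> w = u \<otimes> (a \<oplus> c)"
    using subm_carrier[OF M] u by (auto simp: r_distr subset_iff)
  then show "z \<oplus> w \<in> scale u M"
    using * subm_add[OF M] by (auto simp: mem_scale)
next
  fix t z assume "t \<in> T" "z \<in> scale u M"
  then obtain a where *: "a \<in> M" "z = u \<otimes> a"
    by (auto simp: mem_scale)
  then have "t \<otimes> z = u \<otimes> (t \<otimes> a)"
    using subm_carrier[OF M] T u \<open>t \<in> T\<close> by (auto simp: m_ac subset_iff)
  then show "t \<otimes> z \<in> scale u M"
    using * subm_smult[OF M \<open>t \<in> T\<close>] by (auto simp: mem_scale)
qed

lemma subm_Int: "subm T M \<Longrightarrow> subm T Y \<Longrightarrow> subm T (M \<inter> Y)"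
  by (auto simp: subm_def)

lemma msum_upper1: "subm T M \<Longrightarrow> subm T' Y \<Longrightarrow> M \<subseteq> msum M Y"
  using subm_carrier[of T M] subm_zero[of T' Y] by (force simp: mem_msum)

lemma msum_upper2: "subm T M \<Longrightarrow> subm T' Y \<Longrightarrow> Y \<subseteq> msum M Y"
  using subm_carrier[of T' Y] subm_zero[of T M] by (force simp: mem_msum)

lemma msum_least: "subm T Z \<Longrightarrow> M \<subseteq> Z \<Longrightarrow> Y \<subseteq> Z \<Longrightarrow> msum M Y \<subseteq> Z"
  by (auto simp: mem_msum subm_def subset_iff)

lemma scale_scale:
  assumes "u \<in> carrier R" "v \<in> carrier R" "M \<subseteq> carrier R"
  shows "scale u (scale v M) = scale (u \<otimes> v) M"
  using assms by (force simp: scale_def m_assoc subset_iff)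

lemma scale_one: "M \<subseteq> carrier R \<Longrightarrow> scale \<one> M = M"
  by (force simp: scale_def subset_iff)

lemma scale_inv_cancel:
  assumes "u \<in> Units R" "M \<subseteq> carrier R"
  shows "scale u (scale (inv u) M) = M" "scale (inv u) (scale u M) = M"
proof -
  show "scale u (scale (inv u) M) = M" using assms by (simp add: scale_scale scale_one Units_closed)
  show "scale (inv u) (scale u M) = M" using assms by (simp add: scale_scale scale_one Units_closed)
qed

lemma scale_subset_iff:
  assumes "u \<in> Units R" "M \<subseteq> carrier R" "Y \<subseteq> carrier R"
  shows "scale u M \<subseteq> scale u Y \<longleftrightarrow> M \<subseteq> Y"
proof
  assume *: "scale u M \<subseteq> scale u Y"
  have "scale (inv u) (scale u M) \<subseteq> scale (inv u) (scale u Y)"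
    using * by (fastforce simp: mem_scale subset_iff)
  then show "M \<subseteq> Y"
    using assms by (simp add: scale_inv_cancel)
qed (auto simp: scale_def)

lemma Units_of_dvd_Unit:
  assumes "u \<in> Units R" "a \<in> carrier R" "b \<in> carrier R" "u = a \<otimes> b"
  shows "a \<in> Units R"
proof -
  have "a \<otimes> (b \<otimes> inv u) = \<one>"
    using assms by (metis Units_inv_closed Units_r_inv m_assoc)
  then show ?thesis
    using assms by (meson Units_inv_closed Units_one_closed m_closed unit_factor)
qed

lemma Units_cancel: "u \<in> Units R \<Longrightarrow> x \<in> carrier R \<Longrightarrow> inv u \<otimes> (u \<otimes> x) = x"
  and Units_cancel': "u \<in> Units R \<Longrightarrow> x \<in> carrier R \<Longrightarrow> u \<otimes> (inv u \<otimes> x) = x"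
  using m_assoc[of u "inv u" x] m_assoc[of "inv u" u x] by auto

end

section \<open>Total fractions of a local ring\<close>

text \<open>\<^term>\<open>A\<close> is the image of the local ring in its total ring of fractions \<^term>\<open>Q\<close> and \<^term>\<open>m\<close> its maximal ideal.
  Regular elements of \<^term>\<open>A\<close> are the ones that are units of \<^term>\<open>Q\<close>.\<close>

locale local_fractions = cring Q for Q (structure) +
  fixes A :: "'a set" and m :: "'a set"
  assumes A_carrier: "A \<subseteq> carrier Q"
    and A_one: "\<one> \<in> A"
    and A_neg: "\<ominus> \<one> \<in> A"
    and A_ring: "subm A A"
    and m_ideal: "subm A m" "m \<subseteq> A" "\<one> \<notin> m"
    and A_local: "a \<in> A \<Longrightarrow> a \<notin> m \<Longrightarrow> \<exists>b\<in>A. a \<otimes> b = \<one>"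
    and fractions: "q \<in> carrier Q \<Longrightarrow> \<exists>s\<in>A \<inter> Units Q. s \<otimes> q \<in> A"
    and acc: "F \<noteq> {} \<Longrightarrow> (\<And>M. M \<in> F \<Longrightarrow> subm A M \<and> M \<subseteq> A) \<Longrightarrow> \<exists>M\<in>F. \<forall>Y\<in>F. M \<subseteq> Y \<longrightarrow> Y = M"
    and dim1: "subm A P \<Longrightarrow> P \<subseteq> A \<Longrightarrow> \<one> \<notin> P \<Longrightarrow>
      (\<And>a b. a \<in> A \<Longrightarrow> b \<in> A \<Longrightarrow> a \<otimes> b \<in> P \<Longrightarrow> a \<in> P \<or> b \<in> P) \<Longrightarrow> P \<inter> Units Q \<noteq> {} \<Longrightarrow> P = m"
    and m_regular: "m \<inter> Units Q \<noteq> {}"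
    and infinite_residues: "\<exists>U. infinite U \<and> U \<subseteq> A \<and> (\<forall>u\<in>U. \<forall>v\<in>U. u \<noteq> v \<longrightarrow> u \<ominus> v \<notin> m)"
begin

lemma A_closed [simp]: "a \<in> A \<Longrightarrow> a \<in> carrier Q"
  using A_carrier by blast

lemma A_mult: "a \<in> A \<Longrightarrow> b \<in> A \<Longrightarrow> a \<otimes> b \<in> A"
  and A_add: "a \<in> A \<Longrightarrow> b \<in> A \<Longrightarrow> a \<oplus> b \<in> A"
  and A_zero: "\<zero> \<in> A"
  using A_ring by (auto simp: subm_def)

lemma A_minus: "a \<in> A \<Longrightarrow> \<ominus> a \<in> A"
  and A_diff: "a \<in> A \<Longrightarrow> b \<in> A \<Longrightarrow> a \<ominus> b \<in> A"
  using subm_neg[OF A_ring A_neg] subm_diff[OF A_ring A_neg] by auto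

lemma A_pow: "a \<in> A \<Longrightarrow> a [^] (n::nat) \<in> A"
  by (induction n) (auto simp: A_one A_mult)

lemma one_minus_unit:
  assumes "a \<in> m" obtains b where "b \<in> A" "(\<one> \<ominus> a) \<otimes> b = \<one>"
proof -
  have a: "a \<in> A" using assms m_ideal by auto
  have "\<one> \<ominus> a \<notin> m"
  proof
    assume "\<one> \<ominus> a \<in> m"
    then have "(\<one> \<ominus> a) \<oplus> a \<in> m"
      using assms m_ideal(1) by (auto intro: subm_add)
    moreover have "(\<one> \<ominus> a) \<oplus> a = \<one>"
      using a A_closed[OF a] by algebra
    ultimately show False using m_ideal by simp
  qed
  then show ?thesis
    using A_local[of "\<one> \<ominus> a"] a A_one A_diff that by auto
qed

lemma subm_unit_cancel:
  assumes M: "subm A M" and "a \<in> A" "a \<notin> m" "x \<in> carrier Q" "a \<otimes> x \<in> M"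
  shows "x \<in> M"
proof -
  obtain b where b: "b \<in> A" "a \<otimes> b = \<one>" using A_local assms by blast
  have "b \<otimes> (a \<otimes> x) = x"
    using b assms by (metis A_closed l_one m_assoc m_comm)
  then show ?thesis using subm_smult[OF M b(1) assms(5)] by simp
qed

lemma subm_diffA: "subm A M \<Longrightarrow> x \<in> M \<Longrightarrow> y \<in> M \<Longrightarrow> x \<ominus> y \<in> M"
  using subm_diff A_neg by blast

text \<open>\<open>\<one> \<ominus> a\<close> is invertible in \<open>A\<close>. In this form the
  locality of \<open>A\<close> enters the arguments of Nakayama type.\<close>

lemma subm_cancel_one_minus:
  assumes M: "subm A M" and "a \<in> m" "x \<in> carrier Q" "x \<ominus> a \<otimes> x \<in> M"
  shows "x \<in> M"
proof -
  have a: "a \<in> A" using assms m_ideal by auto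
  obtain b where b: "b \<in> A" "(\<one> \<ominus> a) \<otimes> b = \<one>" using one_minus_unit assms by blast
  have "b \<otimes> (x \<ominus> a \<otimes> x) = ((\<one> \<ominus> a) \<otimes> b) \<otimes> x"
    using b(1) a assms(3) A_closed[OF b(1)] A_closed[OF a] by algebra
  then show ?thesis using subm_smult[OF M b(1) assms(4)] assms b by simp
qed

lemma subm_principal: "x \<in> carrier Q \<Longrightarrow> subm A (scale x A)"
  using subm_scale A_carrier A_ring by blast

lemma principal_self: "x \<in> carrier Q \<Longrightarrow> x \<in> scale x A"
  using A_one by (force simp: mem_scale)

lemma principal_least: "subm A M \<Longrightarrow> x \<in> M \<Longrightarrow> scale x A \<subseteq> M"
  using subm_smult[of A M] subm_carrier[of A M] by (force simp: mem_scale m_comm)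

text \<open>Multiplication by the unit \<open>d\<close> preserves and reflects inclusion and sends
  the family to ideals of \<open>A\<close>. So the Noetherian condition extends to fractional
  modules with a common denominator.\<close>

lemma acc_bounded:
  assumes ne: "F \<noteq> {}" and d: "d \<in> Units Q"
    and F: "\<And>M. M \<in> F \<Longrightarrow> subm A M \<and> scale d M \<subseteq> A"
  shows "\<exists>M\<in>F. \<forall>Y\<in>F. M \<subseteq> Y \<longrightarrow> Y = M"
proof -
  have "\<exists>M\<in>(\<lambda>M. scale d M) ` F. \<forall>Y\<in>(\<lambda>M. scale d M) ` F. M \<subseteq> Y \<longrightarrow> Y = M"
  proof (rule acc)
    fix M assume "M \<in> (\<lambda>M. scale d M) ` F"
    then show "subm A M \<and> M \<subseteq> A"
      using F d A_carrier by (auto simp: subm_scale)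
  qed (use ne in auto)
  then obtain M where M: "M \<in> F" "\<forall>Y\<in>F. scale d M \<subseteq> scale d Y \<longrightarrow> scale d Y = scale d M"
    by auto
  have "Y = M" if Y: "Y \<in> F" "M \<subseteq> Y" for Y
  proof -
    have c: "M \<subseteq> carrier Q" "Y \<subseteq> carrier Q" using F M(1) Y(1) subm_carrier by blast+
    then have "scale d Y = scale d M" using M(2) Y d by (simp add: scale_subset_iff)
    then show ?thesis using c d by (metis scale_subset_iff subset_antisym subset_refl)
  qed
  then show ?thesis using M(1) by blast
qed

text \<open>For a Noetherian ring, integral and almost integral elements agree; this description needs
  no polynomials.\<close>

definition S :: "'a set" where
  "S = {q \<in> carrier Q. \<exists>d\<in>A \<inter> Units Q. \<forall>i::nat. d \<otimes> q [^] i \<in> A}"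

definition C :: "'a set" where
  "C = {q \<in> carrier Q. \<forall>x\<in>S. q \<otimes> x \<in> A}"

lemma S_closed [simp]: "q \<in> S \<Longrightarrow> q \<in> carrier Q"
  by (simp add: S_def)

lemma S_denominator:
  assumes "q \<in> S"
  obtains d where "d \<in> A" "d \<in> Units Q" "\<And>i::nat. d \<otimes> q [^] i \<in> A"
  using assms unfolding S_def by blast

lemma S_memI: "d \<in> A \<Longrightarrow> d \<in> Units Q \<Longrightarrow> q \<in> carrier Q \<Longrightarrow> (\<And>i::nat. d \<otimes> q [^] i \<in> A) \<Longrightarrow> q \<in> S"
  unfolding S_def by blast

text \<open>A regular \<open>d\<close> in \<open>M\<close> is a common denominator for all powers of
  \<open>q\<close>, because every \<open>d q^i\<close> stays in \<open>M\<close>. This replaces the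
  determinant trick.\<close>

lemma stable_imp_S:
  assumes q: "q \<in> carrier Q" and M: "M \<subseteq> A" "M \<inter> Units Q \<noteq> {}" "\<And>x. x \<in> M \<Longrightarrow> q \<otimes> x \<in> M"
  shows "q \<in> S"
proof -
  obtain d where d: "d \<in> M" "d \<in> Units Q" using M by blast
  have "d \<otimes> q [^] i \<in> M" for i :: nat
  proof (induction i)
    case 0 then show ?case using d M by auto
  next
    case (Suc i)
    have "d \<in> carrier Q" using d by auto
    then have "d \<otimes> q [^] Suc i = q \<otimes> (d \<otimes> q [^] i)"
      using q by (simp add: m_ac)
    then show ?case using M(3)[OF Suc] by simp
  qed
  then show ?thesis using d(1,2) M(1) q unfolding S_def by blast
qed

lemma A_subset_S: "A \<subseteq> S"
proof
  fix q assume q: "q \<in> A"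
  have "\<one> \<in> A \<inter> Units Q" using A_one by simp
  then show "q \<in> S" using stable_imp_S[of q A] q A_mult by auto
qed

text \<open>A single module stable under both \<open>q\<close> and \<open>r\<close> shows that sums
  and products of almost integral elements are almost integral. \<open>Z\<close> consists of the
  common denominators of all monomials \<open>q^i r^j\<close>; it is regular because it contains the
  product of a denominator for \<open>q\<close> and one for \<open>r\<close>.\<close>

lemma S_pair:
  assumes q: "q \<in> S" and r: "r \<in> S"
  obtains Z where "subm A Z" "Z \<subseteq> A" "Z \<inter> Units Q \<noteq> {}"
    "\<And>z. z \<in> Z \<Longrightarrow> q \<otimes> z \<in> Z" "\<And>z. z \<in> Z \<Longrightarrow> r \<otimes> z \<in> Z"
proof -
  obtain d where d: "d \<in> A" "d \<in> Units Q" "\<And>i::nat. d \<otimes> q [^] i \<in> A"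
    using S_denominator[OF q] by blast
  obtain e where e: "e \<in> A" "e \<in> Units Q" "\<And>i::nat. e \<otimes> r [^] i \<in> A"
    using S_denominator[OF r] by blast
  have qr [simp]: "q \<in> carrier Q" "r \<in> carrier Q" using q r by auto
  define Z where "Z = {a \<in> A. \<forall>(i::nat) (j::nat). a \<otimes> (q [^] i \<otimes> r [^] j) \<in> A}"
  have ZA: "Z \<subseteq> A" by (auto simp: Z_def)
  have Zc: "z \<in> carrier Q" if "z \<in> Z" for z using that ZA by auto
  show ?thesis
  proof
    show "subm A Z"
      unfolding subm_def
    proof (intro conjI ballI)
      show "Z \<subseteq> carrier Q" using Zc by auto
      show "\<zero> \<in> Z" by (auto simp: Z_def A_zero)
      fix x y assume "x \<in> Z" "y \<in> Z"
      then show "x \<oplus> y \<in> Z" by (auto simp: Z_def A_add l_distr)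
    next
      fix t x assume "t \<in> A" "x \<in> Z"
      then show "t \<otimes> x \<in> Z" by (auto simp: Z_def A_mult m_assoc)
    qed
    show "Z \<subseteq> A" by (fact ZA)
    have "(d \<otimes> e) \<otimes> (q [^] i \<otimes> r [^] j) = (d \<otimes> q [^] i) \<otimes> (e \<otimes> r [^] j)" for i j :: nat
      using d(1) e(1) by (simp add: m_ac)
    then have "d \<otimes> e \<in> Z" using d e by (auto simp: Z_def A_mult)
    then show "Z \<inter> Units Q \<noteq> {}" using d e by auto
  next
    fix z assume z: "z \<in> Z"
    have *: "z \<otimes> (q [^] i \<otimes> r [^] j) \<in> A" for i j :: nat using z by (auto simp: Z_def)
    have "(q \<otimes> z) \<otimes> (q [^] i \<otimes> r [^] j) \<in> A" for i j :: nat
      using *[of "Suc i" j] Zc[OF z] by (simp add: m_ac)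
    moreover have "q \<otimes> z \<in> A" using *[of 1 0] Zc[OF z] by (simp add: m_comm)
    ultimately show "q \<otimes> z \<in> Z" by (simp add: Z_def)
    have "(r \<otimes> z) \<otimes> (q [^] i \<otimes> r [^] j) \<in> A" for i j :: nat
      using *[of i "Suc j"] Zc[OF z] by (simp add: m_ac)
    moreover have "r \<otimes> z \<in> A" using *[of 0 1] Zc[OF z] by (simp add: m_comm)
    ultimately show "r \<otimes> z \<in> Z" by (simp add: Z_def)
  qed
qed

lemma S_mult: assumes "q \<in> S" "r \<in> S" shows "q \<otimes> r \<in> S"
proof -
  obtain Z where Z: "subm A Z" "Z \<subseteq> A" "Z \<inter> Units Q \<noteq> {}"
    "\<And>z. z \<in> Z \<Longrightarrow> q \<otimes> z \<in> Z" "\<And>z. z \<in> Z \<Longrightarrow> r \<otimes> z \<in> Z" using S_pair[OF assms] by metis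
  have "(q \<otimes> r) \<otimes> z \<in> Z" if "z \<in> Z" for z
  proof -
    have "(q \<otimes> r) \<otimes> z = q \<otimes> (r \<otimes> z)" using assms that Z(2) A_closed by (auto simp: m_assoc)
    then show ?thesis using Z that by simp
  qed
  then show ?thesis using stable_imp_S[of "q \<otimes> r" Z] Z assms by auto
qed

lemma S_add: assumes "q \<in> S" "r \<in> S" shows "q \<oplus> r \<in> S"
proof -
  obtain Z where Z: "subm A Z" "Z \<subseteq> A" "Z \<inter> Units Q \<noteq> {}"
    "\<And>z. z \<in> Z \<Longrightarrow> q \<otimes> z \<in> Z" "\<And>z. z \<in> Z \<Longrightarrow> r \<otimes> z \<in> Z" using S_pair[OF assms] by metis
  have "(q \<oplus> r) \<otimes> z \<in> Z" if "z \<in> Z" for z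
  proof -
    have "(q \<oplus> r) \<otimes> z = q \<otimes> z \<oplus> r \<otimes> z"
      using assms that Z(2) A_closed by (auto simp: l_distr)
    then show ?thesis using Z that by (simp add: subm_add)
  qed
  then show ?thesis using stable_imp_S[of "q \<oplus> r" Z] Z assms by auto
qed

lemma S_carrier: "S \<subseteq> carrier Q" by auto

lemma S_one: "\<one> \<in> S" and S_zero: "\<zero> \<in> S" and S_neg: "\<ominus> \<one> \<in> S"
  using A_subset_S A_one A_zero A_neg by auto

lemma S_ring: "subm S S"
  using S_mult S_add S_zero by (auto simp: subm_def)

lemma subm_S_imp_A: "subm S M \<Longrightarrow> subm A M"
  using subm_mono A_subset_S by blast

lemma C_subset_A: "C \<subseteq> A"
  using S_one by (force simp: C_def)

lemma C_subm: "subm S C"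
  unfolding subm_def
proof (intro conjI ballI)
  show "C \<subseteq> carrier Q" by (auto simp: C_def)
  show "\<zero> \<in> C" by (auto simp: C_def A_zero)
  fix x y assume "x \<in> C" "y \<in> C"
  then show "x \<oplus> y \<in> C" by (auto simp: C_def A_add l_distr)
next
  fix t x assume t: "t \<in> S" and x: "x \<in> C"
  have "(t \<otimes> x) \<otimes> y \<in> A" if "y \<in> S" for y
  proof -
    have "(t \<otimes> x) \<otimes> y = x \<otimes> (t \<otimes> y)" using t x that by (auto simp: C_def m_ac)
    then show ?thesis using t x that S_mult by (auto simp: C_def)
  qed
  then show "t \<otimes> x \<in> C" using t x by (auto simp: C_def)
qed

lemma C_submA: "subm A C"
  using C_subm subm_S_imp_A by blast

section \<open>Monic equations and almost integral elements\<close>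

lemma eval_bounded:
  assumes "set r \<subseteq> A" "e \<in> carrier Q" "x \<in> carrier Q" "\<And>j. j < length r \<Longrightarrow> e \<otimes> x [^] j \<in> A"
  shows "e \<otimes> eval r x \<in> A"
  using assms
proof (induction r)
  case Nil then show ?case by (simp add: A_zero)
next
  case (Cons a r)
  have ev: "eval r x \<in> carrier Q" using Cons.prems A_carrier by (auto intro!: eval_in_carrier)
  have "e \<otimes> (a \<otimes> x [^] length r \<oplus> eval r x) = a \<otimes> (e \<otimes> x [^] length r) \<oplus> e \<otimes> eval r x"
    using ev Cons.prems by (auto simp: r_distr m_ac)
  moreover have "e \<otimes> x [^] length r \<in> A" "e \<otimes> eval r x \<in> A" "a \<in> A"
    using Cons by auto
  ultimately show ?case by (simp add: A_add A_mult)
qed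

text \<open>If \<open>s\<close> is a denominator of \<open>x\<close> and the equation has degree
  \<open>n\<close>, then \<open>s^n\<close> clears \<open>x^i\<close> for \<open>i < n\<close>.
  Every higher power is a combination of lower powers by the equation, so \<open>s^n\<close> clears
  it by induction.\<close>

lemma monic_root_imp_S:
  assumes r: "set r \<subseteq> A" and x: "x \<in> carrier Q" and root: "eval (\<one> # r) x = \<zero>"
  shows "x \<in> S"
proof -
  let ?n = "length r"
  obtain s where s: "s \<in> A" "s \<in> Units Q" "s \<otimes> x \<in> A" using fractions[OF x] by auto
  have sc: "s \<in> carrier Q" using s by simp
  have ev: "eval r x \<in> carrier Q" using r A_carrier x by (auto intro!: eval_in_carrier)
  have xn: "x [^] ?n = \<ominus> eval r x"
  proof -
    have "x [^] ?n \<oplus> eval r x = \<zero>" using root x by simp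
    then show ?thesis using ev x by (metis minus_equality nat_pow_closed a_comm)
  qed
  define d where "d = s [^] ?n"
  have d: "d \<in> A" "d \<in> Units Q" using s by (auto simp: d_def A_pow Units_pow_closed)
  have dc: "d \<in> carrier Q" using d by simp
  have "d \<otimes> x [^] i \<in> A" for i :: nat
  proof (induction i rule: less_induct)
    case (less i)
    show ?case
    proof (cases "i < ?n")
      case True
      have "d = s [^] (?n - i) \<otimes> s [^] i"
        unfolding d_def using sc True by (simp add: nat_pow_mult)
      then have "d \<otimes> x [^] i = s [^] (?n - i) \<otimes> (s \<otimes> x) [^] i"
        using sc x by (simp add: nat_pow_distrib m_assoc)
      then show ?thesis using s by (simp add: A_mult A_pow)
    next
      case False
      define k where "k = i - ?n"
      have i: "i = k + ?n" using False by (simp add: k_def)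
      have "d \<otimes> x [^] i = \<ominus> ((d \<otimes> x [^] k) \<otimes> eval r x)"
        using dc x ev by (simp add: i nat_pow_mult[symmetric] xn r_minus m_assoc)
      moreover have "(d \<otimes> x [^] k) \<otimes> eval r x \<in> A"
      proof (rule eval_bounded[OF r])
        fix j assume "j < length r"
        then have "d \<otimes> x [^] (k + j) \<in> A" using less i by simp
        then show "d \<otimes> x [^] k \<otimes> x [^] j \<in> A"
          using dc x by (simp add: nat_pow_mult[symmetric] m_assoc)
      qed (use dc x in auto)
      ultimately show ?thesis by (simp add: A_minus)
    qed
  qed
  then show ?thesis using S_memI d x by blast
qed

text \<open>The span of \<open>1, x, ..., x^(n-1)\<close> over \<open>A\<close>. The lists have
  fixed length and may begin with zeros, unlike the elements of \<open>univ_poly\<close>; this keeps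
  the set closed under addition.\<close>

definition powers_span :: "'a \<Rightarrow> nat \<Rightarrow> 'a set" where
  "powers_span x n = {eval r x | r. set r \<subseteq> A \<and> length r = n}"

lemma powers_span_0: "powers_span x 0 = {\<zero>}"
  by (auto simp: powers_span_def)

lemma powers_span_Suc:
  "powers_span x (Suc n) = {a \<otimes> x [^] n \<oplus> w | a w. a \<in> A \<and> w \<in> powers_span x n}"
proof -
  have "eval (a # r) x = a \<otimes> x [^] length r \<oplus> eval r x" for a r by simp
  note ev = this[symmetric]
  show ?thesis
  proof (intro subset_antisym subsetI)
    fix y assume "y \<in> powers_span x (Suc n)"
    then obtain a r where "a \<in> A" "set r \<subseteq> A" "length r = n" "y = eval (a # r) x"
      by (auto simp: powers_span_def length_Suc_conv simp del: eval.simps)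
    then show "y \<in> {a \<otimes> x [^] n \<oplus> w | a w. a \<in> A \<and> w \<in> powers_span x n}"
      by (auto simp: powers_span_def)
  next
    fix y assume "y \<in> {a \<otimes> x [^] n \<oplus> w | a w. a \<in> A \<and> w \<in> powers_span x n}"
    then obtain a r where "a \<in> A" "set r \<subseteq> A" "length r = n" "y = a \<otimes> x [^] n \<oplus> eval r x"
      by (auto simp: powers_span_def)
    then show "y \<in> powers_span x (Suc n)"
      unfolding powers_span_def using ev[of a r] by (intro CollectI exI[of _ "a # r"]) auto
  qed
qed

lemma powers_span_Suc': 
  assumes "x \<in> carrier Q" "powers_span x n \<subseteq> carrier Q"
  shows "powers_span x (Suc n) = msum (scale (x [^] n) A) (powers_span x n)"
proof -
  have "a \<otimes> x [^] n = x [^] n \<otimes> a" if "a \<in> A" for a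
    using that assms by (simp add: m_comm)
  then have "powers_span x (Suc n) = {x [^] n \<otimes> a \<oplus> w | a w. a \<in> A \<and> w \<in> powers_span x n}"
    unfolding powers_span_Suc by (intro Collect_cong) (metis (no_types))
  then show ?thesis
    by (auto simp: msum_def scale_def)
qed

lemma powers_span_subm: "x \<in> carrier Q \<Longrightarrow> subm A (powers_span x n)"
proof (induction n)
  case 0 then show ?case by (auto simp: powers_span_0 subm_def)
next
  case (Suc n)
  then show ?case
    using subm_carrier[OF Suc.IH]
    by (simp add: powers_span_Suc' subm_msum A_carrier subm_principal)
qed

lemma powers_span_mono:
  assumes "x \<in> carrier Q" "i \<le> j" shows "powers_span x i \<subseteq> powers_span x j"
  using assms(2)
proof (induction rule: dec_induct)
  case (step n)
  then show ?case
    using msum_upper2[OF subm_principal powers_span_subm, of "x [^] n" x n] assms(1)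
      powers_span_Suc'[OF assms(1), of n] subm_carrier[OF powers_span_subm[OF assms(1)]] by auto
qed auto

text \<open>The spans of the powers of \<open>x\<close> share the denominator \<open>d\<close>, so
  one of them is maximal. There \<open>x^n\<close> is a combination of lower powers, and moving it
  to the other side gives the monic equation.\<close>

lemma S_imp_monic_root:
  assumes "x \<in> S"
  obtains r where "set r \<subseteq> A" "eval (\<one> # r) x = \<zero>"
proof -
  have x: "x \<in> carrier Q" using assms by simp
  obtain d where d: "d \<in> A" "d \<in> Units Q" "\<And>i::nat. d \<otimes> x [^] i \<in> A"
    using S_denominator[OF assms] by blast
  have "\<exists>M\<in>range (powers_span x). \<forall>Y\<in>range (powers_span x). M \<subseteq> Y \<longrightarrow> Y = M"
  proof (rule acc_bounded[OF _ d(2)])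
    fix M assume "M \<in> range (powers_span x)"
    then show "subm A M \<and> scale d M \<subseteq> A"
      using powers_span_subm[OF x] eval_bounded[OF _ _ x d(3)] d(1)
      by (auto simp: mem_scale powers_span_def)
  qed auto
  then obtain n where n: "\<forall>k. powers_span x n \<subseteq> powers_span x k \<longrightarrow> powers_span x k = powers_span x n"
    by auto
  have "x [^] n \<in> powers_span x (Suc n)"
    using A_one subm_zero[OF powers_span_subm[OF x]] x unfolding powers_span_Suc
    by (intro CollectI exI[of _ \<one>] exI[of _ \<zero>]) auto
  then have "x [^] n \<in> powers_span x n"
    using n powers_span_mono[OF x, of n "Suc n"] by auto
  then obtain r where r: "set r \<subseteq> A" "length r = n" "x [^] n = eval r x"
    by (auto simp: powers_span_def)
  have "\<ominus> eval r x \<in> powers_span x n"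
    using subm_neg[OF powers_span_subm[OF x] A_neg] r by (auto simp: powers_span_def)
  then obtain r' where r': "set r' \<subseteq> A" "length r' = n" "\<ominus> eval r x = eval r' x"
    by (auto simp: powers_span_def)
  have "eval r x \<in> carrier Q" using r A_carrier x by (auto intro!: eval_in_carrier)
  then have "eval (\<one> # r') x = \<zero>"
    using r' r(3) x by (simp add: r'(3)[symmetric] r_neg)
  then show ?thesis using that r' by blast
qed

end

section \<open>Modules over the normalization\<close>

locale finite_normalization = local_fractions +
  assumes C_regular: "C \<inter> Units Q \<noteq> {}"
begin

section \<open>Chain condition and Nakayama's lemma inside the normalization\<close>

lemma acc_S:
  assumes "F \<noteq> {}" "\<And>M. M \<in> F \<Longrightarrow> subm A M \<and> M \<subseteq> S"
  shows "\<exists>M\<in>F. \<forall>N\<in>F. M \<subseteq> N \<longrightarrow> N = M"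
proof -
  obtain e where e: "e \<in> C" "e \<in> Units Q" using C_regular by blast
  show ?thesis
  proof (rule acc_bounded[OF assms(1) e(2)])
    fix M assume "M \<in> F"
    then show "subm A M \<and> scale e M \<subseteq> A"
      using assms(2)[of M] e(1) by (auto simp: C_def scale_def)
  qed
qed

text \<open>Multiplication by a regular element of \<open>C\<close> moves \<open>M\<close> into
  \<open>A\<close> and keeps it stable under \<open>q\<close>.\<close>

lemma stable_imp_S':
  assumes q: "q \<in> carrier Q" and M: "M \<subseteq> S" "M \<inter> Units Q \<noteq> {}" "\<And>x. x \<in> M \<Longrightarrow> q \<otimes> x \<in> M"
  shows "q \<in> S"
proof -
  obtain e where e: "e \<in> C" "e \<in> Units Q" using C_regular by blast
  obtain d where d: "d \<in> M" "d \<in> Units Q" using M by blast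
  show ?thesis
  proof (rule stable_imp_S[OF q, of "scale e M"])
    show "scale e M \<subseteq> A" using e(1) M(1) by (auto simp: C_def scale_def)
    have "e \<otimes> d \<in> scale e M" using d by (auto simp: scale_def)
    then show "scale e M \<inter> Units Q \<noteq> {}" using d e by blast
    fix x assume "x \<in> scale e M"
    then obtain y where y: "y \<in> M" "x = e \<otimes> y" by (auto simp: scale_def)
    then have "q \<otimes> x = e \<otimes> (q \<otimes> y)"
      using q e M(1) S_closed by (auto intro!: m_lcomm)
    then show "q \<otimes> x \<in> scale e M" using M(3)[OF y(1)] by (auto simp: scale_def)
  qed
qed

lemma regular_meets_A:
  assumes "subm S J" "J \<subseteq> S" "J \<inter> Units Q \<noteq> {}"
  obtains s where "s \<in> J" "s \<in> A" "s \<in> Units Q"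
proof -
  obtain e where e: "e \<in> C" "e \<in> Units Q" using C_regular by blast
  obtain d where d: "d \<in> J" "d \<in> Units Q" using assms by blast
  have "e \<otimes> d \<in> A" using e d assms(2) by (auto simp: C_def)
  moreover have "e \<otimes> d \<in> J" using e d assms(1) C_subset_A A_subset_S subm_smult by blast
  ultimately show ?thesis using that e d by blast
qed

text \<open>Nakayama's lemma in a form that avoids the product of \<^term>\<open>m\<close> and \<^term>\<open>M\<close>.\<close>

lemma nakayama:
  assumes N: "subm A N" and M: "subm A M" "M \<subseteq> S" and NM: "N \<subseteq> M" "N \<noteq> M"
  obtains N' where "subm A N'" "N \<subseteq> N'" "N' \<subseteq> M" "N' \<noteq> M" "\<And>a x. a \<in> m \<Longrightarrow> x \<in> M \<Longrightarrow> a \<otimes> x \<in> N'"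
proof -
  define F where "F = {N'. subm A N' \<and> N \<subseteq> N' \<and> N' \<subseteq> M \<and> N' \<noteq> M}"
  have "\<exists>N'\<in>F. \<forall>K\<in>F. N' \<subseteq> K \<longrightarrow> K = N'"
  proof (rule acc_S)
    show "F \<noteq> {}" using N NM by (auto simp: F_def)
  qed (use M in \<open>auto simp: F_def\<close>)
  then obtain N' where N': "subm A N'" "N \<subseteq> N'" "N' \<subseteq> M" "N' \<noteq> M"
    and max: "\<And>K. K \<in> F \<Longrightarrow> N' \<subseteq> K \<Longrightarrow> K = N'" by (auto simp: F_def)
  have Mc: "M \<subseteq> carrier Q" using M(1) subm_carrier by blast
  obtain x0 where x0: "x0 \<in> M" "x0 \<notin> N'" using N'(3,4) by blast
  have x0c: "x0 \<in> carrier Q" using x0 Mc by blast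
  \<comment> \<open>\<open>M\<close> is simple modulo \<open>N'\<close>: by maximality of
    \<open>N'\<close>, any element outside it generates \<open>M\<close> modulo
    \<open>N'\<close>.\<close>
  have full: "M = msum N' (scale y A)" if y: "y \<in> M" "y \<notin> N'" for y
  proof (rule ccontr)
    assume ne: "M \<noteq> msum N' (scale y A)"
    have yc: "y \<in> carrier Q" using y Mc by blast
    have sub: "N' \<subseteq> msum N' (scale y A)"
      using msum_upper1 N'(1) subm_principal[OF yc] by blast
    have "msum N' (scale y A) \<in> F"
      unfolding F_def
    proof (intro CollectI conjI)
      show "subm A (msum N' (scale y A))"
        by (intro subm_msum A_carrier N'(1) subm_principal yc)
      show "N \<subseteq> msum N' (scale y A)" using sub N'(2) by blast
      show "msum N' (scale y A) \<subseteq> M"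
        by (intro msum_least[OF M(1)] N'(3) principal_least[OF M(1) y(1)])
    qed (use ne in auto)
    then have "msum N' (scale y A) = N'" using max sub by blast
    moreover have "y \<in> msum N' (scale y A)"
      using msum_upper2[OF N'(1) subm_principal[OF yc]] principal_self[OF yc] by blast
    ultimately show False using y by blast
  qed
  \<comment> \<open>If \<open>a x0\<close> were outside \<open>N'\<close>, it would generate
    \<open>M\<close> modulo \<open>N'\<close>. Then \<open>(1 - r a) x0\<close> would lie in
    \<open>N'\<close> for some \<open>r\<close> in \<open>A\<close>, and \<open>1 - r a\<close> is
    invertible.\<close>
  have ax0: "a \<otimes> x0 \<in> N'" if a: "a \<in> m" for a
  proof (rule ccontr)
    assume "a \<otimes> x0 \<notin> N'"
    have aA: "a \<in> A" using a m_ideal by blast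
    then have "a \<otimes> x0 \<in> M" using M(1) x0 subm_smult by blast
    then have "x0 \<in> msum N' (scale (a \<otimes> x0) A)" using full \<open>a \<otimes> x0 \<notin> N'\<close> x0(1) by blast
    then obtain n r where nr: "n \<in> N'" "r \<in> A" "x0 = n \<oplus> (a \<otimes> x0) \<otimes> r"
      by (auto simp: mem_msum mem_scale)
    have nc: "n \<in> carrier Q" using nr N'(3) Mc by blast
    have ra: "r \<otimes> a \<in> m" using nr(2) a m_ideal(1) subm_smult by blast
    have "x0 \<ominus> (r \<otimes> a) \<otimes> x0 = (n \<oplus> (a \<otimes> x0) \<otimes> r) \<ominus> (r \<otimes> a) \<otimes> x0" using nr(3) by simp
    also have "\<dots> = n" using nc x0c A_closed[OF aA] A_closed[OF nr(2)] by algebra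
    finally have "x0 \<ominus> (r \<otimes> a) \<otimes> x0 \<in> N'" using nr by simp
    then show False using subm_cancel_one_minus[OF N'(1) ra x0c] x0 by blast
  qed
  show ?thesis
  proof (rule that[OF N'])
    fix a x assume a: "a \<in> m" and x: "x \<in> M"
    have aA: "a \<in> A" using a m_ideal by blast
    obtain n r where nr: "n \<in> N'" "r \<in> A" "x = n \<oplus> x0 \<otimes> r"
      using x full[OF x0] by (auto simp: mem_msum mem_scale)
    have nc: "n \<in> carrier Q" using nr N'(3) Mc by blast
    have "a \<otimes> x = a \<otimes> n \<oplus> r \<otimes> (a \<otimes> x0)"
      using nr(3) nc x0c A_closed[OF aA] A_closed[OF nr(2)] by algebra
    moreover have "a \<otimes> n \<in> N'" "r \<otimes> (a \<otimes> x0) \<in> N'"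
      using subm_smult[OF N'(1)] nr aA ax0[OF a] by blast+
    ultimately show "a \<otimes> x \<in> N'" using subm_add[OF N'(1)] by simp
  qed
qed

lemma S_pow: "x \<in> S \<Longrightarrow> x [^] (n::nat) \<in> S"
  by (induction n) (auto simp: S_one S_mult)

lemma eval_S: "set r \<subseteq> S \<Longrightarrow> x \<in> S \<Longrightarrow> eval r x \<in> S"
  by (induction r) (auto simp: S_zero intro!: S_add S_mult S_pow)

lemma S_principal: "x \<in> carrier Q \<Longrightarrow> subm S (scale x S)"
  using subm_scale S_carrier S_ring by blast

lemma S_principal_self: "x \<in> carrier Q \<Longrightarrow> x \<in> scale x S"
  using S_one by (force simp: mem_scale)

lemma S_principal_least: "subm S M \<Longrightarrow> x \<in> M \<Longrightarrow> scale x S \<subseteq> M"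
  using subm_smult[of S M] subm_carrier[of S M] S_closed by (force simp: mem_scale m_comm)

section \<open>Maximal ideals of the normalization and their multipliers\<close>

definition maximal_in_S :: "'a set \<Rightarrow> bool" where
  "maximal_in_S M \<longleftrightarrow> subm S M \<and> M \<subseteq> S \<and> M \<noteq> S \<and> (\<forall>N. subm S N \<longrightarrow> M \<subseteq> N \<longrightarrow> N \<subseteq> S \<longrightarrow> N = M \<or> N = S)"

lemma maximal_in_S_comaximal:
  assumes M: "maximal_in_S M" and w: "w \<in> S" "w \<notin> M"
  obtains x t where "x \<in> M" "t \<in> S" "\<one> = x \<oplus> t \<otimes> w"
proof -
  have M': "subm S M" "M \<subseteq> S" using M by (auto simp: maximal_in_S_def)
  have wc: "w \<in> carrier Q" using w by simp
  let ?N = "msum M (scale w S)"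
  have "subm S ?N" by (intro subm_msum S_carrier M' S_principal wc)
  moreover have "M \<subseteq> ?N" "w \<in> ?N"
    using msum_upper1[OF M'(1) S_principal[OF wc]] msum_upper2[OF M'(1) S_principal[OF wc]]
      S_principal_self[OF wc] by blast+
  moreover have "?N \<subseteq> S" by (intro msum_least[OF S_ring] M' S_principal_least[OF S_ring] w)
  ultimately have "?N = S" using M w(2) unfolding maximal_in_S_def by blast
  then have "\<one> \<in> ?N" using S_one by simp
  then obtain x t where "x \<in> M" "t \<in> S" "\<one> = x \<oplus> w \<otimes> t" by (auto simp: mem_msum mem_scale)
  then show ?thesis using that wc by (simp add: m_comm)
qed

lemma one_notin_maximal: "maximal_in_S M \<Longrightarrow> \<one> \<notin> M"
proof
  assume M: "maximal_in_S M" and "\<one> \<in> M"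
  then have "t \<in> M" if "t \<in> S" for t
    using that subm_smult[of S M t \<one>] by (auto simp: maximal_in_S_def)
  then show False using M by (auto simp: maximal_in_S_def)
qed

lemma maximal_in_S_prime:
  assumes M: "maximal_in_S M" and xw: "x \<in> S" "w \<in> S" "x \<otimes> w \<in> M" "w \<notin> M"
  shows "x \<in> M"
proof -
  have M': "subm S M" "M \<subseteq> S" using M by (auto simp: maximal_in_S_def)
  obtain u t where u: "u \<in> M" "t \<in> S" "\<one> = u \<oplus> t \<otimes> w"
    using maximal_in_S_comaximal[OF M xw(2,4)] by blast
  have uc: "u \<in> carrier Q" "t \<in> carrier Q" "x \<in> carrier Q" "w \<in> carrier Q"
    using u xw M' by auto
  have "x = x \<otimes> \<one>" using uc by simp
  also have "\<dots> = x \<otimes> (u \<oplus> t \<otimes> w)" using u(3) by simp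
  also have "\<dots> = x \<otimes> u \<oplus> t \<otimes> (x \<otimes> w)" using uc by algebra
  also have "\<dots> \<in> M" by (intro subm_add[OF M'(1)] subm_smult[OF M'(1)] xw u)
  finally show ?thesis .
qed

text \<open>The annihilator of \<^term>\<open>b\<close> modulo \<^term>\<open>s\<close>, chosen maximal among those inside \<^term>\<open>M\<close>, is an
  associated prime of \<^term>\<open>s\<close> localised at \<^term>\<open>M\<close>; dimension one forces it to be \<^term>\<open>M\<close>.\<close>

lemma maximal_in_S_multiplier:
  assumes M: "maximal_in_S M" and reg: "M \<inter> Units Q \<noteq> {}"
  obtains q where "q \<in> carrier Q" "q \<notin> S" "\<And>x. x \<in> M \<Longrightarrow> q \<otimes> x \<in> S"
proof -
  have M': "subm S M" "M \<subseteq> S" using M by (auto simp: maximal_in_S_def)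
  obtain s where s: "s \<in> M" "s \<in> A" "s \<in> Units Q" using regular_meets_A[OF M' reg] by blast
  have sc: "s \<in> carrier Q" using s by auto
  define ann where "ann b = {x \<in> S. x \<otimes> b \<in> scale s S}" for b
  have sS: "subm S (scale s S)" by (rule S_principal[OF sc])
  have ann_subm: "subm S (ann b)" if b: "b \<in> S" for b
    unfolding subm_def
  proof (intro conjI ballI)
    show "ann b \<subseteq> carrier Q" by (auto simp: ann_def)
    show "\<zero> \<in> ann b" using b S_zero subm_zero[OF sS] by (auto simp: ann_def)
    fix x y assume "x \<in> ann b" "y \<in> ann b"
    then show "x \<oplus> y \<in> ann b"
      using b subm_add[OF sS] by (auto simp: ann_def l_distr S_add)
  next
    fix t x assume "t \<in> S" "x \<in> ann b"
    then show "t \<otimes> x \<in> ann b"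
      using b subm_smult[OF sS] by (auto simp: ann_def m_assoc S_mult)
  qed
  define F where "F = {ann b | b. b \<in> S \<and> ann b \<subseteq> M}"
  have "\<exists>P\<in>F. \<forall>K\<in>F. P \<subseteq> K \<longrightarrow> K = P"
  proof (rule acc_S)
    \<comment> \<open>The family is nonempty because \<open>ann \<one>\<close> lies in
      \<open>scale s S\<close>, and \<open>s\<close> was taken from \<open>M\<close>.\<close>
    have "ann \<one> \<subseteq> M"
      using S_principal_least[OF M'(1) s(1)] by (auto simp: ann_def)
    then show "F \<noteq> {}" using S_one by (auto simp: F_def)
    fix P assume "P \<in> F"
    then show "subm A P \<and> P \<subseteq> S"
      using ann_subm subm_S_imp_A by (auto simp: F_def ann_def)
  qed
  then obtain b where b: "b \<in> S" "ann b \<subseteq> M" and max': "\<forall>K\<in>F. ann b \<subseteq> K \<longrightarrow> K = ann b"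
    unfolding F_def by blast
  have max: "ann b' = ann b" if "b' \<in> S" "ann b' \<subseteq> M" "ann b \<subseteq> ann b'" for b'
    using max' that unfolding F_def by blast
  define P where "P = ann b"
  have bc: "b \<in> carrier Q" using b by simp
  have P: "subm S P" "P \<subseteq> M" "P \<subseteq> S" using ann_subm b M' by (auto simp: P_def)
  have oneP: "\<one> \<notin> P" using one_notin_maximal[OF M] P by blast
  have ann_mult: "ann b \<subseteq> ann (w \<otimes> b)" if "w \<in> S" for w
  proof
    fix x assume x: "x \<in> ann b"
    then have "x \<otimes> (w \<otimes> b) = w \<otimes> (x \<otimes> b)" using that bc by (auto simp: ann_def intro!: m_lcomm)
    then show "x \<in> ann (w \<otimes> b)" using x subm_smult[OF sS that] by (auto simp: ann_def)
  qed
  have prime: "u \<in> P \<or> v \<in> P" if uv: "u \<in> S" "v \<in> S" "u \<otimes> v \<in> P" for u v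
  proof (cases "ann (v \<otimes> b) \<subseteq> M")
    case True
    have "ann (v \<otimes> b) = P" unfolding P_def by (rule max[OF S_mult[OF uv(2) b(1)] True ann_mult[OF uv(2)]])
    moreover have "u \<in> ann (v \<otimes> b)" using uv b by (auto simp: ann_def P_def m_assoc)
    ultimately show ?thesis by blast
  next
    case False
    then obtain w where w: "w \<in> S" "w \<otimes> (v \<otimes> b) \<in> scale s S" "w \<notin> M" by (auto simp: ann_def)
    \<comment> \<open>\<open>w\<close> lies outside the prime \<open>M\<close>, so passing from
      \<open>b\<close> to \<open>w b\<close> keeps the annihilator inside \<open>M\<close>. It
      contains \<open>ann b\<close>, hence equals it by maximality, and the choice of
      \<open>w\<close> puts \<open>v\<close> in it.\<close>
    have "ann (w \<otimes> b) \<subseteq> M"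
    proof
      fix x assume x: "x \<in> ann (w \<otimes> b)"
      then have "x \<otimes> w \<in> ann b" using w b by (auto simp: ann_def m_assoc S_mult)
      then show "x \<in> M" using maximal_in_S_prime[OF M _ w(1) _ w(3)] x b(2) by (auto simp: ann_def)
    qed
    then have "ann (w \<otimes> b) = P"
      unfolding P_def by (intro max[OF S_mult[OF w(1) b(1)] _ ann_mult[OF w(1)]])
    moreover have "v \<otimes> (w \<otimes> b) = w \<otimes> (v \<otimes> b)" using uv w bc by (auto intro!: m_lcomm)
    then have "v \<in> ann (w \<otimes> b)" using uv w by (auto simp: ann_def)
    ultimately show ?thesis by blast
  qed
  have "s \<in> P" using s A_subset_S sc b(1) by (auto simp: P_def ann_def mem_scale)
  have Pm: "P \<inter> A = m"
  proof (rule dim1)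
    show "subm A (P \<inter> A)" using subm_Int subm_S_imp_A P(1) A_ring by blast
    show "P \<inter> A \<inter> Units Q \<noteq> {}" using \<open>s \<in> P\<close> s by blast
    fix a c assume "a \<in> A" "c \<in> A" "a \<otimes> c \<in> P \<inter> A"
    then show "a \<in> P \<inter> A \<or> c \<in> P \<inter> A" using prime[of a c] A_subset_S by blast
  qed (use oneP in auto)
  have "y \<in> P" if y: "y \<in> M" for y
  proof (rule ccontr)
    assume yP: "y \<notin> P"
    have yS: "y \<in> S" and yc: "y \<in> carrier Q" using y M' by auto
    \<comment> \<open>Incomparability through a monic polynomial of least degree whose value at
      \<open>y\<close> lies in \<open>P\<close>. If its constant term is in \<open>m\<close>, which
      is inside \<open>P\<close>, then \<open>y\<close> can be divided out because \<open>P\<close>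
      is prime, and the degree drops. If not, the constant term is a unit of \<open>A\<close> that
      lies in \<open>M\<close>.\<close>
    define D where "D r \<longleftrightarrow> set r \<subseteq> A \<and> eval (\<one> # r) y \<in> P" for r
    have "\<exists>r. D r"
      using S_imp_monic_root[OF yS] subm_zero[OF P(1)] unfolding D_def by metis
    then obtain r where r: "D r" "\<And>r'. D r' \<Longrightarrow> length r \<le> length r'"
      using ex_has_least_nat[of D _ length] by blast
    show False
    proof (cases r rule: rev_cases)
      case Nil
      then have "eval [\<one>] y \<in> P" using r by (simp add: D_def)
      then show False using oneP yc by simp
    next
      case (snoc r' a)
      have r'A: "set r' \<subseteq> A" and a: "a \<in> A" using r snoc by (auto simp: D_def)
      let ?e = "eval (\<one> # r') y"
      have eS: "?e \<in> S" using r'A A_subset_S S_one yS by (intro eval_S) auto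
      have ec: "?e \<in> carrier Q" using eS by (rule S_closed)
      have *: "?e \<otimes> y \<oplus> a \<in> P"
        using r snoc eval_append_aux[of "\<one> # r'" a y] r'A A_carrier a yc unfolding D_def
        by (auto simp del: eval.simps)
      show False
      proof (cases "a \<in> m")
        case True
        then have "a \<in> P" using Pm by blast
        have "(?e \<otimes> y \<oplus> a) \<ominus> a = ?e \<otimes> y" using ec yc A_closed[OF a] by algebra
        then have "?e \<otimes> y \<in> P" using subm_diff[OF P(1) S_neg * \<open>a \<in> P\<close>] by simp
        then have "?e \<in> P" using prime[OF eS yS] yP by blast
        then have "D r'" using r'A by (simp add: D_def del: eval.simps)
        then show False using r(2)[of r'] snoc by simp
      next
        case False
        have "?e \<otimes> y \<in> M" using subm_smult[OF M'(1) eS y] .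
        moreover have "(?e \<otimes> y \<oplus> a) \<ominus> ?e \<otimes> y = a" using ec yc A_closed[OF a] by algebra
        ultimately have "a \<in> M" using subm_diff[OF M'(1) S_neg, of "?e \<otimes> y \<oplus> a" "?e \<otimes> y"] * P by auto
        moreover obtain c where "c \<in> A" "a \<otimes> c = \<one>" using A_local[OF a False] by blast
        ultimately have "\<one> \<in> M"
          using subm_smult[OF M'(1), of c a] A_subset_S a by (auto simp: m_comm)
        then show False using one_notin_maximal[OF M] by blast
      qed
    qed
  qed
  then have PM: "P = M" using P by blast
  \<comment> \<open>The multiplier is \<open>b/s\<close>. It sends \<open>M = ann b\<close> into
    \<open>S\<close>, and it is not in \<open>S\<close> because \<open>\<one>\<close> does not
    annihilate \<open>b\<close> modulo \<open>s\<close>.\<close>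
  have q: "inv s \<otimes> b \<in> carrier Q" using s bc by simp
  show ?thesis
  proof (rule that[OF q])
    show "inv s \<otimes> b \<notin> S"
    proof
      assume *: "inv s \<otimes> b \<in> S"
      have "b = s \<otimes> (inv s \<otimes> b)" using Units_cancel'[OF s(3) bc] by simp
      then have "b \<in> scale s S" using * by (auto simp: mem_scale)
      then have "\<one> \<in> P" using S_one bc by (auto simp: P_def ann_def)
      then show False using oneP by blast
    qed
    fix x assume "x \<in> M"
    then have "x \<in> ann b" using PM P_def by blast
    then obtain t where t: "x \<in> S" "t \<in> S" "x \<otimes> b = s \<otimes> t" by (auto simp: ann_def mem_scale)
    have "(inv s \<otimes> b) \<otimes> x = inv s \<otimes> (x \<otimes> b)"
      using S_closed[OF t(1)] Units_inv_closed[OF s(3)] bc by (simp add: m_ac)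
    also have "\<dots> = t" using t s Units_cancel[OF s(3)] by simp
    finally show "(inv s \<otimes> b) \<otimes> x \<in> S" using t by simp
  qed
qed

text \<open>Noetherian induction on \<^term>\<open>J\<close>.  For a maximal ideal \<^term>\<open>M\<close> above \<^term>\<open>J\<close> and \<^term>\<open>q\<close> outside \<^term>\<open>S\<close> with
  \<open>qM \<subseteq> S\<close>, the module \<open>J + qJ\<close> is larger than \<^term>\<open>J\<close>.  The map \<open>L \<mapsto> L + qL\<close> is injective on modules
  inside \<^term>\<open>M\<close>, and the remaining modules above \<^term>\<open>J\<close> contain \<open>J + qJ\<close>.\<close>

lemma finite_S_overmodules:
  assumes "subm S J" "J \<subseteq> S" "J \<inter> Units Q \<noteq> {}"
  shows "finite {L. subm S L \<and> J \<subseteq> L \<and> L \<subseteq> S}"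
proof (rule ccontr)
  assume inf: "infinite {L. subm S L \<and> J \<subseteq> L \<and> L \<subseteq> S}"
  define F where "F = {J. subm S J \<and> J \<subseteq> S \<and> J \<inter> Units Q \<noteq> {} \<and>
    infinite {L. subm S L \<and> J \<subseteq> L \<and> L \<subseteq> S}}"
  have "\<exists>J\<in>F. \<forall>N\<in>F. J \<subseteq> N \<longrightarrow> N = J"
    using assms inf subm_S_imp_A by (intro acc_S) (auto simp: F_def)
  then obtain J where J: "subm S J" "J \<subseteq> S" "J \<inter> Units Q \<noteq> {}"
      and Jinf: "infinite {L. subm S L \<and> J \<subseteq> L \<and> L \<subseteq> S}"
      and Jmax: "\<forall>N\<in>F. J \<subseteq> N \<longrightarrow> N = J"
    unfolding F_def by blast
  have JS: "J \<noteq> S"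
  proof
    assume "J = S"
    then have "{L. subm S L \<and> J \<subseteq> L \<and> L \<subseteq> S} \<subseteq> {S}" by blast
    then show False using Jinf finite_subset by blast
  qed
  define G where "G = {M. subm S M \<and> J \<subseteq> M \<and> M \<subseteq> S \<and> M \<noteq> S}"
  have "\<exists>M\<in>G. \<forall>N\<in>G. M \<subseteq> N \<longrightarrow> N = M"
    using J JS subm_S_imp_A by (intro acc_S) (auto simp: G_def)
  then obtain M where M: "subm S M" "J \<subseteq> M" "M \<subseteq> S" "M \<noteq> S" and "\<forall>N\<in>G. M \<subseteq> N \<longrightarrow> N = M"
    unfolding G_def by blast
  then have Mmax: "maximal_in_S M"
    unfolding maximal_in_S_def G_def by blast
  have Mreg: "M \<inter> Units Q \<noteq> {}" using J(3) M(2) by blast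
  obtain q where q: "q \<in> carrier Q" "q \<notin> S" "\<And>x. x \<in> M \<Longrightarrow> q \<otimes> x \<in> S"
    using maximal_in_S_multiplier[OF Mmax Mreg] by blast
  obtain x0 where x0: "x0 \<in> M" "q \<otimes> x0 \<notin> M"
    using stable_imp_S'[OF q(1) M(3) Mreg] q(2) by blast
  obtain x1 t where x1: "x1 \<in> M" "t \<in> S" "\<one> = x1 \<oplus> t \<otimes> (q \<otimes> x0)"
    using maximal_in_S_comaximal[OF Mmax q(3)[OF x0(1)] x0(2)] by blast
  define x2 where "x2 = t \<otimes> x0"
  have x2: "x2 \<in> M" using subm_smult[OF M(1) x1(2) x0(1)] by (simp add: x2_def)
  have c: "x0 \<in> carrier Q" "x1 \<in> carrier Q" "x2 \<in> carrier Q" "t \<in> carrier Q"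
    using x0 x1 x2 M(3) by auto
  \<comment> \<open>Invertibility of \<open>M\<close> in explicit form: \<open>\<one>\<close> lies
    in \<open>M + qM\<close>. An element \<open>x\<close> of \<open>L\<close> is recovered from
    \<open>x\<close> and \<open>q x\<close> as \<open>x1 x + x2 (q x)\<close>, which is what makes
    \<open>g\<close> injective.\<close>
  have one: "\<one> = x1 \<oplus> q \<otimes> x2" using x1(3) q(1) c by (simp add: x2_def m_lcomm)
  define J' where "J' = msum J (scale q J)"
  have J'S: "subm S J'" unfolding J'_def by (intro subm_msum S_carrier J subm_scale q)
  have J'sub: "J' \<subseteq> S"
    unfolding J'_def
  proof (rule msum_least[OF S_ring J(2)])
    show "scale q J \<subseteq> S" using q(3) M(2) by (auto simp: scale_def)
  qed
  have qJ: "subm S (scale q J)" by (intro subm_scale S_carrier J q)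
  have JJ': "J \<subseteq> J'" unfolding J'_def by (rule msum_upper1[OF J(1) qJ])
  have qJJ': "scale q J \<subseteq> J'" unfolding J'_def by (rule msum_upper2[OF J(1) qJ])
  have "J' \<noteq> J"
    using stable_imp_S'[OF q(1) J(2,3)] q(2) qJJ' by (auto simp: scale_def)
  moreover have "J' \<inter> Units Q \<noteq> {}" using JJ' J(3) by blast
  ultimately have fin: "finite {L. subm S L \<and> J' \<subseteq> L \<and> L \<subseteq> S}"
    using Jmax J'S J'sub JJ' unfolding F_def by blast
  define H where "H = {L. subm S L \<and> J \<subseteq> L \<and> L \<subseteq> M}"
  define g where "g L = msum L (scale q L)" for L
  have ginj: "inj_on g H"
  proof -
    have "L \<subseteq> L'" if L: "L \<in> H" and L': "L' \<in> H" and eq: "g L = g L'" for L L'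
    proof
      fix x assume x: "x \<in> L"
      have sL: "subm S L" "L \<subseteq> M" "subm S L'" "L' \<subseteq> M" using L L' by (auto simp: H_def)
      have car: "y \<in> carrier Q" if "y \<in> L \<or> y \<in> L'" for y
        using that sL M(3) S_closed by blast
      have qx: "subm S (scale q L)" by (intro subm_scale S_carrier sL q)
      have "x \<in> g L" using msum_upper1[OF sL(1) qx] x unfolding g_def by blast
      then obtain a b where ab: "a \<in> L'" "b \<in> L'" "x = a \<oplus> q \<otimes> b"
        unfolding eq unfolding g_def by (auto simp: mem_msum mem_scale)
      have "q \<otimes> x \<in> g L" using msum_upper2[OF sL(1) qx] x unfolding g_def by (auto simp: scale_def)
      then obtain d e where de: "d \<in> L'" "e \<in> L'" "q \<otimes> x = d \<oplus> q \<otimes> e"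
        unfolding eq unfolding g_def by (auto simp: mem_msum mem_scale)
      have cc: "a \<in> carrier Q" "b \<in> carrier Q" "d \<in> carrier Q" "e \<in> carrier Q" "x \<in> carrier Q"
        using car ab de x by auto
      have "x = (x1 \<oplus> q \<otimes> x2) \<otimes> x" using cc by (simp add: one[symmetric])
      also have "\<dots> = x1 \<otimes> x \<oplus> x2 \<otimes> (q \<otimes> x)" using cc c q(1) by algebra
      also have "\<dots> = x1 \<otimes> (a \<oplus> q \<otimes> b) \<oplus> x2 \<otimes> (d \<oplus> q \<otimes> e)" using ab(3) de(3) by simp
      also have "\<dots> = (x1 \<otimes> a \<oplus> (q \<otimes> x1) \<otimes> b) \<oplus> (x2 \<otimes> d \<oplus> (q \<otimes> x2) \<otimes> e)"
        using cc c q(1) by algebra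
      also have "\<dots> \<in> L'"
        using x1(1) x2 M(3) q(3) ab de by (intro subm_add[OF sL(3)] subm_smult[OF sL(3)]) auto
      finally show "x \<in> L'" .
    qed
    then show ?thesis by (auto simp: inj_on_def)
  qed
  have gsub: "g ` H \<subseteq> {L. subm S L \<and> J' \<subseteq> L \<and> L \<subseteq> S}"
  proof
    fix L' assume "L' \<in> g ` H"
    then obtain L where L: "subm S L" "J \<subseteq> L" "L \<subseteq> M" and L': "L' = g L" by (auto simp: H_def)
    have "subm S (g L)" unfolding g_def by (intro subm_msum S_carrier L subm_scale q)
    moreover have "J' \<subseteq> g L" using L(2) unfolding J'_def g_def by (auto simp: msum_def scale_def)
    moreover have "scale q L \<subseteq> S" using q(3) L(3) by (auto simp: scale_def)
    then have "g L \<subseteq> S" unfolding g_def using msum_least[OF S_ring] L(3) M(3) by blast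
    ultimately show "L' \<in> {L. subm S L \<and> J' \<subseteq> L \<and> L \<subseteq> S}" using L' by blast
  qed
  have finH: "finite H" by (rule finite_imageD[OF finite_subset[OF gsub fin] ginj])
  have "{L. subm S L \<and> J \<subseteq> L \<and> L \<subseteq> S} \<subseteq> H \<union> {L. subm S L \<and> J' \<subseteq> L \<and> L \<subseteq> S}"
  proof
    fix L assume "L \<in> {L. subm S L \<and> J \<subseteq> L \<and> L \<subseteq> S}"
    then have L: "subm S L" "J \<subseteq> L" "L \<subseteq> S" by auto
    show "L \<in> H \<union> {L. subm S L \<and> J' \<subseteq> L \<and> L \<subseteq> S}"
    proof (cases "L \<subseteq> M")
      case True
      then show ?thesis using L by (simp add: H_def)
    next
      case False
      then obtain l where l: "l \<in> L" "l \<notin> M" by blast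
      obtain x t where xt: "x \<in> M" "t \<in> S" "\<one> = x \<oplus> t \<otimes> l"
        using maximal_in_S_comaximal[OF Mmax _ l(2)] l(1) L(3) by blast
      \<comment> \<open>Since \<open>L\<close> is comaximal with \<open>M\<close>, multiplying
        \<open>1 = x + t l\<close> by \<open>q j\<close> splits it into \<open>(q x) j\<close>,
        which is in \<open>L\<close> because \<open>j\<close> is, and \<open>(q j) t l\<close>,
        which is in \<open>L\<close> because \<open>l\<close> is.\<close>
      have "scale q J \<subseteq> L"
      proof
        fix y assume "y \<in> scale q J"
        then obtain j where j: "j \<in> J" "y = q \<otimes> j" by (auto simp: scale_def)
        have cc: "x \<in> carrier Q" "t \<in> carrier Q" "l \<in> carrier Q" "j \<in> carrier Q"
          using xt l j J M L by auto
        have "y = q \<otimes> (j \<otimes> (x \<oplus> t \<otimes> l))" using j(2) cc by (simp add: xt(3)[symmetric])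
        also have "\<dots> = (q \<otimes> x) \<otimes> j \<oplus> ((q \<otimes> j) \<otimes> t) \<otimes> l" using cc q(1) by algebra
        also have "\<dots> \<in> L"
        proof -
          have "(q \<otimes> x) \<otimes> j \<in> L" using subm_smult[OF L(1) q(3)[OF xt(1)]] j L(2) by blast
          moreover have "q \<otimes> j \<in> S" using q(3) j(1) M(2) by blast
          then have "((q \<otimes> j) \<otimes> t) \<otimes> l \<in> L" using subm_smult[OF L(1) S_mult[OF _ xt(2)] l(1)] by blast
          ultimately show ?thesis using subm_add[OF L(1)] by blast
        qed
        finally show "y \<in> L" .
      qed
      then have "J' \<subseteq> L" unfolding J'_def using msum_least[OF L(1,2)] by blast
      then show ?thesis using L by blast
    qed
  qed
  then show False using Jinf finite_subset[OF _ finite_UnI[OF finH fin]] by blast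
qed

section \<open>Generic elements and principal reductions\<close>

text \<open>Let \<open>W = aS + bS\<close> and let \<open>x\<close> in \<open>m\<close> be regular.
  Only finitely many \<open>S\<close>-modules lie between \<open>xW\<close> and \<open>S\<close>, so
  among infinitely many \<open>u\<close> with different residues two give the same module
  \<open>(a + ub)S + xW\<close>. It contains the difference \<open>(u - v)b\<close> with
  \<open>u - v\<close> invertible in \<open>A\<close>, hence \<open>b\<close> and \<open>a\<close>,
  so it is all of \<open>W\<close>. Nakayama then removes \<open>xW\<close>.\<close>

lemma generic_generator_two:
  assumes a: "a \<in> A" "a \<in> Units Q" and b: "b \<in> A"
  obtains u where "u \<in> A" "a \<in> scale (a \<oplus> u \<otimes> b) S" "b \<in> scale (a \<oplus> u \<otimes> b) S"
proof -
  have ac: "a \<in> carrier Q" and bc: "b \<in> carrier Q" using a b by auto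
  obtain x where x: "x \<in> m" "x \<in> Units Q" using m_regular by blast
  have xA: "x \<in> A" and xc: "x \<in> carrier Q" using x m_ideal by auto
  obtain U where U: "infinite U" "U \<subseteq> A" "\<forall>u\<in>U. \<forall>v\<in>U. u \<noteq> v \<longrightarrow> u \<ominus> v \<notin> m"
    using infinite_residues by blast
  define W where "W = msum (scale a S) (scale b S)"
  have WS: "subm S W" unfolding W_def by (intro subm_msum S_carrier S_principal ac bc)
  have W: "W \<subseteq> S"
    unfolding W_def using a b A_subset_S by (intro msum_least[OF S_ring] S_principal_least[OF S_ring]) auto
  have aW: "a \<in> W" and bW: "b \<in> W"
    using msum_upper1[OF S_principal[OF ac] S_principal[OF bc]] S_principal_self[OF ac]
      msum_upper2[OF S_principal[OF ac] S_principal[OF bc]] S_principal_self[OF bc]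
    unfolding W_def by blast+
  have W_least: "W \<subseteq> L" if "subm S L" "a \<in> L" "b \<in> L" for L
    unfolding W_def using that by (intro msum_least S_principal_least) auto
  have xWS: "subm S (scale x W)" by (intro subm_scale S_carrier WS xc)
  have xW: "scale x W \<subseteq> W"
    using subm_smult[OF WS] xA A_subset_S by (auto simp: scale_def)
  define z where "z u = a \<oplus> u \<otimes> b" for u
  define Y where "Y u = msum (scale (z u) S) (scale x W)" for u
  have zA: "z u \<in> A" if "u \<in> A" for u using that a b by (simp add: z_def A_add A_mult)
  have zc: "z u \<in> carrier Q" if "u \<in> A" for u using zA[OF that] by simp
  have zW: "z u \<in> W" if "u \<in> A" for u
    using subm_add[OF WS aW] subm_smult[OF WS _ bW] that A_subset_S by (auto simp: z_def)
  have YS: "subm S (Y u)" if "u \<in> A" for u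
    unfolding Y_def by (intro subm_msum S_carrier S_principal zc that xWS)
  have "finite {L. subm S L \<and> scale x W \<subseteq> L \<and> L \<subseteq> S}"
  proof (rule finite_S_overmodules[OF xWS])
    show "scale x W \<subseteq> S" using xW W by blast
    have "x \<otimes> a \<in> scale x W" using aW by (auto simp: scale_def)
    then show "scale x W \<inter> Units Q \<noteq> {}" using x a by blast
  qed
  moreover have "Y ` U \<subseteq> {L. subm S L \<and> scale x W \<subseteq> L \<and> L \<subseteq> S}"
  proof
    fix L assume "L \<in> Y ` U"
    then obtain u where u: "u \<in> A" "L = Y u" using U by blast
    have "Y u \<subseteq> W"
      unfolding Y_def using zW[OF u(1)] by (intro msum_least[OF WS] S_principal_least[OF WS] xW)
    moreover have "scale x W \<subseteq> Y u"
      unfolding Y_def by (rule msum_upper2[OF S_principal[OF zc[OF u(1)]] xWS])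
    ultimately show "L \<in> {L. subm S L \<and> scale x W \<subseteq> L \<and> L \<subseteq> S}"
      using YS u W by blast
  qed
  ultimately have "finite (Y ` U)" using finite_subset by blast
  then obtain u v where uv: "u \<in> U" "v \<in> U" "u \<noteq> v" "Y u = Y v"
    using U(1) finite_imageD[of Y U] by (auto simp: inj_on_def)
  have uA: "u \<in> A" and vA: "v \<in> A" using uv U by auto
  have uc: "u \<in> carrier Q" "v \<in> carrier Q" using uA vA by auto
  have zY: "z u \<in> Y u" "z v \<in> Y u"
    using msum_upper1[OF S_principal xWS] S_principal_self zc uA vA uv(4) unfolding Y_def by blast+
  have "z u \<ominus> z v = (u \<ominus> v) \<otimes> b"
    unfolding z_def using uc ac bc by algebra
  then have "(u \<ominus> v) \<otimes> b \<in> Y u" using subm_diff[OF YS[OF uA] S_neg zY] by simp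
  then have bY: "b \<in> Y u"
    using subm_unit_cancel[OF subm_S_imp_A[OF YS[OF uA]], of "u \<ominus> v" b] U(3) uv A_diff uA vA bc
    by blast
  have "z u \<ominus> u \<otimes> b = a" unfolding z_def using uc ac bc by algebra
  then have aY: "a \<in> Y u"
    using subm_diff[OF YS[OF uA] S_neg zY(1) subm_smult[OF YS[OF uA] _ bY, of u]] uA A_subset_S by auto
  have "scale (z u) S = W"
  proof (rule ccontr)
    assume ne: "scale (z u) S \<noteq> W"
    have zS: "subm A (scale (z u) S)" using subm_S_imp_A S_principal zc[OF uA] by blast
    have zsW: "scale (z u) S \<subseteq> W" using S_principal_least[OF WS zW[OF uA]] .
    obtain N' where N': "subm A N'" "scale (z u) S \<subseteq> N'" "N' \<subseteq> W" "N' \<noteq> W"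
      "\<And>a x. a \<in> m \<Longrightarrow> x \<in> W \<Longrightarrow> a \<otimes> x \<in> N'"
      using nakayama[OF zS subm_S_imp_A[OF WS] W zsW ne] by metis
    have "scale x W \<subseteq> N'" using N'(5)[OF x(1)] by (auto simp: scale_def)
    then have "Y u \<subseteq> N'" unfolding Y_def using msum_least[OF N'(1,2)] by blast
    moreover have "W \<subseteq> Y u" using W_least[OF YS[OF uA] aY bY] .
    ultimately show False using N'(3,4) by blast
  qed
  then show ?thesis using that[of u] aW bW uA by (simp add: z_def)
qed

text \<open>A generator of \<^term>\<open>K\<close>\<open>S\<close> inside \<^term>\<open>K\<close>: this is where the infinite residue field is used.\<close>

lemma principal_reduction:
  assumes K: "subm A K" "K \<subseteq> A" "K \<inter> Units Q \<noteq> {}"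
  obtains z where "z \<in> K" "z \<in> Units Q" "K \<subseteq> scale z S"
proof -
  \<comment> \<open>A maximal \<open>zS\<close> contains \<open>K\<close>: for \<open>b\<close> in
    \<open>K\<close>, some \<open>z + u b\<close> generates a module containing both
    \<open>z\<close> and \<open>b\<close>, and maximality identifies it with
    \<open>zS\<close>.\<close>
  define F where "F = {scale z S | z. z \<in> K \<and> z \<in> Units Q}"
  have "\<exists>M\<in>F. \<forall>N\<in>F. M \<subseteq> N \<longrightarrow> N = M"
  proof (rule acc_S)
    show "F \<noteq> {}" using K(3) by (auto simp: F_def)
    fix M assume "M \<in> F"
    then obtain z where z: "z \<in> K" "M = scale z S" by (auto simp: F_def)
    have "z \<in> S" using z K(2) A_subset_S by blast
    then show "subm A M \<and> M \<subseteq> S"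
      using subm_S_imp_A[OF S_principal] S_principal_least[OF S_ring] z by auto
  qed
  then obtain z where z: "z \<in> K" "z \<in> Units Q"
      and max: "\<And>w. w \<in> K \<Longrightarrow> w \<in> Units Q \<Longrightarrow> scale z S \<subseteq> scale w S \<Longrightarrow> scale w S = scale z S"
    unfolding F_def by blast
  have "K \<subseteq> scale z S"
  proof
    fix b assume b: "b \<in> K"
    obtain u where u: "u \<in> A" "z \<in> scale (z \<oplus> u \<otimes> b) S" "b \<in> scale (z \<oplus> u \<otimes> b) S"
      using generic_generator_two[of z b] z b K(2) by blast
    let ?w = "z \<oplus> u \<otimes> b"
    have wK: "?w \<in> K" using subm_add[OF K(1) z(1) subm_smult[OF K(1) u(1) b]] .
    then have wc: "?w \<in> carrier Q" using K(2) by auto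
    obtain t where t: "t \<in> S" "z = ?w \<otimes> t" using u(2) by (auto simp: mem_scale)
    have "?w \<in> Units Q" using Units_of_dvd_Unit[OF z(2) wc S_closed[OF t(1)] t(2)] .
    then have "scale ?w S = scale z S"
      using max wK S_principal_least[OF S_principal[OF wc] u(2)] by blast
    then show "b \<in> scale z S" using u by simp
  qed
  then show ?thesis using that z by blast
qed

section \<open>Classes up to scaling, and ideals cyclic modulo the conductor\<close>

text \<open>The normal forms in \<open>F\<close> are arbitrary sets and need not belong to the
  class; ideals representing them are chosen only at the end.\<close>

definition finite_up_to_scaling :: "'a set set \<Rightarrow> bool" where
  "finite_up_to_scaling \<K> \<longleftrightarrow> (\<exists>F. finite F \<and> (\<forall>K\<in>\<K>. \<exists>u\<in>Units Q. scale u K \<in> F))"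

lemma finite_up_to_scaling_subset:
  "finite_up_to_scaling \<K> \<Longrightarrow> \<L> \<subseteq> \<K> \<Longrightarrow> finite_up_to_scaling \<L>"
  unfolding finite_up_to_scaling_def by blast

lemma finite_up_to_scaling_Un:
  "finite_up_to_scaling \<K> \<Longrightarrow> finite_up_to_scaling \<L> \<Longrightarrow> finite_up_to_scaling (\<K> \<union> \<L>)"
  unfolding finite_up_to_scaling_def by (metis UnCI UnE finite_Un)

lemma finite_imp_finite_up_to_scaling:
  assumes "finite \<K>" "\<And>K. K \<in> \<K> \<Longrightarrow> K \<subseteq> carrier Q" shows "finite_up_to_scaling \<K>"
  unfolding finite_up_to_scaling_def
  using assms scale_one by (intro exI[of _ \<K>] conjI ballI bexI[of _ \<one>]) auto

definition cyclic_over_C :: "'a \<Rightarrow> 'a set" where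
  "cyclic_over_C w = msum (scale w A) C"

lemma cyclic_over_C:
  assumes w: "w \<in> A"
  shows "subm A (cyclic_over_C w)" "C \<subseteq> cyclic_over_C w" "w \<in> cyclic_over_C w" "cyclic_over_C w \<subseteq> A"
proof -
  have wc: "w \<in> carrier Q" using w by simp
  note s = subm_principal[OF wc]
  show "subm A (cyclic_over_C w)"
    unfolding cyclic_over_C_def by (intro subm_msum A_carrier s C_submA)
  show "C \<subseteq> cyclic_over_C w" unfolding cyclic_over_C_def by (rule msum_upper2[OF s C_submA])
  show "w \<in> cyclic_over_C w"
    unfolding cyclic_over_C_def using msum_upper1[OF s C_submA] principal_self[OF wc] by blast
  show "cyclic_over_C w \<subseteq> A"
    unfolding cyclic_over_C_def by (intro msum_least[OF A_ring] principal_least[OF A_ring] w C_subset_A)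
qed

lemma cyclic_over_C_least: "subm A K \<Longrightarrow> C \<subseteq> K \<Longrightarrow> w \<in> K \<Longrightarrow> cyclic_over_C w \<subseteq> K"
  unfolding cyclic_over_C_def by (intro msum_least principal_least)

lemma scale_msum:
  assumes "u \<in> carrier Q" "M \<subseteq> carrier Q" "N \<subseteq> carrier Q"
  shows "scale u (msum M N) = msum (scale u M) (scale u N)"
proof -
  have *: "u \<otimes> (x \<oplus> y) = u \<otimes> x \<oplus> u \<otimes> y" if "x \<in> M" "y \<in> N" for x y
    using that assms by (auto intro: r_distr)
  show ?thesis
    unfolding msum_def scale_def using * by (auto simp: image_iff) metis+
qed

text \<open>If \<^term>\<open>z\<close> generates \<open>KS\<close>, then by Nakayama it also generates \<^term>\<open>K\<close> modulo \<^term>\<open>C\<close>, so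
  \<open>z\<inverse>K = A + z\<inverse>C\<close> with an \<^term>\<open>S\<close>-module \<open>z\<inverse>C\<close> between \<^term>\<open>C\<close> and \<^term>\<open>S\<close>.\<close>

lemma cyclic_over_C_finite: "finite_up_to_scaling {cyclic_over_C w | w. w \<in> A \<and> w \<notin> C}"
  unfolding finite_up_to_scaling_def
proof (intro exI conjI ballI)
  have "finite {L. subm S L \<and> C \<subseteq> L \<and> L \<subseteq> S}"
    using finite_S_overmodules[OF C_subm _ C_regular] C_subset_A A_subset_S by blast
  then show "finite (msum A ` {L. subm S L \<and> C \<subseteq> L \<and> L \<subseteq> S})" by (rule finite_imageI)
  fix K assume "K \<in> {cyclic_over_C w | w. w \<in> A \<and> w \<notin> C}"
  then obtain w where w: "w \<in> A" "w \<notin> C" and K: "K = cyclic_over_C w" by blast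
  note Kw = cyclic_over_C[OF w(1), folded K]
  have Cc: "C \<subseteq> carrier Q" using C_subset_A A_carrier by blast
  have wc: "w \<in> carrier Q" using w by simp
  have "K \<inter> Units Q \<noteq> {}" using C_regular Kw(2) by blast
  then obtain z where z: "z \<in> K" "z \<in> Units Q" "K \<subseteq> scale z S"
    using principal_reduction[OF Kw(1,4)] by blast
  have zc: "z \<in> carrier Q" using z by auto
  obtain a c where ac: "a \<in> A" "c \<in> C" "z = w \<otimes> a \<oplus> c"
    using z(1) unfolding K cyclic_over_C_def by (auto simp: mem_msum mem_scale)
  have acc: "a \<in> carrier Q" "c \<in> carrier Q" using ac Cc by auto
  \<comment> \<open>For \<open>a\<close> in \<open>m\<close> the module \<open>zS\<close> would lie
    in \<open>mW + C\<close> with \<open>W = KS\<close>, hence in the proper submodule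
    \<open>N'\<close> given by Nakayama. But \<open>w\<close> is in \<open>zS\<close>, so all of
    \<open>W\<close> would lie in \<open>N'\<close>.\<close>
  have "a \<notin> m"
  proof
    assume am: "a \<in> m"
    define W where "W = msum (scale w S) C"
    have WS: "subm S W" unfolding W_def by (intro subm_msum S_carrier S_principal wc C_subm)
    have W: "W \<subseteq> S"
      unfolding W_def using w C_subset_A A_subset_S
      by (intro msum_least[OF S_ring] S_principal_least[OF S_ring]) auto
    have CW: "C \<subseteq> W" unfolding W_def by (rule msum_upper2[OF S_principal[OF wc] C_subm])
    have wW: "w \<in> W"
      unfolding W_def using msum_upper1[OF S_principal[OF wc] C_subm] S_principal_self[OF wc] by blast
    obtain N' where N': "subm A N'" "C \<subseteq> N'" "N' \<subseteq> W" "N' \<noteq> W"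
      "\<And>a x. a \<in> m \<Longrightarrow> x \<in> W \<Longrightarrow> a \<otimes> x \<in> N'"
      using nakayama[OF C_submA subm_S_imp_A[OF WS] W CW] w wW by metis
    have zN: "scale z S \<subseteq> N'"
    proof
      fix y assume "y \<in> scale z S"
      then obtain t where t: "t \<in> S" "y = z \<otimes> t" by (auto simp: mem_scale)
      have tc: "t \<in> carrier Q" using t by simp
      have "y = a \<otimes> (t \<otimes> w) \<oplus> t \<otimes> c" unfolding t(2) ac(3) using tc acc wc by algebra
      moreover have "a \<otimes> (t \<otimes> w) \<in> N'" using N'(5)[OF am subm_smult[OF WS t(1) wW]] .
      moreover have "t \<otimes> c \<in> N'" using subm_smult[OF C_subm t(1) ac(2)] N'(2) by blast
      ultimately show "y \<in> N'" using subm_add[OF N'(1)] by simp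
    qed
    have "scale w S \<subseteq> scale z S"
      using S_principal_least[OF S_principal[OF zc]] z(3) Kw(3) by blast
    then have "W \<subseteq> N'" unfolding W_def using msum_least[OF N'(1) _ N'(2)] zN by blast
    then show False using N'(3,4) by blast
  qed
  then obtain b where b: "b \<in> A" "a \<otimes> b = \<one>" using A_local ac(1) by blast
  have "cyclic_over_C z \<subseteq> K" using cyclic_over_C_least[OF Kw(1,2) z(1)] .
  moreover have "K \<subseteq> cyclic_over_C z"
  proof -
    have zA: "z \<in> A" using z Kw by blast
    have "b \<otimes> (z \<ominus> c) = (a \<otimes> b) \<otimes> w" unfolding ac(3) using acc wc A_closed[OF b(1)] by algebra
    then have "w = b \<otimes> (z \<ominus> c)" using b wc by simp
    moreover have "z \<ominus> c \<in> cyclic_over_C z"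
      using subm_diffA[OF cyclic_over_C(1)[OF zA]] cyclic_over_C[OF zA] ac(2) by blast
    ultimately have "w \<in> cyclic_over_C z"
      using subm_smult[OF cyclic_over_C(1)[OF zA] b(1)] by simp
    then show ?thesis unfolding K
      by (rule cyclic_over_C_least[OF cyclic_over_C(1,2)[OF zA]])
  qed
  ultimately have Kz: "K = msum (scale z A) C" unfolding cyclic_over_C_def by blast
  have iz: "inv z \<in> carrier Q" "inv z \<in> Units Q" using z by auto
  have "scale (inv z) K = msum A (scale (inv z) C)"
    unfolding Kz using scale_msum[OF iz(1) _ Cc, of "scale z A"] scale_inv_cancel(2)[OF z(2) A_carrier]
      subm_carrier[OF subm_principal[OF zc]] by simp
  moreover have "subm S (scale (inv z) C)" by (intro subm_scale S_carrier C_subm iz)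
  moreover have "scale (inv z) C \<subseteq> S"
  proof
    fix y assume "y \<in> scale (inv z) C"
    then obtain c where c: "c \<in> C" "y = inv z \<otimes> c" by (auto simp: mem_scale)
    then have "c \<in> scale z S" using Kw z by blast
    then obtain t where "t \<in> S" "c = z \<otimes> t" by (auto simp: mem_scale)
    then show "y \<in> S" using c Units_cancel[OF z(2)] by simp
  qed
  moreover have "C \<subseteq> scale (inv z) C"
  proof
    fix c assume c: "c \<in> C"
    have "z \<in> S" using z Kw A_subset_S by blast
    then have "z \<otimes> c \<in> C" using subm_smult[OF C_subm] c by blast
    moreover have "c = inv z \<otimes> (z \<otimes> c)" using Units_cancel[OF z(2)] c Cc by auto
    ultimately show "c \<in> scale (inv z) C" by (auto simp: mem_scale)
  qed
  ultimately show "\<exists>u\<in>Units Q. scale u K \<in> msum A ` {L. subm S L \<and> C \<subseteq> L \<and> L \<subseteq> S}"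
    using iz(2) by (intro bexI[of _ "inv z"]) auto
qed

end

section \<open>Ideals above the conductor and reflexive ideals\<close>

context local_fractions
begin

section \<open>Chains of modules and regularity of the conductor\<close>

text \<open>\<open>n\<close> counts strict inclusions, so there are \<open>n + 1\<close> modules.
  The bounds \<open>Z\<close> and \<open>Y\<close> need not occur among them, which makes the notion
  monotone in both.\<close>

definition chain :: "'a set \<Rightarrow> 'a set \<Rightarrow> nat \<Rightarrow> bool" where
  "chain Z Y n \<longleftrightarrow> (\<exists>N :: nat \<Rightarrow> 'a set.
     (\<forall>i\<le>n. subm A (N i) \<and> Z \<subseteq> N i \<and> N i \<subseteq> Y) \<and> (\<forall>i<n. N i \<subset> N (Suc i)))"

lemma chain_of_list:
  assumes "successively (\<subset>) Ns" "\<And>N. N \<in> set Ns \<Longrightarrow> subm A N \<and> Z \<subseteq> N \<and> N \<subseteq> Y"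
    and "length Ns = Suc n"
  shows "chain Z Y n"
  unfolding chain_def
proof (intro exI[of _ "\<lambda>i. Ns ! i"] conjI allI impI)
  fix i assume "i \<le> n"
  then have "Ns ! i \<in> set Ns" using assms(3) by simp
  then show "subm A (Ns ! i)" "Z \<subseteq> Ns ! i" "Ns ! i \<subseteq> Y" using assms(2) by auto
next
  fix i assume "i < n"
  then show "Ns ! i \<subset> Ns ! Suc i"
    using assms(1,3) by (auto simp: successively_conv_nth)
qed

text \<open>For a regular \<open>x\<close> in \<open>m\<close> the ideals \<open>x^j A + C\<close>
  descend strictly unless some \<open>x^j\<close> lies in \<open>C\<close>: equality of two
  neighbours gives \<open>(1 - a x) x^j\<close> in \<open>C\<close>, and \<open>1 - a x\<close> is
  invertible. The exponent \<open>k - i\<close> lists them in ascending order.\<close>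

lemma no_chain_imp_C_regular:
  assumes "\<not> chain C A k" shows "C \<inter> Units Q \<noteq> {}"
proof (rule ccontr)
  assume nreg: "\<not> C \<inter> Units Q \<noteq> {}"
  obtain x where x: "x \<in> m" "x \<in> Units Q" using m_regular by blast
  have xA: "x \<in> A" using x m_ideal by blast
  have xp: "x [^] j \<in> A" "x [^] j \<in> Units Q" for j :: nat
    using A_pow[OF xA] Units_pow_closed[OF x(2)] by auto
  have xc: "x \<in> carrier Q" "x [^] j \<in> carrier Q" for j :: nat using xA by auto
  define N where "N i = msum (scale (x [^] (k - i)) A) C" for i
  have N: "subm A (N i) \<and> C \<subseteq> N i \<and> N i \<subseteq> A" for i
    unfolding N_def using xp
    by (intro conjI subm_msum A_carrier subm_principal xc C_submA
        msum_upper2[OF subm_principal[OF xc(2)] C_submA]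
        msum_least[OF A_ring] principal_least[OF A_ring] C_subset_A) auto
  have "N i \<subset> N (Suc i)" if "i < k" for i
  proof -
    define j where "j = k - Suc i"
    have Ni: "N i = msum (scale (x [^] Suc j) A) C" "N (Suc i) = msum (scale (x [^] j) A) C"
      using that by (simp_all add: N_def j_def Suc_diff_Suc)
    have in2: "x [^] j \<in> N (Suc i)"
      unfolding Ni using msum_upper1[OF subm_principal[OF xc(2)] C_submA] principal_self[OF xc(2)] by blast
    have "x [^] Suc j = x \<otimes> x [^] j" using xc by (simp add: m_comm)
    then have "x [^] Suc j \<in> N (Suc i)" using subm_smult[of A "N (Suc i)" x] N xA in2 by simp
    then have "N i \<subseteq> N (Suc i)"
      unfolding Ni(1) using N by (intro msum_least[of A] principal_least) auto
    moreover have "x [^] j \<notin> N i"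
    proof
      assume "x [^] j \<in> N i"
      then obtain a c where ac: "a \<in> A" "c \<in> C" "x [^] j = x [^] Suc j \<otimes> a \<oplus> c"
        unfolding Ni by (auto simp: mem_msum mem_scale)
      have cc: "c \<in> carrier Q" using ac(2) C_subset_A by auto
      have "x [^] j \<ominus> (a \<otimes> x) \<otimes> x [^] j = (x [^] j \<otimes> x \<otimes> a \<oplus> c) \<ominus> (a \<otimes> x) \<otimes> x [^] j"
        using ac(3) by simp
      also have "\<dots> = c" using cc xc A_closed[OF ac(1)] by algebra
      finally have "x [^] j \<ominus> (a \<otimes> x) \<otimes> x [^] j \<in> C" using ac(2) by simp
      moreover have "a \<otimes> x \<in> m" using subm_smult[OF m_ideal(1) ac(1) x(1)] .
      ultimately have "x [^] j \<in> C" using subm_cancel_one_minus[OF C_submA _ xc(2)] by blast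
      then show False using nreg xp by blast
    qed
    ultimately show ?thesis using in2 by blast
  qed
  then have "chain C A k" unfolding chain_def using N by blast
  then show False using assms by blast
qed

lemma proper_subset_m:
  assumes K: "subm A K" "K \<subseteq> A" "K \<noteq> A" shows "K \<subseteq> m"
proof
  fix a assume a: "a \<in> K"
  show "a \<in> m"
  proof (rule ccontr)
    assume "a \<notin> m"
    then have "\<one> \<in> K" using subm_unit_cancel[OF K(1), of a \<one>] a K(2) by auto
    then have "x \<in> K" if "x \<in> A" for x using subm_smult[OF K(1) that, of \<one>] that by simp
    then show False using K by blast
  qed
qed

section \<open>Fractional duals\<close>

definition dual :: "'a set \<Rightarrow> 'a set" where
  "dual K = {q \<in> carrier Q. \<forall>x\<in>K. q \<otimes> x \<in> A}"

lemma subset_double_dual: "K \<subseteq> carrier Q \<Longrightarrow> K \<subseteq> dual (dual K)"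
  by (auto simp: dual_def m_comm subset_iff)

lemma dual_carrier: "dual K \<subseteq> carrier Q"
  by (auto simp: dual_def)

lemma dual_subm: assumes K: "K \<subseteq> carrier Q" shows "subm A (dual K)"
  unfolding subm_def
proof (intro conjI ballI dual_carrier)
  have [simp]: "x \<in> carrier Q" if "x \<in> K" for x using that K by blast
  show "\<zero> \<in> dual K" by (auto simp: dual_def A_zero)
  fix x y assume "x \<in> dual K" "y \<in> dual K"
  then show "x \<oplus> y \<in> dual K" by (auto simp: dual_def l_distr A_add)
next
  have [simp]: "x \<in> carrier Q" if "x \<in> K" for x using that K by blast
  fix t x assume "t \<in> A" "x \<in> dual K"
  then show "t \<otimes> x \<in> dual K" by (auto simp: dual_def m_assoc A_mult)
qed

lemma dual_scale:
  assumes u: "u \<in> Units Q" and K: "K \<subseteq> carrier Q"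
  shows "dual (scale u K) = scale (inv u) (dual K)"
proof (intro subset_antisym subsetI)
  have uc: "u \<in> carrier Q" "inv u \<in> carrier Q" using u by auto
  have Kc: "x \<in> carrier Q" if "x \<in> K" for x using that K by blast
  fix q
  {
    assume q: "q \<in> dual (scale u K)"
    then have qc: "q \<in> carrier Q" by (simp add: dual_def)
    have "(u \<otimes> q) \<otimes> x \<in> A" if "x \<in> K" for x
    proof -
      have "(u \<otimes> q) \<otimes> x = q \<otimes> (u \<otimes> x)" using uc qc Kc[OF that] by algebra
      then show ?thesis using q that by (auto simp: dual_def scale_def)
    qed
    then have "u \<otimes> q \<in> dual K" using uc qc by (simp add: dual_def)
    moreover have "q = inv u \<otimes> (u \<otimes> q)" using Units_cancel[OF u qc] by simp
    ultimately show "q \<in> scale (inv u) (dual K)" by (auto simp: mem_scale)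
  next
    assume "q \<in> scale (inv u) (dual K)"
    then obtain j where j: "j \<in> dual K" "q = inv u \<otimes> j" by (auto simp: mem_scale)
    have jc: "j \<in> carrier Q" using j by (simp add: dual_def)
    have "q \<otimes> (u \<otimes> x) \<in> A" if "x \<in> K" for x
    proof -
      have "q \<otimes> (u \<otimes> x) = inv u \<otimes> (u \<otimes> (j \<otimes> x))" unfolding j(2) using uc jc Kc[OF that] by algebra
      also have "\<dots> = j \<otimes> x" using Units_cancel[OF u] jc Kc[OF that] by simp
      finally show ?thesis using j(1) that by (simp add: dual_def)
    qed
    then show "q \<in> dual (scale u K)" using j uc jc by (auto simp: dual_def scale_def)
  }
qed

end

context finite_normalization
begin

section \<open>Classification of ideals above the conductor\<close>

text \<open>An ideal off the list would sit in a chain \<open>C\<close>,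
  \<open>cyclic_over_C w\<close>, \<open>K\<close>, \<open>m\<close>, \<open>A\<close> with four
  strict steps, for any \<open>w\<close> in \<open>K\<close> outside \<open>C\<close>.\<close>

lemma length_three_classification:
  assumes bound: "\<not> chain C A 4"
  shows "finite_up_to_scaling {K. subm A K \<and> C \<subseteq> K \<and> K \<subseteq> A}"
proof -
  have "finite_up_to_scaling {C, m, A}"
    using C_subset_A m_ideal A_carrier by (intro finite_imp_finite_up_to_scaling) auto
  then have big: "finite_up_to_scaling ({C, m, A} \<union> {cyclic_over_C w | w. w \<in> A \<and> w \<notin> C})"
    using cyclic_over_C_finite by (rule finite_up_to_scaling_Un)
  have "K \<in> {C, m, A} \<union> {cyclic_over_C w | w. w \<in> A \<and> w \<notin> C}"
    if K: "subm A K" "C \<subseteq> K" "K \<subseteq> A" for K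
  proof (rule ccontr)
    assume "\<not> ?thesis"
    then have ne: "K \<noteq> C" "K \<noteq> m" "K \<noteq> A" and ncyc: "\<And>w. w \<in> A \<Longrightarrow> w \<notin> C \<Longrightarrow> K \<noteq> cyclic_over_C w"
      by auto
    obtain w where w: "w \<in> K" "w \<notin> C" using ne K by blast
    have wA: "w \<in> A" using w K by blast
    note cw = cyclic_over_C[OF wA]
    have Km: "K \<subseteq> m" using proper_subset_m K ne by blast
    have "chain C A 4"
    proof (rule chain_of_list[of "[C, cyclic_over_C w, K, m, A]"])
      show "successively (\<subset>) [C, cyclic_over_C w, K, m, A]"
        using cw w ncyc[OF wA w(2)] cyclic_over_C_least[OF K(1,2) w(1)] Km ne m_ideal A_one by auto
    qed (use cw K m_ideal C_submA A_ring Km C_subset_A in auto)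
    then show False using bound by blast
  qed
  then show ?thesis by (intro finite_up_to_scaling_subset[OF big] subsetI) blast
qed

text \<open>For \<open>j\<close> in the dual of \<open>K\<close> the product \<open>j k\<close> lies
  in \<open>m\<close>; otherwise it would be invertible and \<open>K\<close> would be
  \<open>kA\<close>, hence cyclic over \<open>C\<close> or equal to \<open>C\<close>. So
  \<open>a (j k)\<close> lies in \<open>ym\<close>, which says that \<open>y^-1 a k\<close>
  multiplies the dual of \<open>K\<close> into \<open>A\<close>. It is therefore in the double dual,
  that is, in \<open>K\<close>.\<close>

lemma noncyclic_reflexive_stable:
  assumes y: "y \<in> m" "y \<in> Units Q" and mm: "\<And>a b. a \<in> m \<Longrightarrow> b \<in> m \<Longrightarrow> a \<otimes> b \<in> scale y m"
    and K: "subm A K" "C \<subseteq> K" "K \<subseteq> A" "dual (dual K) \<subseteq> K" "K \<noteq> C"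
    and ncyc: "\<And>w. w \<in> A \<Longrightarrow> w \<notin> C \<Longrightarrow> K \<noteq> cyclic_over_C w"
    and a: "a \<in> m" and k: "k \<in> K"
  shows "a \<otimes> k \<in> scale y K"
proof -
  have c: "a \<in> carrier Q" "k \<in> carrier Q" "y \<in> carrier Q" "inv y \<in> carrier Q"
    using a k y K(3) m_ideal(2) by (auto simp: subset_iff)
  have jk: "j \<otimes> k \<in> m" if j: "j \<in> dual K" for j
  proof (rule ccontr)
    assume n: "j \<otimes> k \<notin> m"
    have jA: "j \<otimes> x \<in> A" if "x \<in> K" for x using j that by (simp add: dual_def)
    have jc: "j \<in> carrier Q" using j by (simp add: dual_def)
    obtain b where b: "b \<in> A" "(j \<otimes> k) \<otimes> b = \<one>" using A_local[OF jA[OF k] n] by blast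
    have kA: "k \<in> A" using k K by blast
    have "K \<subseteq> scale k A"
    proof
      fix x assume x: "x \<in> K"
      then have xc: "x \<in> carrier Q" using K(3) by auto
      have "x = ((j \<otimes> k) \<otimes> b) \<otimes> x" using b xc by simp
      also have "\<dots> = k \<otimes> (b \<otimes> (j \<otimes> x))" using c jc xc A_closed[OF b(1)] by algebra
      finally show "x \<in> scale k A" using A_mult[OF b(1) jA[OF x]] by (auto simp: mem_scale)
    qed
    then have "K \<subseteq> cyclic_over_C k"
      using principal_least[OF cyclic_over_C(1)[OF kA] cyclic_over_C(3)[OF kA]] by blast
    then have eq: "K = cyclic_over_C k" using cyclic_over_C_least[OF K(1,2) k] by blast
    have "k \<in> C" using ncyc[OF kA] eq by blast
    then have "K \<subseteq> C" unfolding eq using cyclic_over_C_least[OF C_submA] by blast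
    then show False using K by blast
  qed
  have "inv y \<otimes> (a \<otimes> k) \<in> dual (dual K)"
    unfolding dual_def[of "dual K"]
  proof (intro CollectI conjI ballI)
    show "inv y \<otimes> (a \<otimes> k) \<in> carrier Q" using c by simp
    fix j assume j: "j \<in> dual K"
    then have jc: "j \<in> carrier Q" by (simp add: dual_def)
    obtain b where b: "b \<in> m" "a \<otimes> (j \<otimes> k) = y \<otimes> b" using mm[OF a jk[OF j]] by (auto simp: mem_scale)
    have bA: "b \<in> A" using b m_ideal by blast
    have "inv y \<otimes> (a \<otimes> k) \<otimes> j = inv y \<otimes> (a \<otimes> (j \<otimes> k))" using c jc by algebra
    also have "\<dots> = b" using b bA Units_cancel[OF y(2)] by simp
    finally show "inv y \<otimes> (a \<otimes> k) \<otimes> j \<in> A" using bA by simp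
  qed
  then have "inv y \<otimes> (a \<otimes> k) \<in> K" using K(4) by blast
  moreover have "a \<otimes> k = y \<otimes> (inv y \<otimes> (a \<otimes> k))" using Units_cancel'[OF y(2)] c by simp
  ultimately show ?thesis by (auto simp: mem_scale)
qed

text \<open>The sets in \<^term>\<open>\<P>\<close> are \<^term>\<open>y\<close> times maximal ideals of the ring \<open>y\<inverse>m\<close>.  Four different ones
  and their successive intersections, together with \<^term>\<open>m\<close> and \<^term>\<open>A\<close>, form a chain of length five.\<close>

lemma finite_maximal_submodules:
  assumes y: "y \<in> m" "y \<in> Units Q" and bound: "\<not> chain C A 5"
    and P: "\<And>K. K \<in> \<P> \<Longrightarrow> subm A K \<and> C \<subseteq> K \<and> K \<subseteq> m \<and> K \<noteq> m"
    and stable: "\<And>K a k. K \<in> \<P> \<Longrightarrow> a \<in> m \<Longrightarrow> k \<in> K \<Longrightarrow> a \<otimes> k \<in> scale y K"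
    and cover: "\<And>K w. K \<in> \<P> \<Longrightarrow> w \<in> m \<Longrightarrow> w \<notin> K \<Longrightarrow> m \<subseteq> msum K (scale w A)"
  shows "finite \<P>"
proof (rule ccontr)
  assume inf: "infinite \<P>"
  have yc: "y \<in> carrier Q" "inv y \<in> carrier Q" using y by auto
  have mc: "a \<in> carrier Q" if "a \<in> m" for a using that m_ideal(2) by auto
  have Kc: "a \<in> carrier Q" if "K \<in> \<P>" "a \<in> K" for a K using that P mc by blast
  \<comment> \<open>\<open>y\<close> corresponds to the identity of the ring \<open>y^-1 m\<close>,
    so a proper ideal of that ring cannot contain it.\<close>
  have yK: "y \<notin> K" if K: "K \<in> \<P>" for K
  proof
    assume "y \<in> K"
    have "m \<subseteq> K"
    proof
      fix a assume a: "a \<in> m"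
      obtain k where k: "k \<in> K" "a \<otimes> y = y \<otimes> k" using stable[OF K a \<open>y \<in> K\<close>] by (auto simp: mem_scale)
      have "a = inv y \<otimes> (y \<otimes> a)" using Units_cancel[OF y(2) mc[OF a]] by simp
      also have "y \<otimes> a = y \<otimes> k" using k(2) mc[OF a] yc by (simp add: m_comm)
      also have "inv y \<otimes> (y \<otimes> k) = k" using Units_cancel[OF y(2) Kc[OF K k(1)]] .
      finally show "a \<in> K" using k by simp
    qed
    then show False using P[OF K] by blast
  qed
  \<comment> \<open>Two different maximal ideals are comaximal. In terms of \<open>y\<close>, this
    splits \<open>y\<close> as \<open>p + (y - p)\<close> with one part in each of \<open>K\<close>
    and \<open>L\<close>.\<close>
  have sep: "\<exists>p\<in>K. y \<ominus> p \<in> L" if KL: "K \<in> \<P>" "L \<in> \<P>" "K \<noteq> L" for K L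
  proof -
    have "\<not> K \<subseteq> L"
    proof
      assume "K \<subseteq> L"
      then obtain l where l: "l \<in> L" "l \<notin> K" using KL by blast
      then have "m \<subseteq> msum K (scale l A)" using cover[OF KL(1)] P[OF KL(2)] by blast
      moreover have "msum K (scale l A) \<subseteq> L"
        using msum_least[of A L] principal_least[of L l] P[OF KL(2)] l \<open>K \<subseteq> L\<close> by blast
      ultimately show False using P[OF KL(2)] by blast
    qed
    then obtain k where k: "k \<in> K" "k \<notin> L" by blast
    then have "y \<in> msum L (scale k A)" using cover[OF KL(2), of k] P[OF KL(1)] y by blast
    then obtain l a where la: "l \<in> L" "a \<in> A" "y = l \<oplus> k \<otimes> a" by (auto simp: mem_msum mem_scale)
    have "k \<otimes> a = a \<otimes> k" using Kc[OF KL(1) k(1)] la(2) by (simp add: m_comm)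
    then have "k \<otimes> a \<in> K" using P[OF KL(1)] subm_smult[of A K a k] la k by simp
    moreover have "y \<ominus> k \<otimes> a = l"
      unfolding la(3) using Kc[OF KL(2) la(1)] Kc[OF KL(1) k(1)] A_closed[OF la(2)] by algebra
    ultimately show ?thesis using la(1) by metis
  qed
  \<comment> \<open>\<open>y^-1 p q\<close> is \<open>y\<close> times the product of
    \<open>p/y\<close> and \<open>q/y\<close> in the ring \<open>y^-1 m\<close>. Factors congruent
    to the identity modulo \<open>L\<close> have a product with the same property, and the product
    stays in every ideal that contains one of them.\<close>
  have combine: "inv y \<otimes> (p \<otimes> q) \<in> D \<and> y \<ominus> inv y \<otimes> (p \<otimes> q) \<in> L"
    if L: "L \<in> \<P>" and D: "subm A D" "D \<subseteq> m" "\<And>a k. a \<in> m \<Longrightarrow> k \<in> D \<Longrightarrow> a \<otimes> k \<in> scale y D"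
      and p: "p \<in> m" "y \<ominus> p \<in> L" and q: "q \<in> m" "y \<ominus> q \<in> L" and pq: "p \<in> D \<or> q \<in> D" for p q L D
  proof
    have c: "p \<in> carrier Q" "q \<in> carrier Q" using mc p q by auto
    have sL: "subm A L" using P[OF L] by blast
    have "p \<otimes> q \<in> scale y D" using pq D(3)[of p q] D(3)[of q p] p q c by (auto simp: m_comm)
    then obtain d where d: "d \<in> D" "p \<otimes> q = y \<otimes> d" by (auto simp: mem_scale)
    then show "inv y \<otimes> (p \<otimes> q) \<in> D" using Units_cancel[OF y(2)] mc D(2) by auto
    obtain l where l: "l \<in> L" "p \<otimes> (y \<ominus> q) = y \<otimes> l" using stable[OF L p(1) q(2)] by (auto simp: mem_scale)
    have "p \<ominus> inv y \<otimes> (p \<otimes> q) = inv y \<otimes> (y \<otimes> p) \<ominus> inv y \<otimes> (p \<otimes> q)"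
      using Units_cancel[OF y(2) c(1)] by simp
    also have "\<dots> = inv y \<otimes> (p \<otimes> (y \<ominus> q))" using c yc by algebra
    also have "\<dots> = l" using l Units_cancel[OF y(2)] Kc[OF L] by simp
    finally have "p \<ominus> inv y \<otimes> (p \<otimes> q) \<in> L" using l by simp
    then have "(y \<ominus> p) \<oplus> (p \<ominus> inv y \<otimes> (p \<otimes> q)) \<in> L" using subm_add[OF sL p(2)] by blast
    moreover have "(y \<ominus> p) \<oplus> (p \<ominus> inv y \<otimes> (p \<otimes> q)) = y \<ominus> inv y \<otimes> (p \<otimes> q)" using c yc by algebra
    ultimately show "y \<ominus> inv y \<otimes> (p \<otimes> q) \<in> L" by simp
  qed
  have notin: "p \<notin> L" if L: "L \<in> \<P>" "p \<in> m" "y \<ominus> p \<in> L" for p L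
  proof
    assume "p \<in> L"
    then have "(y \<ominus> p) \<oplus> p \<in> L" using P[OF L(1)] subm_add[of A L] L by blast
    moreover have "(y \<ominus> p) \<oplus> p = y" using yc mc[OF L(2)] by algebra
    ultimately show False using yK[OF L(1)] by simp
  qed
  obtain K1 where K1: "K1 \<in> \<P>" using inf infinite_imp_nonempty by blast
  obtain K2 where K2: "K2 \<in> \<P>" "K1 \<noteq> K2"
    using infinite_imp_nonempty[OF Diff_infinite_finite[OF _ inf, of "{K1}"]] by auto
  obtain K3 where K3: "K3 \<in> \<P>" "K1 \<noteq> K3" "K2 \<noteq> K3"
    using infinite_imp_nonempty[OF Diff_infinite_finite[OF _ inf, of "{K1, K2}"]] by auto
  obtain K4 where K4: "K4 \<in> \<P>" "K1 \<noteq> K4" "K2 \<noteq> K4" "K3 \<noteq> K4"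
    using infinite_imp_nonempty[OF Diff_infinite_finite[OF _ inf, of "{K1, K2, K3}"]] by auto
  note P1 = P[OF K1] and P2 = P[OF K2(1)] and P3 = P[OF K3(1)] and P4 = P[OF K4(1)]
  have "\<exists>p\<in>K1. p \<notin> K2"
    using sep[OF K1 K2(1,2)] notin[OF K2(1)] P1 by blast
  \<comment> \<open>The product of the separating elements lies in all earlier ideals and is
    congruent to \<open>y\<close> modulo the new one, hence outside it. So each further intersection
    is strictly smaller.\<close>
  moreover have "\<exists>r\<in>K1 \<inter> K2. r \<notin> K3"
  proof -
    obtain p where p: "p \<in> K1" "y \<ominus> p \<in> K3" using sep[OF K1 K3(1,2)] by blast
    obtain q where q: "q \<in> K2" "y \<ominus> q \<in> K3" using sep[OF K2(1) K3(1,3)] by blast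
    have pm: "p \<in> m" "q \<in> m" using p q P1 P2 by auto
    have "inv y \<otimes> (p \<otimes> q) \<in> K1 \<and> y \<ominus> inv y \<otimes> (p \<otimes> q) \<in> K3"
      using combine[OF K3(1) _ _ stable[OF K1] pm(1) p(2) pm(2) q(2)] P1 p by blast
    moreover have "inv y \<otimes> (p \<otimes> q) \<in> K2"
      using combine[OF K3(1) _ _ stable[OF K2(1)] pm(1) p(2) pm(2) q(2)] P2 q by blast
    ultimately show ?thesis using notin[OF K3(1)] P1 by blast
  qed
  moreover have "\<exists>r\<in>K1 \<inter> K2 \<inter> K3. r \<notin> K4"
  proof -
    obtain p where p: "p \<in> K1" "y \<ominus> p \<in> K4" using sep[OF K1 K4(1,2)] by blast
    obtain q where q: "q \<in> K2" "y \<ominus> q \<in> K4" using sep[OF K2(1) K4(1,3)] by blast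
    obtain r where r: "r \<in> K3" "y \<ominus> r \<in> K4" using sep[OF K3(1) K4(1,4)] by blast
    have pm: "p \<in> m" "q \<in> m" "r \<in> m" using p q r P1 P2 P3 by auto
    define s where "s = inv y \<otimes> (p \<otimes> q)"
    have s: "s \<in> K1" "y \<ominus> s \<in> K4"
      using combine[OF K4(1) _ _ stable[OF K1] pm(1) p(2) pm(2) q(2)] P1 p unfolding s_def by blast+
    have s2: "s \<in> K2"
      using combine[OF K4(1) _ _ stable[OF K2(1)] pm(1) p(2) pm(2) q(2)] P2 q unfolding s_def by blast
    have sm: "s \<in> m" using s P1 by blast
    define t where "t = inv y \<otimes> (s \<otimes> r)"
    have t: "t \<in> K1" "y \<ominus> t \<in> K4"
      using combine[OF K4(1) _ _ stable[OF K1] sm s(2) pm(3) r(2)] P1 s unfolding t_def by blast+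
    have "t \<in> K2"
      using combine[OF K4(1) _ _ stable[OF K2(1)] sm s(2) pm(3) r(2)] P2 s2 unfolding t_def by blast
    moreover have "t \<in> K3"
      using combine[OF K4(1) _ _ stable[OF K3(1)] sm s(2) pm(3) r(2)] P3 r unfolding t_def by blast
    ultimately show ?thesis using notin[OF K4(1)] t P1 by blast
  qed
  ultimately have succ: "successively (\<subset>) [K1 \<inter> K2 \<inter> K3 \<inter> K4, K1 \<inter> K2 \<inter> K3, K1 \<inter> K2, K1, m, A]"
    using P1 m_ideal A_one by auto
  have "chain C A 5"
    by (rule chain_of_list[OF succ])
      (use P1 P2 P3 P4 m_ideal A_ring C_subset_A subm_Int in auto)
  then show False using bound by blast
qed

text \<open>Let \<open>K\<close> be an ideal off the list and not cyclic over \<open>C\<close>. A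
  module \<open>K + wA\<close> strictly between \<open>K\<close> and \<open>m\<close> would refine
  the chain \<open>C\<close>, \<open>cyclic_over_C v\<close>, \<open>K\<close>, \<open>m\<close>,
  \<open>A\<close> to five strict steps. So \<open>K\<close> is maximal below \<open>m\<close>,
  which is the \<open>cover\<close> condition for counting such ideals.\<close>

lemma length_four_classification:
  assumes y: "y \<in> m" "y \<in> Units Q" and mm: "\<And>a b. a \<in> m \<Longrightarrow> b \<in> m \<Longrightarrow> a \<otimes> b \<in> scale y m"
    and bound: "\<not> chain C A 5"
  shows "finite_up_to_scaling {K. subm A K \<and> C \<subseteq> K \<and> K \<subseteq> A \<and> dual (dual K) \<subseteq> K}"
proof -
  define \<P> where "\<P> = {K. subm A K \<and> C \<subseteq> K \<and> K \<subseteq> A \<and> dual (dual K) \<subseteq> K} -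
    ({C, m, A} \<union> {cyclic_over_C w | w. w \<in> A \<and> w \<notin> C})"
  have P: "subm A K" "C \<subseteq> K" "K \<subseteq> A" "dual (dual K) \<subseteq> K" "K \<noteq> C" "K \<noteq> m" "K \<noteq> A"
      "\<And>w. w \<in> A \<Longrightarrow> w \<notin> C \<Longrightarrow> K \<noteq> cyclic_over_C w" if "K \<in> \<P>" for K
    using that by (auto simp: \<P>_def)
  have Pm: "K \<subseteq> m" if "K \<in> \<P>" for K using proper_subset_m P[OF that] by blast
  have finP: "finite \<P>"
  proof (rule finite_maximal_submodules[OF y bound])
    fix K assume K: "K \<in> \<P>"
    show "subm A K \<and> C \<subseteq> K \<and> K \<subseteq> m \<and> K \<noteq> m" using P[OF K] Pm[OF K] by blast
    show "a \<otimes> k \<in> scale y K" if "a \<in> m" "k \<in> K" for a k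
      using noncyclic_reflexive_stable[OF y mm P(1-5)[OF K] P(8)[OF K] that] by blast
    show "m \<subseteq> msum K (scale w A)" if w: "w \<in> m" "w \<notin> K" for w
    proof (rule ccontr)
      assume n: "\<not> m \<subseteq> msum K (scale w A)"
      obtain v where v: "v \<in> K" "v \<notin> C" using P[OF K] by blast
      have vA: "v \<in> A" using v P(3)[OF K] by blast
      note cv = cyclic_over_C[OF vA]
      have wA: "w \<in> A" using w m_ideal by blast
      then have wc: "w \<in> carrier Q" by simp
      let ?W = "msum K (scale w A)"
      have W: "subm A ?W" by (intro subm_msum A_carrier P(1)[OF K] subm_principal wc)
      have KW: "K \<subseteq> ?W" "w \<in> ?W"
        using msum_upper1[OF P(1)[OF K] subm_principal[OF wc]]
          msum_upper2[OF P(1)[OF K] subm_principal[OF wc]] principal_self[OF wc] by blast+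
      have Wm: "?W \<subseteq> m" by (intro msum_least[OF m_ideal(1)] Pm[OF K] principal_least[OF m_ideal(1)] w)
      have "successively (\<subset>) [C, cyclic_over_C v, K, ?W, m, A]"
        using cv v P(8)[OF K vA v(2)] cyclic_over_C_least[OF P(1,2)[OF K] v(1)] KW w Wm n m_ideal A_one
        by auto
      then have "chain C A 5"
        by (rule chain_of_list)
          (use cv P(1-3)[OF K] W Wm KW m_ideal C_submA A_ring C_subset_A in auto)
      then show False using bound by blast
    qed
  qed
  have "finite_up_to_scaling ({C, m, A} \<union> \<P>)"
    using C_subset_A m_ideal(2) A_carrier P(3) finP by (intro finite_imp_finite_up_to_scaling) blast+
  then have "finite_up_to_scaling (({C, m, A} \<union> \<P>) \<union> {cyclic_over_C w | w. w \<in> A \<and> w \<notin> C})"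
    using cyclic_over_C_finite by (rule finite_up_to_scaling_Un)
  then show ?thesis by (rule finite_up_to_scaling_subset) (auto simp: \<P>_def)
qed

text \<open>A reflexive \<^term>\<open>I\<close> is \<^term>\<open>z\<close> times the dual of \<open>K = z I\<^sup>*\<close>, and \<^term>\<open>C\<close> is contained in \<^term>\<open>K\<close> once
  \<^term>\<open>z\<close> generates \<open>IS\<close>.\<close>

lemma reflexive_classes:
  assumes fin: "finite_up_to_scaling {K. subm A K \<and> C \<subseteq> K \<and> K \<subseteq> A \<and> dual (dual K) \<subseteq> K}"
  shows "finite_up_to_scaling {I. subm A I \<and> I \<subseteq> A \<and> I \<inter> Units Q \<noteq> {} \<and> dual (dual I) \<subseteq> I}"
proof -
  obtain F where F: "finite F" "\<And>K. subm A K \<Longrightarrow> C \<subseteq> K \<Longrightarrow> K \<subseteq> A \<Longrightarrow> dual (dual K) \<subseteq> K \<Longrightarrow>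
      \<exists>u\<in>Units Q. scale u K \<in> F"
    using fin unfolding finite_up_to_scaling_def by blast
  show ?thesis
    unfolding finite_up_to_scaling_def
  \<comment> \<open>If \<open>F\<close> contains the multiple \<open>uK\<close>, then the dual of
    \<open>uK\<close> is \<open>(u z)^-1 I\<close>, so the duals of the normal forms of
    \<open>K\<close> serve as normal forms of \<open>I\<close>.\<close>
  proof (intro exI[of _ "dual ` F"] conjI ballI finite_imageI F(1))
    fix I assume "I \<in> {I. subm A I \<and> I \<subseteq> A \<and> I \<inter> Units Q \<noteq> {} \<and> dual (dual I) \<subseteq> I}"
    then have I: "subm A I" "I \<subseteq> A" "I \<inter> Units Q \<noteq> {}" "dual (dual I) \<subseteq> I" by auto
    have Ic: "I \<subseteq> carrier Q" using I A_carrier by blast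
    obtain z where z: "z \<in> I" "z \<in> Units Q" "I \<subseteq> scale z S"
      using principal_reduction[OF I(1-3)] by blast
    have zc: "z \<in> carrier Q" "inv z \<in> carrier Q" "inv z \<in> Units Q" using z by auto
    define K where "K = scale z (dual I)"
    have Kc: "K \<subseteq> carrier Q"
      unfolding K_def using subm_carrier subm_scale A_carrier dual_subm Ic zc by blast
    have dK: "dual K = scale (inv z) (dual (dual I))"
      unfolding K_def by (rule dual_scale[OF z(2) dual_carrier])
    have I2: "dual (dual I) = I" using I subset_double_dual[OF Ic] by blast
    have "dual (dual K) = scale z (dual I)"
      unfolding dK I2 using dual_scale[OF zc(3) Ic] z(2) by simp
    then have "dual (dual K) \<subseteq> K" by (simp add: K_def)
    moreover have "subm A K" unfolding K_def by (intro subm_scale A_carrier dual_subm Ic zc)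
    moreover have "K \<subseteq> A"
      unfolding K_def using z(1) zc(1) by (auto simp: dual_def scale_def m_comm)
    moreover have "C \<subseteq> K"
    proof
      fix c assume c: "c \<in> C"
      have cc: "c \<in> carrier Q" using c C_subset_A by auto
      have "inv z \<otimes> c \<in> dual I"
        unfolding dual_def
      proof (intro CollectI conjI ballI)
        show "inv z \<otimes> c \<in> carrier Q" using zc cc by simp
        fix x assume "x \<in> I"
        then obtain t where t: "t \<in> S" "x = z \<otimes> t" using z(3) by (metis mem_scale subsetD)
        have "inv z \<otimes> c \<otimes> x = inv z \<otimes> (z \<otimes> (c \<otimes> t))"
          unfolding t(2) using zc cc S_closed[OF t(1)] by algebra
        also have "\<dots> = c \<otimes> t" using Units_cancel[OF z(2)] cc t by simp
        finally show "inv z \<otimes> c \<otimes> x \<in> A" using c t by (simp add: C_def)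
      qed
      moreover have "c = z \<otimes> (inv z \<otimes> c)" using Units_cancel'[OF z(2) cc] by simp
      ultimately show "c \<in> K" unfolding K_def by (auto simp: mem_scale)
    qed
    ultimately obtain u where u: "u \<in> Units Q" "scale u K \<in> F" using F(2) by blast
    have "dual (scale u K) = scale (inv u) (scale (inv z) I)"
      using dual_scale[OF u(1) Kc] dK I2 by simp
    also have "\<dots> = scale (inv u \<otimes> inv z) I" using u zc Ic by (simp add: scale_scale)
    finally have "scale (inv u \<otimes> inv z) I \<in> dual ` F" using u(2) by (metis imageI)
    moreover have "inv u \<otimes> inv z \<in> Units Q" using u zc by simp
    ultimately show "\<exists>u\<in>Units Q. scale u I \<in> dual ` F" by blast
  qed
qed

end

section \<open>Lengths and multiplicity\<close>

context local_fractions
begin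

section \<open>Additivity of length\<close>

definition has_length :: "'a set \<Rightarrow> 'a set \<Rightarrow> nat \<Rightarrow> bool" where
  "has_length Z Y n \<longleftrightarrow> chain Z Y n \<and> (\<forall>k. chain Z Y k \<longrightarrow> k \<le> n)"

lemma chain_mono: "chain Z Y n \<Longrightarrow> Z' \<subseteq> Z \<Longrightarrow> Y \<subseteq> Y' \<Longrightarrow> chain Z' Y' n"
  unfolding chain_def by (meson order_trans)

lemma chain_less: "chain Z Y n \<Longrightarrow> k \<le> n \<Longrightarrow> chain Z Y k"
  unfolding chain_def by (meson le_trans less_le_trans)

lemma chain_0: "subm A Y \<Longrightarrow> Z \<subseteq> Y \<Longrightarrow> chain Z Y 0"
  unfolding chain_def by auto

lemma chain_append:
  assumes ab: "chain Z Y a" "chain Y X' b" and sub: "Z \<subseteq> Y" "Y \<subseteq> X'"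
  shows "chain Z X' (a + b)"
proof -
  obtain N where N: "\<forall>i\<le>a. subm A (N i) \<and> Z \<subseteq> N i \<and> N i \<subseteq> Y" "\<forall>i<a. N i \<subset> N (Suc i)"
    using ab(1) unfolding chain_def by blast
  obtain L where L: "\<forall>i\<le>b. subm A (L i) \<and> Y \<subseteq> L i \<and> L i \<subseteq> X'" "\<forall>i<b. L i \<subset> L (Suc i)"
    using ab(2) unfolding chain_def by blast
  \<comment> \<open>At the joint the last module \<open>N a\<close> is dropped in favour of
    \<open>L 0\<close>. The step from \<open>N (a - 1)\<close> to \<open>L 0\<close> stays strict
    because \<open>N a\<close>, \<open>Y\<close> and \<open>L 0\<close> are nested.\<close>
  define K where "K i = (if i < a then N i else L (i - a))" for i
  show ?thesis
    unfolding chain_def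
  proof (intro exI[of _ K] conjI allI impI)
    fix i assume "i \<le> a + b"
    then have "subm A (K i) \<and> Z \<subseteq> K i \<and> K i \<subseteq> X'"
    proof (cases "i < a")
      case True
      then have "subm A (N i) \<and> Z \<subseteq> N i \<and> N i \<subseteq> Y" using N(1) by simp
      then show ?thesis using True sub by (auto simp: K_def)
    next
      case False
      then have "subm A (L (i - a)) \<and> Y \<subseteq> L (i - a) \<and> L (i - a) \<subseteq> X'" 
        using L(1) \<open>i \<le> a + b\<close> by simp
      then show ?thesis using False sub by (auto simp: K_def)
    qed
    then show "subm A (K i)" "Z \<subseteq> K i" "K i \<subseteq> X'" by blast+
  next
    fix i assume i: "i < a + b"
    consider "Suc i < a" | "Suc i = a" | "a \<le> i" by linarith
    then show "K i \<subset> K (Suc i)"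
    proof cases
      case 2
      then have "N i \<subset> N a" "N a \<subseteq> Y" "Y \<subseteq> L 0" using N L by auto
      then show ?thesis using 2 by (auto simp: K_def)
    next
      case 3
      then show ?thesis using L(2)[rule_format, of "i - a"] i by (simp add: K_def Suc_diff_le)
    qed (use N in \<open>auto simp: K_def\<close>)
  qed
qed

text \<open>Repetitions are deleted from a weakly increasing chain, one index at a time; the
  induction keeps \<open>N k\<close> as the last module of the thinned chain.\<close>

lemma strictly_increasing_indices:
  fixes N :: "nat \<Rightarrow> 'a set"
  assumes "\<And>i. i < n \<Longrightarrow> N i \<subseteq> N (Suc i)" "\<And>i. i \<le> n \<Longrightarrow> subm A (N i) \<and> Z \<subseteq> N i \<and> N i \<subseteq> Y"
  shows "chain Z Y (card {i. i < n \<and> N i \<noteq> N (Suc i)})"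
proof -
  have "\<exists>L. (\<forall>i\<le>card {i. i < k \<and> N i \<noteq> N (Suc i)}. subm A (L i) \<and> Z \<subseteq> L i \<and> L i \<subseteq> Y) \<and>
      (\<forall>i<card {i. i < k \<and> N i \<noteq> N (Suc i)}. L i \<subset> L (Suc i)) \<and>
      L (card {i. i < k \<and> N i \<noteq> N (Suc i)}) = N k" if "k \<le> n" for k
    using that
  proof (induction k)
    case 0
    then show ?case using assms(2)[of 0] by (intro exI[of _ "\<lambda>_. N 0"]) auto
  next
    case (Suc k)
    let ?c = "card {i. i < k \<and> N i \<noteq> N (Suc i)}"
    obtain L where L: "\<forall>i\<le>?c. subm A (L i) \<and> Z \<subseteq> L i \<and> L i \<subseteq> Y" "\<forall>i<?c. L i \<subset> L (Suc i)" "L ?c = N k"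
      using Suc by auto
    show ?case
    proof (cases "N k = N (Suc k)")
      case True
      then have "{i. i < Suc k \<and> N i \<noteq> N (Suc i)} = {i. i < k \<and> N i \<noteq> N (Suc i)}"
        using less_Suc_eq by blast
      then show ?thesis using L True by auto
    next
      case False
      then have eq: "{i. i < Suc k \<and> N i \<noteq> N (Suc i)} = insert k {i. i < k \<and> N i \<noteq> N (Suc i)}"
        using less_Suc_eq by blast
      have card: "card {i. i < Suc k \<and> N i \<noteq> N (Suc i)} = Suc ?c"
        unfolding eq by (subst card_insert_disjoint) auto
      define L' where "L' i = (if i \<le> ?c then L i else N (Suc k))" for i
      have "N k \<subset> N (Suc k)" using False assms(1)[of k] Suc.prems by auto
      then show ?thesis
        unfolding card using L assms(2)[of "Suc k"] Suc.prems
        by (intro exI[of _ L']) (auto simp: L'_def le_Suc_eq less_Suc_eq)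
    qed
  qed
  from this[of n] show ?thesis unfolding chain_def by blast
qed

text \<open>Modular law: in every step of the chain the intersection with \<^term>\<open>Y\<close> or the sum with \<^term>\<open>Y\<close> grows.\<close>

lemma chain_split:
  assumes ch: "chain Z X' n" and Y: "subm A Y" "Z \<subseteq> Y" "Y \<subseteq> X'" and X': "subm A X'"
  obtains a b where "chain Z Y a" "chain Y X' b" "n \<le> a + b"
proof -
  obtain N where N: "\<forall>i\<le>n. subm A (N i) \<and> Z \<subseteq> N i \<and> N i \<subseteq> X'" "\<forall>i<n. N i \<subset> N (Suc i)"
    using ch unfolding chain_def by blast
  define I where "I i = N i \<inter> Y" for i
  define J where "J i = msum (N i) Y" for i
  let ?a = "{i. i < n \<and> I i \<noteq> I (Suc i)}" and ?b = "{i. i < n \<and> J i \<noteq> J (Suc i)}"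
  have a: "chain Z Y (card ?a)"
  proof (rule strictly_increasing_indices)
    show "i < n \<Longrightarrow> I i \<subseteq> I (Suc i)" for i using N by (auto simp: I_def)
    fix i assume "i \<le> n"
    then have i: "subm A (N i)" "Z \<subseteq> N i" using N by auto
    show "subm A (I i) \<and> Z \<subseteq> I i \<and> I i \<subseteq> Y"
      unfolding I_def using subm_Int[OF i(1) Y(1)] i(2) Y(2) by auto
  qed
  have b: "chain Y X' (card ?b)"
  proof (rule strictly_increasing_indices)
    show "i < n \<Longrightarrow> J i \<subseteq> J (Suc i)" for i using N(2) unfolding J_def msum_def by fast
    fix i assume "i \<le> n"
    then have i: "subm A (N i)" "N i \<subseteq> X'" using N by auto
    show "subm A (J i) \<and> Y \<subseteq> J i \<and> J i \<subseteq> X'"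
      unfolding J_def using subm_msum[OF A_carrier i(1) Y(1)] msum_upper2[OF i(1) Y(1)]
        msum_least[OF X' i(2) Y(3)] by blast
  qed
  have "{..<n} \<subseteq> ?a \<union> ?b"
  proof
    fix i assume i: "i \<in> {..<n}"
    have s: "subm A (N i)" "subm A (N (Suc i))" "N i \<subset> N (Suc i)" using N i by auto
    show "i \<in> ?a \<union> ?b"
    proof (rule ccontr)
      assume "i \<notin> ?a \<union> ?b"
      then have eq: "I i = I (Suc i)" "J i = J (Suc i)" using i by auto
      have "N (Suc i) \<subseteq> N i"
      proof
        fix x assume x: "x \<in> N (Suc i)"
        then have "x \<in> J i" using eq(2) msum_upper1[OF s(2) Y(1)] unfolding J_def by blast
        then obtain u v where uv: "u \<in> N i" "v \<in> Y" "x = u \<oplus> v" by (auto simp: J_def mem_msum)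
        have c: "u \<in> carrier Q" "v \<in> carrier Q" using uv subm_carrier s Y by blast+
        have "u \<in> N (Suc i)" using uv s by blast
        then have "x \<ominus> u \<in> N (Suc i)" using subm_diffA[OF s(2) x] by blast
        moreover have "x \<ominus> u = v" unfolding uv(3) using c by algebra
        ultimately have "v \<in> I (Suc i)" using uv by (simp add: I_def)
        then have "v \<in> N i" using eq(1) by (auto simp: I_def)
        then show "x \<in> N i" using uv subm_add[OF s(1)] by simp
      qed
      then show False using s by blast
    qed
  qed
  then have "card {..<n} \<le> card (?a \<union> ?b)" by (intro card_mono) auto
  then have "n \<le> card ?a + card ?b" using card_Un_le[of ?a ?b] by simp
  then show ?thesis using that a b by blast
qed

lemma has_length_add:
  assumes "has_length Z Y a" "has_length Y X' b" "subm A Y" "subm A X'" "Z \<subseteq> Y" "Y \<subseteq> X'"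
  shows "has_length Z X' (a + b)"
  unfolding has_length_def
proof (intro conjI allI impI)
  show "chain Z X' (a + b)" using assms chain_append unfolding has_length_def by blast
  fix k assume "chain Z X' k"
  then obtain c d where "chain Z Y c" "chain Y X' d" "k \<le> c + d"
    using chain_split[OF _ assms(3,5,6,4)] by metis
  then show "k \<le> a + b" using assms(1,2) unfolding has_length_def by (meson add_mono le_trans)
qed

lemma has_length_unique: "has_length Z Y a \<Longrightarrow> has_length Z Y b \<Longrightarrow> a = b"
  unfolding has_length_def by (meson le_antisym)

lemma has_length_self: "subm A Y \<Longrightarrow> has_length Y Y 0"
  unfolding has_length_def using chain_0
  by (auto simp: chain_def) (metis gr_zeroI less_eq_Suc_le psubset_eq subset_antisym zero_le)

lemma scale_mono: "M \<subseteq> N \<Longrightarrow> scale u M \<subseteq> scale u N"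
  by (auto simp: scale_def)

lemma chain_scale:
  assumes u: "u \<in> Units Q" and ch: "chain Z Y n"
  shows "chain (scale u Z) (scale u Y) n"
proof -
  obtain N where N: "\<forall>i\<le>n. subm A (N i) \<and> Z \<subseteq> N i \<and> N i \<subseteq> Y" "\<forall>i<n. N i \<subset> N (Suc i)"
    using ch unfolding chain_def by blast
  have "scale u (N i) \<subset> scale u (N (Suc i))" if "i < n" for i
    using N that scale_subset_iff[OF u, of "N i" "N (Suc i)"] scale_subset_iff[OF u, of "N (Suc i)" "N i"]
      subm_carrier[of A "N i"] subm_carrier[of A "N (Suc i)"] by (auto simp: psubset_eq)
  moreover have "subm A (scale u (N i)) \<and> scale u Z \<subseteq> scale u (N i) \<and> scale u (N i) \<subseteq> scale u Y"
    if "i \<le> n" for i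
  proof -
    have "subm A (N i)" "Z \<subseteq> N i" "N i \<subseteq> Y" using N(1) that by auto
    then show ?thesis using subm_scale[OF A_carrier _ Units_closed[OF u]] scale_mono by simp
  qed
  ultimately show ?thesis
    unfolding chain_def by (intro exI[of _ "\<lambda>i. scale u (N i)"]) blast
qed

lemma has_length_scale:
  assumes u: "u \<in> Units Q" and YZ: "Z \<subseteq> carrier Q" "Y \<subseteq> carrier Q" and l: "has_length Z Y n"
  shows "has_length (scale u Z) (scale u Y) n"
  unfolding has_length_def
proof (intro conjI allI impI)
  show "chain (scale u Z) (scale u Y) n" using chain_scale[OF u] l by (simp add: has_length_def)
  fix k assume "chain (scale u Z) (scale u Y) k"
  then have "chain (scale (inv u) (scale u Z)) (scale (inv u) (scale u Y)) k"
    using u by (intro chain_scale[of "inv u" "scale u Z"]) auto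
  then have "chain Z Y k" by (simp add: scale_inv_cancel(2)[OF u] YZ)
  then show "k \<le> n" using l by (simp add: has_length_def)
qed

text \<open>Because \<open>m\<close> kills \<open>Y/Z\<close>, adjoining one element to a module
  between \<open>Z\<close> and \<open>Y\<close> is a simple step. A largest \<open>N\<close> of
  finite length over \<open>Z\<close> therefore has to be \<open>Y\<close>.\<close>

lemma has_length_exists:
  assumes Z: "subm A Z" and Y: "subm A Y" "Z \<subseteq> Y" "Y \<subseteq> A"
    and mY: "\<And>a y. a \<in> m \<Longrightarrow> y \<in> Y \<Longrightarrow> a \<otimes> y \<in> Z"
  obtains n where "has_length Z Y n"
proof -
  define F where "F = {N. subm A N \<and> Z \<subseteq> N \<and> N \<subseteq> Y \<and> (\<exists>n. has_length Z N n)}"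
  have "\<exists>N\<in>F. \<forall>K\<in>F. N \<subseteq> K \<longrightarrow> K = N"
  proof (rule acc)
    have "Z \<in> F" unfolding F_def using Z Y(2) has_length_self[OF Z] by blast
    then show "F \<noteq> {}" by blast
  qed (use Y(3) in \<open>auto simp: F_def\<close>)
  then obtain N n where N: "subm A N" "Z \<subseteq> N" "N \<subseteq> Y" "has_length Z N n"
      and max: "\<forall>K\<in>F. N \<subseteq> K \<longrightarrow> K = N" unfolding F_def by blast
  have "N = Y"
  proof (rule ccontr)
    assume "N \<noteq> Y"
    then obtain x where x: "x \<in> Y" "x \<notin> N" using N by blast
    have xc: "x \<in> carrier Q" using x Y by auto
    let ?N' = "msum N (scale x A)"
    note px = subm_principal[OF xc]
    have "x \<in> ?N'" using subsetD[OF msum_upper2[OF N(1) px] principal_self[OF xc]] .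
    note N' = subm_msum[OF A_carrier N(1) px] msum_upper1[OF N(1) px]
      msum_least[OF Y(1) N(3) principal_least[OF Y(1) x(1)]] this
    have simple: "L = N \<or> L = ?N'" if L: "subm A L" "N \<subseteq> L" "L \<subseteq> ?N'" for L
    proof (cases "L \<subseteq> N")
      case True then show ?thesis using L by blast
    next
      case False
      then obtain l where l: "l \<in> L" "l \<notin> N" by blast
      have "l \<in> ?N'" using l(1) L(3) by blast
      then obtain v w where "v \<in> N" "w \<in> scale x A" "l = v \<oplus> w" by (auto simp: mem_msum)
      then obtain a where va: "v \<in> N" "a \<in> A" "l = v \<oplus> x \<otimes> a" by (auto simp: mem_scale)
      have vc: "v \<in> carrier Q" using va N Y by (auto simp: subset_iff)
      have eq: "l \<ominus> v = a \<otimes> x" unfolding va(3) using vc xc A_closed[OF va(2)] by algebra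
      have "a \<notin> m"
      proof
        assume "a \<in> m"
        then have "a \<otimes> x \<in> N" using mY x N by blast
        moreover have "l = v \<oplus> a \<otimes> x" using va xc by (simp add: m_comm)
        ultimately show False using subm_add[OF N(1) va(1)] l by simp
      qed
      moreover have "a \<otimes> x \<in> L" using subm_diffA[OF L(1) l(1), of v] va L(2) eq by auto
      ultimately have "x \<in> L" using subm_unit_cancel[OF L(1) va(2) _ xc] by blast
      then have "?N' \<subseteq> L" by (intro msum_least[OF L(1,2)] principal_least[OF L(1)])
      then show ?thesis using L by blast
    qed
    have "has_length N ?N' 1"
      unfolding has_length_def
    proof (intro conjI allI impI)
      show "chain N ?N' 1"
        by (rule chain_of_list[of "[N, ?N']"]) (use N N' x in auto)
      fix k assume "chain N ?N' k"
      show "k \<le> 1"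
      proof (rule ccontr)
        assume "\<not> k \<le> 1"
        then have "chain N ?N' 2" using chain_less[OF \<open>chain N ?N' k\<close>] by simp
        then obtain L where L: "\<forall>i\<le>2. subm A (L i) \<and> N \<subseteq> L i \<and> L i \<subseteq> ?N'" "\<forall>i<2. L i \<subset> L (Suc i)"
          unfolding chain_def by blast
        have "L 0 \<subset> L 1" "L 1 \<subset> L 2" using L(2) by (auto simp: numeral_2_eq_2)
        moreover have "L 1 = N \<or> L 1 = ?N'" using simple L(1) by simp
        moreover have "N \<subseteq> L 0" "L 2 \<subseteq> ?N'" using L(1) by auto
        ultimately show False by blast
      qed
    qed
    then have "has_length Z ?N' (n + 1)" using has_length_add[OF N(4) _ N(1) N'(1) N(2) N'(2)] by blast
    then have "?N' \<in> F" unfolding F_def using N N' by blast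
    then show False using max N' x by blast
  qed
  then show ?thesis using that N by blast
qed

section \<open>Products and powers of the maximal ideal\<close>

text \<open>Taking the least submodule with all products avoids finite sums: an inclusion into a
  module has to be checked on products only.\<close>

definition product :: "'a set \<Rightarrow> 'a set \<Rightarrow> 'a set" where
  "product M N = \<Inter>{Z. subm A Z \<and> (\<forall>x\<in>M. \<forall>y\<in>N. x \<otimes> y \<in> Z)}"

lemma product_mem: "x \<in> M \<Longrightarrow> y \<in> N \<Longrightarrow> x \<otimes> y \<in> product M N"
  by (auto simp: product_def)

lemma product_least: "subm A Z \<Longrightarrow> (\<And>x y. x \<in> M \<Longrightarrow> y \<in> N \<Longrightarrow> x \<otimes> y \<in> Z) \<Longrightarrow> product M N \<subseteq> Z"
  by (auto simp: product_def)

lemma subm_Inter: "\<F> \<noteq> {} \<Longrightarrow> (\<And>Z. Z \<in> \<F> \<Longrightarrow> subm T Z) \<Longrightarrow> subm T (\<Inter>\<F>)"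
  unfolding subm_def by (auto simp: Inter_iff) blast

lemma subm_carrier_Q: "subm A (carrier Q)"
  using A_carrier by (auto simp: subm_def)

lemma product_subm:
  assumes "M \<subseteq> carrier Q" "N \<subseteq> carrier Q" shows "subm A (product M N)"
  unfolding product_def
proof (rule subm_Inter)
  have "carrier Q \<in> {Z. subm A Z \<and> (\<forall>x\<in>M. \<forall>y\<in>N. x \<otimes> y \<in> Z)}"
    using assms subm_carrier_Q by auto
  then show "{Z. subm A Z \<and> (\<forall>x\<in>M. \<forall>y\<in>N. x \<otimes> y \<in> Z)} \<noteq> {}" by blast
qed auto

primrec m_power :: "nat \<Rightarrow> 'a set" where
  "m_power 0 = A"
| "m_power (Suc n) = product (m_power n) m"

lemma m_carrier: "m \<subseteq> carrier Q"
  using m_ideal A_carrier by blast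

lemma m_power_subm: "subm A (m_power n)"
  by (induction n) (auto simp: A_ring intro!: product_subm m_carrier subm_carrier)

lemma m_power_carrier: "m_power n \<subseteq> carrier Q"
  using m_power_subm subm_carrier by blast

lemma m_power_Suc_subset: "m_power (Suc n) \<subseteq> m_power n"
  unfolding m_power.simps
proof (rule product_least[OF m_power_subm])
  fix x y assume "x \<in> m_power n" "y \<in> m"
  then show "x \<otimes> y \<in> m_power n"
    using subm_smult[OF m_power_subm, of y x n] m_ideal m_power_carrier[of n]
    by (auto simp: m_comm subset_iff)
qed

lemma m_power_subset_A: "m_power n \<subseteq> A"
  by (induction n) (use m_power_Suc_subset in auto)

lemma m_power_1: "m_power (Suc 0) = m"
proof
  show "m_power (Suc 0) \<subseteq> m"
    unfolding m_power.simps by (intro product_least m_ideal(1) subm_smult[OF m_ideal(1)])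
  show "m \<subseteq> m_power (Suc 0)"
  proof
    fix a assume a: "a \<in> m"
    then have "\<one> \<otimes> a \<in> m_power (Suc 0)" unfolding m_power.simps using A_one by (intro product_mem)
    then show "a \<in> m_power (Suc 0)" using a m_carrier by auto
  qed
qed

end

context finite_normalization
begin

section \<open>Minimal generators and growth of lengths\<close>

definition generates_m :: "'a set \<Rightarrow> bool" where
  "generates_m G \<longleftrightarrow> G \<subseteq> m \<and> (\<forall>Z. subm A Z \<longrightarrow> G \<subseteq> Z \<longrightarrow> m \<subseteq> Z)"

lemma minimal_generators_chain:
  assumes G: "finite G" "generates_m G" and min: "\<And>H. finite H \<Longrightarrow> generates_m H \<Longrightarrow> card G \<le> card H"
  shows "chain (m_power (Suc (Suc 0))) m (card G)"
proof -
  let ?m2 = "m_power (Suc (Suc 0))"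
  obtain xs where xs: "set xs = G" "distinct xs" using finite_distinct_list[OF G(1)] by blast
  have len: "length xs = card G" using xs distinct_card by fastforce
  have Gm: "G \<subseteq> m" using G(2) by (simp add: generates_m_def)
  have m2: "?m2 \<subseteq> m" using m_power_Suc_subset m_power_1 by blast
  define N where "N i = \<Inter>{Z. subm A Z \<and> ?m2 \<subseteq> Z \<and> set (take i xs) \<subseteq> Z}" for i
  have sub: "set (take i xs) \<subseteq> G" for i using xs set_take_subset by metis
  have inm: "m \<in> {Z. subm A Z \<and> ?m2 \<subseteq> Z \<and> set (take i xs) \<subseteq> Z}" for i
    using m2 m_ideal sub Gm by blast
  have N: "subm A (N i) \<and> ?m2 \<subseteq> N i \<and> N i \<subseteq> m" for i
    unfolding N_def using inm[of i] by (intro conjI subm_Inter Inter_greatest Inter_lower) auto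
  have least: "N i \<subseteq> Z" if "subm A Z" "?m2 \<subseteq> Z" "set (take i xs) \<subseteq> Z" for i Z
    unfolding N_def using that by blast
  have takeN: "set (take i xs) \<subseteq> N i" for i unfolding N_def by blast
  have "N i \<subset> N (Suc i)" if i: "i < card G" for i
  proof -
    have ts: "set (take (Suc i) xs) = insert (xs ! i) (set (take i xs))"
      using i len by (simp add: take_Suc_conv_app_nth)
    then have "N i \<subseteq> N (Suc i)"
      using N takeN[of "Suc i"] by (intro least) auto
    moreover have "xs ! i \<in> N (Suc i)" using takeN[of "Suc i"] ts by blast
    moreover have "xs ! i \<notin> N i"
    proof
      assume xi: "xs ! i \<in> N i"
      have xiG: "xs ! i \<in> G" using xs i len by auto
      define H where "H = G - {xs ! i}"
      have H: "finite H" "H \<subseteq> m"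
        unfolding H_def using G(1) Gm by auto
      have Hcard: "card H < card G" unfolding H_def by (rule card_Diff1_less[OF G(1) xiG])
      have "xs ! i \<notin> set (take i xs)"
        using xs(2) i len by (auto simp: in_set_conv_nth nth_eq_iff_index_eq)
      then have tH: "set (take i xs) \<subseteq> H" using sub by (auto simp: H_def)
      define Y where "Y = \<Inter>{Z. subm A Z \<and> H \<subseteq> Z}"
      have Y: "subm A Y" "H \<subseteq> Y" "Y \<subseteq> m"
        unfolding Y_def using m_ideal(1) H(2) by (auto intro!: subm_Inter)
      have "Y = m"
      proof (rule ccontr)
        assume "Y \<noteq> m"
        then obtain N' where N': "subm A N'" "Y \<subseteq> N'" "N' \<subseteq> m" "N' \<noteq> m"
            "\<And>a x. a \<in> m \<Longrightarrow> x \<in> m \<Longrightarrow> a \<otimes> x \<in> N'"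
          using nakayama[OF Y(1) m_ideal(1) _ Y(3)] m_ideal(2) A_subset_S by blast
        have "?m2 \<subseteq> N'"
          unfolding m_power.simps(2)[of "Suc 0"] m_power_1 using N' by (intro product_least)
        then have "N i \<subseteq> N'" using N' Y tH by (intro least) auto
        then have "G \<subseteq> N'" using xi Y N' H_def by blast
        then have "m \<subseteq> N'" using G(2) N' by (auto simp: generates_m_def)
        then show False using N' by blast
      qed
      then have "generates_m H" unfolding generates_m_def using H(2) Y_def by blast
      then show False using min[OF H(1)] Hcard by simp
    qed
    ultimately show ?thesis by blast
  qed
  then show ?thesis unfolding chain_def using N by blast
qed

text \<open>Lengths of \<open>A/m\<^sup>n\<close> eventually grow by a constant \<^term>\<open>e\<close>.  If \<open>m\<^sup>2 \<noteq> ym\<close>, inserting \<open>m\<^sup>2\<close> into the chain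
  \<open>m \<supseteq> ym \<supseteq> y\<^sup>2m \<supseteq> \<dots>\<close> gives steps longer than \<open>\<mu>(m)\<close>.\<close>

lemma hilbert_samuel:
  obtains y e l k where "y \<in> m" "y \<in> Units Q" "\<And>n. has_length (m_power n) A (l n)"
    "\<And>n. k \<le> n \<Longrightarrow> l (Suc n) = l n + e"
    "\<And>\<mu> a b. chain (m_power (Suc (Suc 0))) m \<mu> \<Longrightarrow> e \<le> \<mu> \<Longrightarrow> a \<in> m \<Longrightarrow> b \<in> m \<Longrightarrow> a \<otimes> b \<in> scale y m"
proof -
  obtain y where y: "y \<in> m" "y \<in> Units Q" "m \<subseteq> scale y S"
    using principal_reduction[OF m_ideal(1,2) m_regular] by blast
  have yc: "y \<in> carrier Q" "inv y \<in> carrier Q" "inv y \<in> Units Q" using y by auto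
  have yp: "y [^] n \<in> carrier Q" "y [^] n \<in> Units Q" for n :: nat
    using yc Units_pow_closed[OF y(2)] by auto
  have yle: "scale y (m_power n) \<subseteq> m_power (Suc n)" for n
  proof
    fix v assume "v \<in> scale y (m_power n)"
    then obtain x where x: "x \<in> m_power n" "v = y \<otimes> x" by (auto simp: mem_scale)
    then have "v = x \<otimes> y" using m_power_carrier[of n] yc by (auto simp: m_comm)
    then show "v \<in> m_power (Suc n)" using product_mem[OF x(1) y(1)] by simp
  qed
  have inS: "m_power n \<subseteq> scale (y [^] n) S" for n
  proof (induction n)
    case 0
    then show ?case using A_subset_S scale_one[OF S_carrier] by simp
  next
    case (Suc n)
    show ?case
      unfolding m_power.simps
    proof (rule product_least)
      show "subm A (scale (y [^] Suc n) S)" using subm_S_imp_A S_principal yp by blast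
      fix a b assume "a \<in> m_power n" "b \<in> m"
      then obtain s t where st: "s \<in> S" "t \<in> S" "a = y [^] n \<otimes> s" "b = y \<otimes> t"
        using subsetD[OF Suc] subsetD[OF y(3)] unfolding mem_scale by metis
      have c: "s \<in> carrier Q" "t \<in> carrier Q" using st by auto
      have "a \<otimes> b = y [^] Suc n \<otimes> (s \<otimes> t)" unfolding st(3,4) using c yc yp by (simp add: m_ac)
      then show "a \<otimes> b \<in> scale (y [^] Suc n) S" using S_mult[OF st(1,2)] by (auto simp: mem_scale)
    qed
  qed
  \<comment> \<open>\<open>W n\<close> is \<open>y^-n m^n\<close>. These modules increase because
    \<open>y m^n\<close> lies in \<open>m^(n+1)\<close>, and they stay in \<open>S\<close> because
    \<open>m\<close> lies in \<open>yS\<close>. Once they are constant,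
    \<open>m^(n+1) = y m^n\<close>.\<close>
  define W where "W n = scale (inv (y [^] n)) (m_power n)" for n :: nat
  have W_S: "subm A (W n) \<and> W n \<subseteq> S" for n
  proof
    show "subm A (W n)" unfolding W_def using yp by (intro subm_scale A_carrier m_power_subm) auto
    show "W n \<subseteq> S"
    proof
      fix v assume "v \<in> W n"
      then obtain x where x: "x \<in> m_power n" "v = inv (y [^] n) \<otimes> x" by (auto simp: W_def mem_scale)
      obtain s where s: "s \<in> S" "x = y [^] n \<otimes> s" using inS x(1) by (auto simp: mem_scale subset_iff)
      then show "v \<in> S" using x(2) Units_cancel[OF yp(2)] by simp
    qed
  qed
  have W_pow: "m_power n = scale (y [^] n) (W n)" for n
    unfolding W_def using scale_inv_cancel(1)[OF yp(2) m_power_carrier] by simp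
  have W_Suc: "scale (y [^] Suc n) (W n) = scale y (m_power n)" for n
    unfolding W_pow[of n] using subm_carrier W_S[of n] yp yc
    by (subst scale_scale) (auto simp: m_comm)
  have W_mono: "W n \<subseteq> W (Suc n)" for n
    using yle[of n] W_Suc[of n] W_pow[of "Suc n"] scale_subset_iff[OF yp(2), of "W n" "W (Suc n)" "Suc n"]
      subm_carrier W_S by metis
  have "\<exists>M\<in>range W. \<forall>N\<in>range W. M \<subseteq> N \<longrightarrow> N = M"
    using W_S by (intro acc_S) auto
  then obtain k0 where k0: "\<And>n. W k0 \<subseteq> W n \<Longrightarrow> W n = W k0" by auto
  \<comment> \<open>One more than \<open>k0\<close>, so that \<open>k\<close> is positive and
    \<open>m^k\<close> lies in \<open>m\<close>.\<close>
  define k where "k = Suc k0"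
  have W_const: "W n = W k0" if "k0 \<le> n" for n
    using k0 lift_Suc_mono_le[of W] W_mono that by blast
  have step: "m_power (Suc n) = scale y (m_power n)" if "k \<le> n" for n
    using W_pow[of "Suc n"] W_Suc[of n] W_const[of n] W_const[of "Suc n"] that by (simp add: k_def)
  have "\<exists>d. has_length (m_power (Suc n)) (m_power n) d" for n
  proof -
    have "a \<otimes> x \<in> m_power (Suc n)" if "a \<in> m" "x \<in> m_power n" for a x
    proof -
      have "a \<otimes> x = x \<otimes> a" using that m_power_carrier[of n] m_carrier by (auto simp: m_comm subset_iff)
      then show ?thesis using product_mem[OF that(2,1)] by simp
    qed
    then show ?thesis
      using has_length_exists[OF m_power_subm m_power_subm m_power_Suc_subset m_power_subset_A] by metis
  qed
  then obtain d where d: "\<And>n. has_length (m_power (Suc n)) (m_power n) (d n)" by metis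
  define l where "l n = (\<Sum>i<n. d i)" for n
  have l: "has_length (m_power n) A (l n)" for n
  proof (induction n)
    case 0
    then show ?case using has_length_self[OF A_ring] by (simp add: l_def)
  next
    case (Suc n)
    have "has_length (m_power (Suc n)) A (d n + l n)"
      using has_length_add[OF d Suc m_power_subm A_ring m_power_Suc_subset m_power_subset_A] .
    then show ?case by (simp add: l_def add.commute)
  qed
  have d_const: "d n = d k" if "k \<le> n" for n
    using that
  proof (induction n rule: dec_induct)
    case (step n)
    have "has_length (m_power (Suc (Suc n))) (m_power (Suc n)) (d n)"
      using has_length_scale[OF y(2) m_power_carrier m_power_carrier d, of n] \<open>k \<le> n\<close>
        \<open>\<And>n. k \<le> n \<Longrightarrow> m_power (Suc n) = scale y (m_power n)\<close>[of n]
        \<open>\<And>n. k \<le> n \<Longrightarrow> m_power (Suc n) = scale y (m_power n)\<close>[of "Suc n"] by simp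
    then have "d (Suc n) = d n" using has_length_unique d by blast
    then show ?case using step by simp
  qed simp
  have l_Suc: "l (Suc n) = l n + d k" if "k \<le> n" for n
    using d_const[OF that] by (simp add: l_def)
  have main: "a \<otimes> b \<in> scale y m"
    if ch: "chain (m_power (Suc (Suc 0))) m \<mu>" and e: "d k \<le> \<mu>" and ab: "a \<in> m" "b \<in> m" for \<mu> a b
  proof (rule ccontr)
    assume nin: "a \<otimes> b \<notin> scale y m"
    let ?m2 = "m_power (Suc (Suc 0))"
    have "a \<otimes> b \<in> ?m2" using product_mem[of a "m_power (Suc 0)" b m] ab m_power_1 by simp
    moreover have ym: "scale y m \<subseteq> ?m2" using yle[of "Suc 0"] m_power_1 by simp
    ultimately have "chain (scale y m) ?m2 1"
      using nin by (intro chain_of_list[of "[scale y m, ?m2]"])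
        (auto intro: subm_scale A_carrier m_ideal m_power_subm yc simp del: m_power.simps)
    \<comment> \<open>The product \<open>a b\<close> makes the inclusion of \<open>ym\<close> in
      \<open>m^2\<close> strict, and this adds one step to the chain of length
      \<open>\<mu>\<close>.\<close>
    then have ch1: "chain (scale y m) m (Suc \<mu>)"
      using chain_append[OF _ ch] ym m_power_Suc_subset[of "Suc 0"] m_power_1 by fastforce
    have ychain: "chain (scale (y [^] n) m) m (n * Suc \<mu>)" for n :: nat
    proof (induction n)
      case 0
      then show ?case using chain_0[OF m_ideal(1)] m_carrier by (simp add: scale_one)
    next
      case (Suc n)
      have "scale (y [^] n) (scale y m) = scale (y [^] Suc n) m"
        using yp yc m_carrier by (simp add: scale_scale)
      then have "chain (scale (y [^] Suc n) m) (scale (y [^] n) m) (Suc \<mu>)"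
        using chain_scale[OF yp(2) ch1, of n] by simp
      moreover have ypA: "y [^] n \<in> A" "y \<in> A" for n :: nat using y m_ideal A_pow by auto
      have "scale (y [^] n) m \<subseteq> m" for n :: nat
        using subm_smult[OF m_ideal(1) ypA(1)] by (auto simp: scale_def)
      moreover have "scale y m \<subseteq> m"
        using subm_smult[OF m_ideal(1) ypA(2)] by (auto simp: scale_def)
      then have "scale (y [^] Suc n) m \<subseteq> scale (y [^] n) m"
        using \<open>scale (y [^] n) (scale y m) = _\<close>[symmetric] by (auto simp: scale_def)
      ultimately have "chain (scale (y [^] Suc n) m) m (Suc \<mu> + n * Suc \<mu>)"
        using chain_append[OF _ Suc] by blast
      then show ?case by (simp add: add.commute add.left_commute)
    qed
    have powers: "m_power (k + n) \<subseteq> scale (y [^] n) m" for n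
    proof (induction n)
      case 0
      have "m_power k \<subseteq> m"
        unfolding k_def using lift_Suc_antimono_le[of m_power "Suc 0" "Suc k0"] m_power_Suc_subset m_power_1
        by simp
      then show ?case using m_carrier by (simp add: scale_one)
    next
      case (Suc n)
      have "m_power (k + Suc n) = scale y (m_power (k + n))" using step[of "k + n"] by simp
      also have "\<dots> \<subseteq> scale y (scale (y [^] n) m)" using Suc by (auto simp: scale_def)
      also have "\<dots> = scale (y [^] Suc n) m"
        using yp yc m_carrier by (simp add: scale_scale m_comm)
      finally show ?case .
    qed
    have lk: "l (k + n) = l k + n * d k" for n
      by (induction n) (use l_Suc[of "k + _"] in auto)
    \<comment> \<open>The chain built from multiples of \<open>m\<close> grows by
      \<open>\<mu> + 1\<close> per step and the length by \<open>e\<close>, at most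
      \<open>\<mu>\<close>. The comparison leaves \<open>n\<close> bounded by the initial value
      \<open>l k\<close>, so \<open>l k + 1\<close> already contradicts it.\<close>
    define n where "n = Suc (l k)"
    have "chain (m_power (k + n)) A (n * Suc \<mu>)"
      using chain_mono[OF ychain powers m_ideal(2)] .
    then have "n * Suc \<mu> \<le> l (k + n)" using l by (auto simp: has_length_def)
    also have "\<dots> = l k + n * d k" by (rule lk)
    also have "\<dots> \<le> l k + n * \<mu>" using e by simp
    finally show False by (simp add: n_def)
  qed
  show ?thesis by (rule that[OF y(1,2) l l_Suc main])
qed

end

section \<open>The total ring of fractions\<close>

context cring
begin

section \<open>Fractions with regular denominators form a ring\<close>

abbreviation "NZ \<equiv> nonzerodivisors R"
abbreviation "TF \<equiv> total_fractions R"

lemma NZ_closed: "s \<in> NZ \<Longrightarrow> s \<in> carrier R"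
  by (simp add: nonzerodivisors_def)

lemma NZ_one: "\<one> \<in> NZ"
  by (simp add: nonzerodivisors_def)

lemma NZ_D: "s \<in> NZ \<Longrightarrow> x \<in> carrier R \<Longrightarrow> s \<otimes> x = \<zero> \<Longrightarrow> x = \<zero>"
  unfolding nonzerodivisors_def by blast

lemma NZ_I: "s \<in> carrier R \<Longrightarrow> (\<And>x. x \<in> carrier R \<Longrightarrow> s \<otimes> x = \<zero> \<Longrightarrow> x = \<zero>) \<Longrightarrow> s \<in> NZ"
  unfolding nonzerodivisors_def by blast

lemma NZ_mult: assumes s: "s \<in> NZ" and t: "t \<in> NZ" shows "s \<otimes> t \<in> NZ"
proof (rule NZ_I)
  show "s \<otimes> t \<in> carrier R" using s t by (simp add: NZ_closed)
  fix x assume x: "x \<in> carrier R" "s \<otimes> t \<otimes> x = \<zero>"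
  then have "s \<otimes> (t \<otimes> x) = \<zero>" using s t by (simp add: NZ_closed m_assoc)
  then have "t \<otimes> x = \<zero>" using NZ_D[OF s] NZ_closed[OF t] x(1) by simp
  then show "x = \<zero>" using NZ_D[OF t x(1)] by simp
qed

lemma NZ_cancel:
  assumes "s \<in> NZ" "x \<in> carrier R" "y \<in> carrier R" "s \<otimes> x = s \<otimes> y"
  shows "x = y"
proof -
  have s: "s \<in> carrier R" using assms by (simp add: NZ_closed)
  have "s \<otimes> (x \<ominus> y) = s \<otimes> x \<ominus> s \<otimes> y" using s assms(2,3) by algebra
  also have "\<dots> = \<zero>" using assms(4) s assms(3) by (simp add: a_minus_def r_neg)
  finally have "x \<ominus> y = \<zero>" using NZ_D[OF assms(1)] assms(2,3) by simp
  then show ?thesis using assms by simp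
qed

lemma mem_fraction:
  "(b, t) \<in> fraction R a s \<longleftrightarrow> b \<in> carrier R \<and> t \<in> NZ \<and> a \<otimes> t = b \<otimes> s"
  by (simp add: fraction_def)

lemma fraction_eq_iff:
  assumes "a \<in> carrier R" "b \<in> carrier R" "s \<in> NZ" "t \<in> NZ"
  shows "fraction R a s = fraction R b t \<longleftrightarrow> a \<otimes> t = b \<otimes> s"
proof
  assume "fraction R a s = fraction R b t"
  moreover have "(b, t) \<in> fraction R b t" using assms by (simp add: mem_fraction)
  ultimately show "a \<otimes> t = b \<otimes> s" by (metis mem_fraction)
next
  assume eq: "a \<otimes> t = b \<otimes> s"
  have sub: "fraction R a s \<subseteq> fraction R b t"
    if *: "a \<in> carrier R" "b \<in> carrier R" "s \<in> NZ" "t \<in> NZ" "a \<otimes> t = b \<otimes> s" for a b s t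
  proof
    fix p assume "p \<in> fraction R a s"
    then obtain c u where p: "p = (c, u)" and cu: "c \<in> carrier R" "u \<in> NZ" "a \<otimes> u = c \<otimes> s"
      by (cases p) (simp add: mem_fraction)
    have car: "s \<in> carrier R" "t \<in> carrier R" "u \<in> carrier R" using * cu by (simp_all add: NZ_closed)
    have "s \<otimes> (b \<otimes> u) = (b \<otimes> s) \<otimes> u" using car *(2) by algebra
    also have "\<dots> = (a \<otimes> t) \<otimes> u" by (simp only: *(5))
    also have "\<dots> = (a \<otimes> u) \<otimes> t" using car *(1) by algebra
    also have "\<dots> = s \<otimes> (c \<otimes> t)" unfolding cu(3) using car cu(1) by algebra
    finally have "b \<otimes> u = c \<otimes> t" using NZ_cancel[OF *(3)] car * cu by simp
    then show "p \<in> fraction R b t" using p cu by (simp add: mem_fraction)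
  qed
  show "fraction R a s = fraction R b t"
    using sub[OF assms eq] sub[OF assms(2,1,4,3) eq[symmetric]] by blast
qed

lemma fraction_self: "a \<in> carrier R \<Longrightarrow> s \<in> NZ \<Longrightarrow> (a, s) \<in> fraction R a s"
  by (simp add: mem_fraction)

lemma TF_carrier: "carrier TF = {fraction R a s | a s. a \<in> carrier R \<and> s \<in> NZ}"
  by (simp add: total_fractions_def)

lemma TF_E:
  assumes "x \<in> carrier TF"
  obtains a s where "a \<in> carrier R" "s \<in> NZ" "x = fraction R a s"
  using assms unfolding TF_carrier by blast

lemma TF_I: "a \<in> carrier R \<Longrightarrow> s \<in> NZ \<Longrightarrow> fraction R a s \<in> carrier TF"
  unfolding TF_carrier by blast

lemma TF_mult:
  assumes "a \<in> carrier R" "b \<in> carrier R" "s \<in> NZ" "t \<in> NZ"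
  shows "fraction R a s \<otimes>\<^bsub>TF\<^esub> fraction R b t = fraction R (a \<otimes> b) (s \<otimes> t)"
proof -
  have "fraction R (c \<otimes> d) (u \<otimes> v) = fraction R (a \<otimes> b) (s \<otimes> t)"
    if "(c, u) \<in> fraction R a s" "(d, v) \<in> fraction R b t" for c d u v
  proof -
    have h: "c \<in> carrier R" "u \<in> NZ" "a \<otimes> u = c \<otimes> s" "d \<in> carrier R" "v \<in> NZ" "b \<otimes> v = d \<otimes> t"
      using that by (simp_all add: mem_fraction)
    have car: "s \<in> carrier R" "t \<in> carrier R" "u \<in> carrier R" "v \<in> carrier R"
      using h assms by (simp_all add: NZ_closed)
    have "(c \<otimes> d) \<otimes> (s \<otimes> t) = (c \<otimes> s) \<otimes> (d \<otimes> t)" using car h(1,4) by algebra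
    also have "\<dots> = (a \<otimes> u) \<otimes> (b \<otimes> v)" using h by simp
    also have "\<dots> = (a \<otimes> b) \<otimes> (u \<otimes> v)" using car assms(1,2) by algebra
    finally show ?thesis using h assms by (simp add: fraction_eq_iff NZ_mult)
  qed
  \<comment> \<open>All representatives give the same fraction, so the union in the definition is a
    nonempty union of copies of one set.\<close>
  then have "(\<Union>(c, u)\<in>fraction R a s. \<Union>(d, v)\<in>fraction R b t. fraction R (c \<otimes> d) (u \<otimes> v))
      = (\<Union>(c, u)\<in>fraction R a s. \<Union>(d, v)\<in>fraction R b t. fraction R (a \<otimes> b) (s \<otimes> t))"
    by (intro SUP_cong refl) (auto split: prod.splits)
  also have "\<dots> = fraction R (a \<otimes> b) (s \<otimes> t)"
    using fraction_self[OF assms(1,3)] fraction_self[OF assms(2,4)] by auto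
  finally show ?thesis by (simp add: total_fractions_def)
qed

lemma TF_add:
  assumes "a \<in> carrier R" "b \<in> carrier R" "s \<in> NZ" "t \<in> NZ"
  shows "fraction R a s \<oplus>\<^bsub>TF\<^esub> fraction R b t = fraction R (a \<otimes> t \<oplus> b \<otimes> s) (s \<otimes> t)"
proof -
  have "fraction R (c \<otimes> v \<oplus> d \<otimes> u) (u \<otimes> v) = fraction R (a \<otimes> t \<oplus> b \<otimes> s) (s \<otimes> t)"
    if "(c, u) \<in> fraction R a s" "(d, v) \<in> fraction R b t" for c d u v
  proof -
    have h: "c \<in> carrier R" "u \<in> NZ" "a \<otimes> u = c \<otimes> s" "d \<in> carrier R" "v \<in> NZ" "b \<otimes> v = d \<otimes> t"
      using that by (simp_all add: mem_fraction)
    have car: "s \<in> carrier R" "t \<in> carrier R" "u \<in> carrier R" "v \<in> carrier R"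
      using h assms by (simp_all add: NZ_closed)
    have "(c \<otimes> v \<oplus> d \<otimes> u) \<otimes> (s \<otimes> t) = (c \<otimes> s) \<otimes> (v \<otimes> t) \<oplus> (d \<otimes> t) \<otimes> (u \<otimes> s)"
      using car h(1,4) by algebra
    also have "\<dots> = (a \<otimes> u) \<otimes> (v \<otimes> t) \<oplus> (b \<otimes> v) \<otimes> (u \<otimes> s)" using h by simp
    also have "\<dots> = (a \<otimes> t \<oplus> b \<otimes> s) \<otimes> (u \<otimes> v)" using car assms(1,2) by algebra
    finally show ?thesis using h assms car by (simp add: fraction_eq_iff NZ_mult)
  qed
  then have "(\<Union>(c, u)\<in>fraction R a s. \<Union>(d, v)\<in>fraction R b t. fraction R (c \<otimes> v \<oplus> d \<otimes> u) (u \<otimes> v))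
      = (\<Union>(c, u)\<in>fraction R a s. \<Union>(d, v)\<in>fraction R b t. fraction R (a \<otimes> t \<oplus> b \<otimes> s) (s \<otimes> t))"
    by (intro SUP_cong refl) (auto split: prod.splits)
  also have "\<dots> = fraction R (a \<otimes> t \<oplus> b \<otimes> s) (s \<otimes> t)"
    using fraction_self[OF assms(1,3)] fraction_self[OF assms(2,4)] by auto
  finally show ?thesis by (simp add: total_fractions_def)
qed

lemma TF_one: "\<one>\<^bsub>TF\<^esub> = fraction R \<one> \<one>" and TF_zero: "\<zero>\<^bsub>TF\<^esub> = fraction R \<zero> \<one>"
  by (simp_all add: total_fractions_def)

lemma TF_cring: "cring TF"
proof (rule cringI)
  show "abelian_group TF"
  proof (rule abelian_groupI)
    fix x y assume x: "x \<in> carrier TF" and y: "y \<in> carrier TF"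
    obtain a s where a: "a \<in> carrier R" "s \<in> NZ" "x = fraction R a s" using x by (rule TF_E)
    obtain b t where b: "b \<in> carrier R" "t \<in> NZ" "y = fraction R b t" using y by (rule TF_E)
    have c: "s \<in> carrier R" "t \<in> carrier R" using a b by (simp_all add: NZ_closed)
    show "x \<oplus>\<^bsub>TF\<^esub> y \<in> carrier TF"
      using a b c by (simp add: TF_add TF_I NZ_mult)
    show "x \<oplus>\<^bsub>TF\<^esub> y = y \<oplus>\<^bsub>TF\<^esub> x"
      using a b c by (simp add: TF_add a_comm m_comm)
    fix z assume "z \<in> carrier TF"
    then obtain d u where d: "d \<in> carrier R" "u \<in> NZ" "z = fraction R d u" by (rule TF_E)
    have u: "u \<in> carrier R" using d by (simp add: NZ_closed)
    have "(a \<otimes> t \<oplus> b \<otimes> s) \<otimes> u \<oplus> d \<otimes> (s \<otimes> t) = a \<otimes> (t \<otimes> u) \<oplus> (b \<otimes> u \<oplus> d \<otimes> t) \<otimes> s"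
      using a(1) b(1) c d(1) u by algebra
    then show "x \<oplus>\<^bsub>TF\<^esub> y \<oplus>\<^bsub>TF\<^esub> z = x \<oplus>\<^bsub>TF\<^esub> (y \<oplus>\<^bsub>TF\<^esub> z)"
      using a b c d u by (simp add: TF_add NZ_mult m_assoc)
  next
    show "\<zero>\<^bsub>TF\<^esub> \<in> carrier TF" by (simp add: TF_zero TF_I NZ_one)
    fix x assume x: "x \<in> carrier TF"
    obtain a s where a: "a \<in> carrier R" "s \<in> NZ" "x = fraction R a s" using x by (rule TF_E)
    have s: "s \<in> carrier R" using a by (simp add: NZ_closed)
    show "\<zero>\<^bsub>TF\<^esub> \<oplus>\<^bsub>TF\<^esub> x = x"
      using a s by (simp add: TF_zero TF_add NZ_one)
    have "fraction R (\<ominus> a) s \<oplus>\<^bsub>TF\<^esub> x = \<zero>\<^bsub>TF\<^esub>"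
      using a s by (simp add: TF_zero TF_add NZ_one NZ_mult fraction_eq_iff l_minus l_neg)
    then show "\<exists>y\<in>carrier TF. y \<oplus>\<^bsub>TF\<^esub> x = \<zero>\<^bsub>TF\<^esub>"
      using a by (intro bexI[of _ "fraction R (\<ominus> a) s"] TF_I) auto
  qed
  show "Group.comm_monoid TF"
  proof (rule comm_monoidI)
    fix x y assume x: "x \<in> carrier TF" and y: "y \<in> carrier TF"
    obtain a s where a: "a \<in> carrier R" "s \<in> NZ" "x = fraction R a s" using x by (rule TF_E)
    obtain b t where b: "b \<in> carrier R" "t \<in> NZ" "y = fraction R b t" using y by (rule TF_E)
    have c: "s \<in> carrier R" "t \<in> carrier R" using a b by (simp_all add: NZ_closed)
    show "x \<otimes>\<^bsub>TF\<^esub> y \<in> carrier TF"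
      using a b c by (simp add: TF_mult TF_I NZ_mult)
    show "x \<otimes>\<^bsub>TF\<^esub> y = y \<otimes>\<^bsub>TF\<^esub> x"
      using a b c by (simp add: TF_mult m_comm)
    fix z assume "z \<in> carrier TF"
    then obtain d u where d: "d \<in> carrier R" "u \<in> NZ" "z = fraction R d u" by (rule TF_E)
    then show "x \<otimes>\<^bsub>TF\<^esub> y \<otimes>\<^bsub>TF\<^esub> z = x \<otimes>\<^bsub>TF\<^esub> (y \<otimes>\<^bsub>TF\<^esub> z)"
      using a b c by (simp add: TF_mult NZ_mult m_assoc NZ_closed)
  next
    show "\<one>\<^bsub>TF\<^esub> \<in> carrier TF" by (simp add: TF_one TF_I NZ_one)
    fix x assume x: "x \<in> carrier TF"
    then show "\<one>\<^bsub>TF\<^esub> \<otimes>\<^bsub>TF\<^esub> x = x"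
      by (elim TF_E) (simp add: TF_one TF_mult NZ_one NZ_closed)
  qed
  fix x y z assume x: "x \<in> carrier TF" and y: "y \<in> carrier TF" and z: "z \<in> carrier TF"
  obtain a s where a: "a \<in> carrier R" "s \<in> NZ" "x = fraction R a s" using x by (rule TF_E)
  obtain b t where b: "b \<in> carrier R" "t \<in> NZ" "y = fraction R b t" using y by (rule TF_E)
  obtain d u where d: "d \<in> carrier R" "u \<in> NZ" "z = fraction R d u" using z by (rule TF_E)
  have c: "s \<in> carrier R" "t \<in> carrier R" "u \<in> carrier R" using a b d by (simp_all add: NZ_closed)
  \<comment> \<open>The two sides of the distributive law get different denominators, so they are
    compared by cross multiplication.\<close>
  have "((a \<otimes> t \<oplus> b \<otimes> s) \<otimes> d) \<otimes> ((s \<otimes> u) \<otimes> (t \<otimes> u))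
      = ((a \<otimes> d) \<otimes> (t \<otimes> u) \<oplus> (b \<otimes> d) \<otimes> (s \<otimes> u)) \<otimes> ((s \<otimes> t) \<otimes> u)"
    using a(1) b(1) c d(1) by algebra
  then show "(x \<oplus>\<^bsub>TF\<^esub> y) \<otimes>\<^bsub>TF\<^esub> z = x \<otimes>\<^bsub>TF\<^esub> z \<oplus>\<^bsub>TF\<^esub> y \<otimes>\<^bsub>TF\<^esub> z"
    using a b c d by (simp add: TF_add TF_mult NZ_mult fraction_eq_iff)
qed

abbreviation "\<iota> \<equiv> fraction_embed R"

lemma embed_closed: "a \<in> carrier R \<Longrightarrow> \<iota> a \<in> carrier TF"
  by (simp add: fraction_embed_def TF_I NZ_one)

lemma embed_inject: "a \<in> carrier R \<Longrightarrow> b \<in> carrier R \<Longrightarrow> \<iota> a = \<iota> b \<longleftrightarrow> a = b"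
  by (simp add: fraction_embed_def fraction_eq_iff NZ_one)

lemma embed_one: "\<iota> \<one> = \<one>\<^bsub>TF\<^esub>" and embed_zero: "\<iota> \<zero> = \<zero>\<^bsub>TF\<^esub>"
  by (simp_all add: fraction_embed_def TF_one TF_zero)

lemma embed_mult: "a \<in> carrier R \<Longrightarrow> b \<in> carrier R \<Longrightarrow> \<iota> (a \<otimes> b) = \<iota> a \<otimes>\<^bsub>TF\<^esub> \<iota> b"
  by (simp add: fraction_embed_def TF_mult NZ_one)

lemma embed_add: "a \<in> carrier R \<Longrightarrow> b \<in> carrier R \<Longrightarrow> \<iota> (a \<oplus> b) = \<iota> a \<oplus>\<^bsub>TF\<^esub> \<iota> b"
  by (simp add: fraction_embed_def TF_add NZ_one)

lemma embed_minus: "a \<in> carrier R \<Longrightarrow> \<iota> (\<ominus> a) = \<ominus>\<^bsub>TF\<^esub> \<iota> a"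
proof -
  interpret Q: cring TF by (rule TF_cring)
  assume a: "a \<in> carrier R"
  then have "\<iota> (\<ominus> a) \<oplus>\<^bsub>TF\<^esub> \<iota> a = \<zero>\<^bsub>TF\<^esub>"
    by (simp add: embed_add[symmetric] embed_zero l_neg)
  then show ?thesis using a by (simp add: Q.minus_equality embed_closed)
qed

lemma embed_diff: "a \<in> carrier R \<Longrightarrow> b \<in> carrier R \<Longrightarrow> \<iota> (a \<ominus> b) = \<iota> a \<ominus>\<^bsub>TF\<^esub> \<iota> b"
  by (simp add: a_minus_def embed_add embed_minus)

lemma embed_Units_iff: "a \<in> carrier R \<Longrightarrow> \<iota> a \<in> Units TF \<longleftrightarrow> a \<in> NZ"
proof
  interpret Q: cring TF by (rule TF_cring)
  assume a: "a \<in> carrier R" and u: "\<iota> a \<in> Units TF"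
  show "a \<in> NZ"
  proof (rule NZ_I[OF a])
    fix x assume x: "x \<in> carrier R" and ax: "a \<otimes> x = \<zero>"
    have "\<iota> x = inv\<^bsub>TF\<^esub> \<iota> a \<otimes>\<^bsub>TF\<^esub> (\<iota> a \<otimes>\<^bsub>TF\<^esub> \<iota> x)"
      using Q.Units_cancel[OF u] x by (simp add: embed_closed)
    also have "\<iota> a \<otimes>\<^bsub>TF\<^esub> \<iota> x = \<zero>\<^bsub>TF\<^esub>" using a x ax embed_mult[of a x] by (simp add: embed_zero)
    finally have "\<iota> x = \<iota> \<zero>" using u by (simp add: embed_zero)
    then show "x = \<zero>" using x by (simp add: embed_inject)
  qed
next
  interpret Q: cring TF by (rule TF_cring)
  assume a: "a \<in> carrier R" and n: "a \<in> NZ"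
  have "\<iota> a \<otimes>\<^bsub>TF\<^esub> fraction R \<one> a = \<one>\<^bsub>TF\<^esub>"
    using a n by (simp add: fraction_embed_def TF_mult TF_one fraction_eq_iff NZ_one)
  then show "\<iota> a \<in> Units TF"
    using a n embed_closed TF_I[of \<one> a]
    by (metis Q.Units_of_dvd_Unit Q.Units_one_closed one_closed)
qed

lemma fraction_clear: "a \<in> carrier R \<Longrightarrow> s \<in> NZ \<Longrightarrow> \<iota> s \<otimes>\<^bsub>TF\<^esub> fraction R a s = \<iota> a"
  by (simp add: fraction_embed_def TF_mult NZ_closed NZ_one fraction_eq_iff m_comm)

section \<open>Ideals of the ring and submodules of its image\<close>

definition preimage :: "('a \<times> 'a) set set \<Rightarrow> 'a set" where
  "preimage M = {r \<in> carrier R. \<iota> r \<in> M}"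

lemma image_preimage: "M \<subseteq> \<iota> ` carrier R \<Longrightarrow> \<iota> ` preimage M = M"
  by (auto simp: preimage_def)

lemma subm_image:
  assumes "ideal I R" shows "cring.subm TF (\<iota> ` carrier R) (\<iota> ` I)"
proof -
  interpret Q: cring TF by (rule TF_cring)
  interpret I: ideal I R by fact
  show ?thesis
    unfolding Q.subm_def
  proof (intro conjI ballI)
    show "\<iota> ` I \<subseteq> carrier TF" using I.a_subset embed_closed by blast
    show "\<zero>\<^bsub>TF\<^esub> \<in> \<iota> ` I" using embed_zero I.zero_closed by (metis imageI)
    fix x y assume "x \<in> \<iota> ` I" "y \<in> \<iota> ` I"
    then obtain a b where ab: "a \<in> I" "b \<in> I" "x = \<iota> a" "y = \<iota> b" by blast
    then have "x \<oplus>\<^bsub>TF\<^esub> y = \<iota> (a \<oplus> b)" by (simp add: embed_add I.Icarr)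
    then show "x \<oplus>\<^bsub>TF\<^esub> y \<in> \<iota> ` I" using ab by simp
  next
    fix t x assume "t \<in> \<iota> ` carrier R" "x \<in> \<iota> ` I"
    then obtain a b where ab: "a \<in> carrier R" "b \<in> I" "t = \<iota> a" "x = \<iota> b" by blast
    then have "t \<otimes>\<^bsub>TF\<^esub> x = \<iota> (a \<otimes> b)" by (simp add: embed_mult I.Icarr)
    then show "t \<otimes>\<^bsub>TF\<^esub> x \<in> \<iota> ` I" using ab I.I_l_closed by simp
  qed
qed

lemma ideal_preimage:
  assumes M: "cring.subm TF (\<iota> ` carrier R) M" shows "ideal (preimage M) R"
proof -
  interpret Q: cring TF by (rule TF_cring)
  have neg: "\<ominus> x \<in> preimage M" if "x \<in> preimage M" for x
  proof -
    have x: "x \<in> carrier R" "\<iota> x \<in> M" using that by (auto simp: preimage_def)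
    have "\<iota> (\<ominus> \<one>) \<otimes>\<^bsub>TF\<^esub> \<iota> x \<in> M" using Q.subm_smult[OF M _ x(2)] by simp
    then have "\<iota> (\<ominus> x) \<in> M" using x embed_mult[of "\<ominus> \<one>" x] by (simp add: l_minus)
    then show ?thesis using x by (simp add: preimage_def)
  qed
  show ?thesis
  proof (rule idealI)
    show "subgroup (preimage M) (add_monoid R)"
    proof (rule add.subgroupI)
      show "preimage M \<subseteq> carrier R" by (auto simp: preimage_def)
      have "\<zero> \<in> preimage M" using Q.subm_zero[OF M] by (simp add: preimage_def embed_zero)
      then show "preimage M \<noteq> {}" by blast
      fix x assume "x \<in> preimage M"
      then show "\<ominus> x \<in> preimage M" by (rule neg)
      fix y assume "y \<in> preimage M"
      then show "x \<oplus> y \<in> preimage M" using \<open>x \<in> preimage M\<close> Q.subm_add[OF M]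
        by (simp add: preimage_def embed_add)
    qed
    fix a x assume "a \<in> preimage M" "x \<in> carrier R"
    then have "\<iota> x \<otimes>\<^bsub>TF\<^esub> \<iota> a \<in> M" "a \<in> carrier R" "x \<in> carrier R"
      using Q.subm_smult[OF M] by (auto simp: preimage_def)
    then show "x \<otimes> a \<in> preimage M" "a \<otimes> x \<in> preimage M"
      by (simp_all add: preimage_def embed_mult m_comm[of a x])
  qed (rule ring_axioms)
qed

end

section \<open>One-dimensional Cohen-Macaulay local rings\<close>

text \<open>Zorn's lemma applies because a nonempty chain of ideals in a Noetherian ring contains
  its union.\<close>

lemma (in noetherian_ring) exists_maximal_ideal_in:
  assumes "F \<noteq> {}" "\<And>I. I \<in> F \<Longrightarrow> ideal I R"
  obtains I where "I \<in> F" "\<And>J. J \<in> F \<Longrightarrow> I \<subseteq> J \<Longrightarrow> J = I"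
proof -
  have "\<exists>M\<in>F. \<forall>N\<in>F. M \<subseteq> N \<longrightarrow> N = M"
  proof (rule subset_Zorn_nonempty[OF assms(1)])
    fix \<C> assume C: "\<C> \<noteq> {}" "subset.chain F \<C>"
    have "subset.chain {I. ideal I R} \<C>"
      using C(2) assms(2) unfolding subset.chain_def by blast
    then have "\<Union>\<C> \<in> \<C>" using ideal_chain_is_trivial C(1) by blast
    then show "\<Union>\<C> \<in> F" using C(2) unfolding subset.chain_def by blast
  qed
  then show ?thesis using that by blast
qed

context local_fractions
begin

lemma integral_over_iff_S:
  assumes x: "x \<in> carrier Q" shows "integral_over Q A x \<longleftrightarrow> x \<in> S"
proof
  assume "integral_over Q A x"
  then obtain p where p: "p \<in> carrier (univ_poly Q A)" "p \<noteq> []" "lead_coeff p = \<one>" "eval p x = \<zero>"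
    unfolding integral_over_def by blast
  obtain r where r: "p = \<one> # r" using p(2,3) by (cases p) auto
  have "set r \<subseteq> A" using p(1) r by (auto simp: univ_poly_def polynomial_def)
  then show "x \<in> S" using monic_root_imp_S x p(4) r by blast
next
  assume "x \<in> S"
  then obtain r where r: "set r \<subseteq> A" "eval (\<one> # r) x = \<zero>" using S_imp_monic_root by blast
  \<comment> \<open>Polynomials are lists with nonzero head, so a monic list counts as a polynomial
    only in a nontrivial ring.\<close>
  have "\<one> \<noteq> \<zero>" using m_ideal subm_zero by metis
  then have "\<one> # r \<in> carrier (univ_poly Q A)"
    using r A_one by (auto simp: univ_poly_def polynomial_def)
  then show "integral_over Q A x"
    unfolding integral_over_def using r(2) by (intro bexI[of _ "\<one> # r"]) auto
qed

end

lemma FactRing_zero: "\<zero>\<^bsub>R Quot I\<^esub> = I"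
  by (simp add: FactRing_def)

locale cm_local_dim1 = cring R for R (structure) +
  assumes cm: "cohen_macaulay_local_ring R"
    and dim_one: "krull_dim R = 1"
    and residue_infinite: "infinite (carrier (residue_field R))"
begin

abbreviation "\<mm> \<equiv> max_ideal R"

sublocale noetherian_ring R
  using cm by (simp add: cohen_macaulay_local_ring_def)

lemma max_ideal: "maximalideal \<mm> R"
  and max_ideal_unique: "maximalideal J R \<Longrightarrow> J = \<mm>"
proof -
  have ex: "\<exists>!m. maximalideal m R"
    using cm by (simp add: cohen_macaulay_local_ring_def local_ring_def)
  show "maximalideal \<mm> R" unfolding max_ideal_def by (rule theI'[OF ex])
  then show "maximalideal J R \<Longrightarrow> J = \<mm>" using ex by blast
qed

lemma mx_ideal: "ideal \<mm> R"
  using max_ideal by (rule maximalideal.axioms)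

lemma mx_subset: "\<mm> \<subseteq> carrier R"
  using mx_ideal by (simp add: ideal.Icarr subsetI)

lemma one_notin_mx: "\<one> \<notin> \<mm>"
  using max_ideal ideal.one_imp_carrier[OF mx_ideal] maximalideal.I_notcarr[OF max_ideal] by metis

lemma proper_ideal_subset_mx:
  assumes "ideal I R" "\<one> \<notin> I" shows "I \<subseteq> \<mm>"
proof -
  define F where "F = {J. ideal J R \<and> I \<subseteq> J \<and> \<one> \<notin> J}"
  obtain J where J: "J \<in> F" "\<And>K. K \<in> F \<Longrightarrow> J \<subseteq> K \<Longrightarrow> K = J"
    using exists_maximal_ideal_in[of F] assms unfolding F_def by blast
  have "maximalideal J R"
  proof (rule maximalidealI)
    show "ideal J R" "carrier R \<noteq> J" using J(1) by (auto simp: F_def)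
    fix K assume K: "ideal K R" "J \<subseteq> K"
    show "K = J \<or> K = carrier R"
    proof (cases "\<one> \<in> K")
      case True
      then show ?thesis using ideal.one_imp_carrier[OF K(1)] by blast
    next
      case False
      then have "K \<in> F" using K J(1) by (auto simp: F_def)
      then show ?thesis using J(2) K(2) by blast
    qed
  qed
  then show ?thesis using max_ideal_unique J(1) by (auto simp: F_def)
qed

lemma unit_of_notin_mx:
  assumes a: "a \<in> carrier R" "a \<notin> \<mm>" obtains b where "b \<in> carrier R" "a \<otimes> b = \<one>"
proof -
  have "\<one> \<in> PIdl a"
    using proper_ideal_subset_mx[OF cgenideal_ideal[OF a(1)]] cgenideal_self[OF a(1)] a(2) by blast
  then show ?thesis using that a(1) by (auto simp: cgenideal_def m_comm)
qed

text \<open>A prime avoiding \<^term>\<open>s\<close> below a nonmaximal prime \<^term>\<open>P\<close> containing \<^term>\<open>s\<close> would give a chain of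
  length two; it is found as an ideal maximal among those not meeting \<open>{s\<^sup>n t | t \<notin> P}\<close>.\<close>

lemma regular_prime_maximal:
  assumes P: "primeideal P R" and s: "s \<in> P" "s \<in> NZ" shows "P = \<mm>"
proof (rule ccontr)
  assume ne: "P \<noteq> \<mm>"
  interpret P: primeideal P R by fact
  have onP: "\<one> \<notin> P" using P.one_imp_carrier P.I_notcarr by metis
  have Pm: "P \<subseteq> \<mm>" using proper_ideal_subset_mx[OF P.ideal_axioms onP] .
  have sc: "s \<in> carrier R" using s by (simp add: NZ_closed)
  have sn: "s [^] n \<in> NZ" for n :: nat
    by (induction n) (simp_all add: NZ_one NZ_mult s)
  define F where "F = {I. ideal I R \<and> (\<forall>(n::nat) t. t \<in> carrier R \<longrightarrow> t \<notin> P \<longrightarrow> s [^] n \<otimes> t \<notin> I)}"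
  have "s [^] n \<otimes> t \<notin> {\<zero>}" if "t \<in> carrier R" "t \<notin> P" for n :: nat and t
  proof
    assume "s [^] n \<otimes> t \<in> {\<zero>}"
    then have "t = \<zero>" using NZ_D[OF sn that(1)] by blast
    then show False using that(2) P.zero_closed by simp
  qed
  then have "{\<zero>} \<in> F" using zeroideal by (simp add: F_def)
  then obtain I where I: "I \<in> F" "\<And>K. K \<in> F \<Longrightarrow> I \<subseteq> K \<Longrightarrow> K = I"
    using exists_maximal_ideal_in[of F] unfolding F_def by blast
  interpret I: ideal I R using I(1) by (simp add: F_def)
  have avoid: "s [^] (n::nat) \<otimes> t \<notin> I" if "t \<in> carrier R" "t \<notin> P" for n t
    using I(1) that unfolding F_def by blast
  \<comment> \<open>The avoided set is closed under multiplication because \<open>P\<close> is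
    prime, so a maximal ideal avoiding it is prime. Maximality is used in the form that
    \<open>I + aR\<close> meets the set.\<close>
  have meets: "\<exists>(n::nat) t p r. t \<in> carrier R \<and> t \<notin> P \<and> p \<in> I \<and> r \<in> carrier R \<and> s [^] n \<otimes> t = p \<oplus> r \<otimes> a"
    if a: "a \<in> carrier R" "a \<notin> I" for a
  proof -
    let ?K = "set_add R I (PIdl a)"
    have K: "ideal ?K R" using add_ideals[OF I.ideal_axioms cgenideal_ideal[OF a(1)]] .
    have mem: "z \<in> ?K \<longleftrightarrow> (\<exists>p\<in>I. \<exists>r\<in>carrier R. z = p \<oplus> r \<otimes> a)" for z
      by (auto simp: set_add_def' cgenideal_def)
    have "I \<subseteq> ?K"
    proof
      fix p assume p: "p \<in> I"
      then have "p = p \<oplus> \<zero> \<otimes> a" using a(1) I.Icarr by simp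
      then show "p \<in> ?K" unfolding mem using p by blast
    qed
    moreover have "a = \<zero> \<oplus> \<one> \<otimes> a" using a(1) by simp
    then have "a \<in> ?K" unfolding mem using I.zero_closed by blast
    ultimately have "?K \<notin> F" using I(2) a(2) by blast
    then obtain n t where "t \<in> carrier R" "t \<notin> P" "s [^] (n::nat) \<otimes> t \<in> ?K"
      using K unfolding F_def by blast
    then show ?thesis unfolding mem by blast
  qed
  have "primeideal I R"
  proof (rule primeidealI)
    show "ideal I R" by (rule I.ideal_axioms)
    show "cring R" by (rule cring_axioms)
    have "\<one> \<notin> I" using avoid[of \<one> 0] onP by simp
    then show "carrier R \<noteq> I" by blast
    fix a b assume ab: "a \<in> carrier R" "b \<in> carrier R" "a \<otimes> b \<in> I"
    show "a \<in> I \<or> b \<in> I"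
    proof (rule ccontr)
      assume "\<not> (a \<in> I \<or> b \<in> I)"
      then have n: "a \<notin> I" "b \<notin> I" by auto
      obtain n t p r where 1: "t \<in> carrier R" "t \<notin> P" "p \<in> I" "r \<in> carrier R"
        "s [^] (n::nat) \<otimes> t = p \<oplus> r \<otimes> a" using meets[OF ab(1) n(1)] by blast
      obtain k u q w where 2: "u \<in> carrier R" "u \<notin> P" "q \<in> I" "w \<in> carrier R"
        "s [^] (k::nat) \<otimes> u = q \<oplus> w \<otimes> b" using meets[OF ab(2) n(2)] by blast
      have c: "p \<in> carrier R" "q \<in> carrier R" using 1 2 I.Icarr by auto
      have "s [^] (n + k) \<otimes> (t \<otimes> u) = (s [^] n \<otimes> t) \<otimes> (s [^] k \<otimes> u)"
        using sc 1(1) 2(1) by (simp add: nat_pow_mult[symmetric] m_ac)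
      also have "\<dots> = (p \<oplus> r \<otimes> a) \<otimes> (q \<oplus> w \<otimes> b)" using 1 2 by simp
      also have "\<dots> = (q \<oplus> w \<otimes> b) \<otimes> p \<oplus> ((r \<otimes> a) \<otimes> q \<oplus> (r \<otimes> w) \<otimes> (a \<otimes> b))"
        using c ab(1,2) 1(4) 2(4) by algebra
      also have "\<dots> \<in> I"
        using c ab(1,2) 1 2 by (intro I.a_closed I.I_l_closed[OF ab(3)] I.I_l_closed[OF 1(3)] I.I_l_closed[OF 2(3)]) auto
      finally have "s [^] (n + k) \<otimes> (t \<otimes> u) \<in> I" .
      moreover have "t \<otimes> u \<notin> P" using P.I_prime 1 2 by blast
      ultimately show False using avoid 1 2 by blast
    qed
  qed
  moreover have "I \<subset> P"
  proof -
    have "I \<subseteq> P"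
    proof
      fix t assume t: "t \<in> I"
      then have tc: "t \<in> carrier R" using I.Icarr by blast
      show "t \<in> P" using avoid[OF tc, of 0] t tc by (cases "t \<in> P") auto
    qed
    moreover have "s \<notin> I" using avoid[of \<one> 1] onP sc by simp
    ultimately show ?thesis using s by blast
  qed
  moreover have "P \<subset> \<mm>" using Pm ne by blast
  moreover have "primeideal \<mm> R" using maximalideal_prime[OF max_ideal] .
  ultimately have "\<exists>Q :: nat \<Rightarrow> 'a set. (\<forall>i\<le>2. primeideal (Q i) R) \<and> (\<forall>i<2. Q i \<subset> Q (Suc i))"
    using P by (intro exI[of _ "\<lambda>i. if i = 0 then I else if i = 1 then P else \<mm>"])
      (auto simp: less_2_cases_iff)
  then have "enat 2 \<le> krull_dim R"
    unfolding krull_dim_def by (intro Sup_upper) blast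
  then show False using dim_one by (simp add: one_enat_def)
qed

text \<open>Depth one supplies a nonempty regular sequence in the maximal ideal. Its first member is
  regular modulo the ideal generated by the empty set, which is zero.\<close>

lemma mx_regular: obtains x where "x \<in> \<mm>" "x \<in> NZ"
proof -
  have "ring_depth R = 1" using cm dim_one by (simp add: cohen_macaulay_local_ring_def)
  have "\<exists>xs. regular_sequence R xs \<and> set xs \<subseteq> \<mm> \<and> xs \<noteq> []"
  proof (rule ccontr)
    assume n: "\<not> ?thesis"
    have "ring_depth R \<le> 0"
      unfolding ring_depth_def
    proof (rule Sup_least)
      fix e assume "e \<in> {enat (length xs) | xs. regular_sequence R xs \<and> set xs \<subseteq> \<mm>}"
      then show "e \<le> 0" using n by (auto simp: zero_enat_def)
    qed
    then show False using \<open>ring_depth R = 1\<close> by simp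
  qed
  then obtain xs where xs: "regular_sequence R xs" "set xs \<subseteq> \<mm>" "xs \<noteq> []" by blast
  define x where "x = xs ! 0"
  have xm: "x \<in> \<mm>" using xs by (simp add: x_def subset_iff)
  have xc: "x \<in> carrier R" using xm mx_subset by blast
  have "Idl (set (take 0 xs)) +> (xs ! 0) \<in> nonzerodivisors (R Quot Idl (set (take 0 xs)))"
    using xs(1,3) unfolding regular_sequence_def by blast
  moreover have "Idl {} = {\<zero>}"
    using genideal_minimal[OF zeroideal, of "{}"] additive_subgroup.zero_closed[of "Idl {}" R]
      ideal.axioms(1)[OF genideal_ideal[of "{}"]] by blast
  ultimately have nz: "{\<zero>} +> x \<in> nonzerodivisors (R Quot {\<zero>})" by (simp add: x_def)
  interpret Z: ideal "{\<zero>}" R by (rule zeroideal)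
  interpret h: ring_hom_ring R "R Quot {\<zero>}" "(+>) {\<zero>}" by (rule Z.rcos_ring_hom_ring)
  have "x \<in> NZ"
  proof (rule NZ_I[OF xc])
    fix y assume y: "y \<in> carrier R" "x \<otimes> y = \<zero>"
    have "({\<zero>} +> x) \<otimes>\<^bsub>R Quot {\<zero>}\<^esub> ({\<zero>} +> y) = \<zero>\<^bsub>R Quot {\<zero>}\<^esub>"
      using h.hom_mult[OF xc y(1)] y(2) h.hom_zero by simp
    then have "{\<zero>} +> y = \<zero>\<^bsub>R Quot {\<zero>}\<^esub>"
      using nz h.hom_closed[OF y(1)] unfolding nonzerodivisors_def by blast
    moreover have "\<zero>\<^bsub>R Quot {\<zero>}\<^esub> = {\<zero>}" by (rule FactRing_zero)
    ultimately have "{\<zero>} +> y = {\<zero>}" by (rule trans)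
    then show "y = \<zero>" using Z.a_rcos_self[OF y(1)] by blast
  qed
  then show ?thesis using that xm by blast
qed

lemma residue_representatives:
  obtains U where "infinite U" "U \<subseteq> carrier R" "\<And>u v. u \<in> U \<Longrightarrow> v \<in> U \<Longrightarrow> u \<noteq> v \<Longrightarrow> u \<ominus> v \<notin> \<mm>"
proof -
  let ?f = "\<lambda>u. \<mm> +> u"
  have car: "carrier (residue_field R) = ?f ` carrier R"
    by (auto simp: residue_field_def FactRing_def A_RCOSETS_def')
  obtain U where U: "U \<subseteq> carrier R" "inj_on ?f U" "?f ` U = ?f ` carrier R"
    using subset_image_inj[of "?f ` carrier R" ?f "carrier R"] by auto
  show ?thesis
  proof
    show "infinite U" using residue_infinite U(3) car by (metis finite_imageI)
    show "U \<subseteq> carrier R" by (fact U)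
    fix u v assume uv: "u \<in> U" "v \<in> U" "u \<noteq> v"
    then show "u \<ominus> v \<notin> \<mm>"
      using U quotient_eq_iff_same_a_r_cos[OF mx_ideal, of u v] by (auto simp: inj_on_def)
  qed
qed

section \<open>The ring inside its fractions, its normalization and conductor\<close>

sublocale Q: local_fractions TF "\<iota> ` carrier R" "\<iota> ` \<mm>"
proof (intro local_fractions.intro local_fractions_axioms.intro TF_cring)
  interpret Q: cring TF by (rule TF_cring)
  let ?A = "\<iota> ` carrier R"
  show "?A \<subseteq> carrier TF" using embed_closed by blast
  show "\<one>\<^bsub>TF\<^esub> \<in> ?A" using embed_one by (metis imageI one_closed)
  show "\<ominus>\<^bsub>TF\<^esub> \<one>\<^bsub>TF\<^esub> \<in> ?A" using embed_minus[of \<one>] embed_one by (metis a_inv_closed imageI one_closed)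
  show "Q.subm ?A ?A" by (rule subm_image[OF oneideal])
  show "Q.subm ?A (\<iota> ` \<mm>)" by (rule subm_image[OF mx_ideal])
  show "\<iota> ` \<mm> \<subseteq> ?A" using mx_subset by blast
  show "\<one>\<^bsub>TF\<^esub> \<notin> \<iota> ` \<mm>"
    using one_notin_mx embed_inject mx_subset by (auto simp: embed_one[symmetric] subset_iff)
  show "\<exists>b\<in>?A. a \<otimes>\<^bsub>TF\<^esub> b = \<one>\<^bsub>TF\<^esub>" if a: "a \<in> ?A" "a \<notin> \<iota> ` \<mm>" for a
  proof -
    obtain r where r: "r \<in> carrier R" "a = \<iota> r" "r \<notin> \<mm>" using a by blast
    obtain b where b: "b \<in> carrier R" "r \<otimes> b = \<one>" using unit_of_notin_mx r by blast
    have "\<iota> r \<otimes>\<^bsub>TF\<^esub> \<iota> b = \<one>\<^bsub>TF\<^esub>" using embed_mult[OF r(1) b(1)] b(2) embed_one by simp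
    then show ?thesis using r b by blast
  qed
  show "\<exists>s\<in>?A \<inter> Units TF. s \<otimes>\<^bsub>TF\<^esub> q \<in> ?A" if q: "q \<in> carrier TF" for q
  proof -
    obtain a s where a: "a \<in> carrier R" "s \<in> NZ" "q = fraction R a s" using q by (rule TF_E)
    have "\<iota> s \<otimes>\<^bsub>TF\<^esub> q = \<iota> a" using fraction_clear a by simp
    moreover have "\<iota> s \<in> Units TF" "s \<in> carrier R" using a embed_Units_iff NZ_closed by auto
    ultimately show ?thesis using a by (intro bexI[of _ "\<iota> s"]) auto
  qed
  show "\<exists>M\<in>F. \<forall>Y\<in>F. M \<subseteq> Y \<longrightarrow> Y = M"
    if F: "F \<noteq> {}" "\<And>M. M \<in> F \<Longrightarrow> Q.subm ?A M \<and> M \<subseteq> ?A" for F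
  proof -
    have ne: "preimage ` F \<noteq> {}" using F(1) by blast
    have ids: "ideal I R" if "I \<in> preimage ` F" for I using F(2) ideal_preimage that by blast
    obtain I where I: "I \<in> preimage ` F" "\<And>J. J \<in> preimage ` F \<Longrightarrow> I \<subseteq> J \<Longrightarrow> J = I"
      by (rule exists_maximal_ideal_in[OF ne ids]) (assumption, rule that, assumption, blast)
    obtain M where M: "M \<in> F" "I = preimage M" using I(1) by blast
    have "Y = M" if "Y \<in> F" "M \<subseteq> Y" for Y
    proof -
      have "preimage M \<subseteq> preimage Y" using that by (auto simp: preimage_def)
      then have "preimage Y = preimage M" using I(2) M that by blast
      then show ?thesis using image_preimage F(2) M(1) that(1) by metis
    qed
    then show ?thesis using M(1) by blast
  qed
  show "P = \<iota> ` \<mm>"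
    if P: "Q.subm ?A P" "P \<subseteq> ?A" "\<one>\<^bsub>TF\<^esub> \<notin> P"
      "\<And>a b. a \<in> ?A \<Longrightarrow> b \<in> ?A \<Longrightarrow> a \<otimes>\<^bsub>TF\<^esub> b \<in> P \<Longrightarrow> a \<in> P \<or> b \<in> P" "P \<inter> Units TF \<noteq> {}" for P
  proof -
    obtain s where s: "s \<in> carrier R" "\<iota> s \<in> P" "\<iota> s \<in> Units TF" using P(2,5) by blast
    have "primeideal (preimage P) R"
    proof (rule primeidealI)
      show "ideal (preimage P) R" by (rule ideal_preimage[OF P(1)])
      show "cring R" by (rule cring_axioms)
      have "\<one> \<notin> preimage P" using P(3) by (simp add: preimage_def embed_one)
      then show "carrier R \<noteq> preimage P" by blast
      fix a b assume "a \<in> carrier R" "b \<in> carrier R" "a \<otimes> b \<in> preimage P"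
      then show "a \<in> preimage P \<or> b \<in> preimage P"
        using P(4)[of "\<iota> a" "\<iota> b"] by (auto simp: preimage_def embed_mult)
    qed
    then have "preimage P = \<mm>"
      using regular_prime_maximal s embed_Units_iff by (simp add: preimage_def)
    then show ?thesis using image_preimage[OF P(2)] by simp
  qed
  obtain x where x: "x \<in> \<mm>" "x \<in> NZ" by (rule mx_regular)
  then have "\<iota> x \<in> Units TF" using embed_Units_iff NZ_closed by blast
  then show "\<iota> ` \<mm> \<inter> Units TF \<noteq> {}" using x by blast
  obtain U where U: "infinite U" "U \<subseteq> carrier R" "\<And>u v. u \<in> U \<Longrightarrow> v \<in> U \<Longrightarrow> u \<noteq> v \<Longrightarrow> u \<ominus> v \<notin> \<mm>"
    using residue_representatives by blast
  have inj: "inj_on \<iota> (carrier R)" using embed_inject by (auto simp: inj_on_def)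
  have "infinite (\<iota> ` U)" using U(1) finite_image_iff[OF inj_on_subset[OF inj U(2)]] by blast
  moreover have "u' \<ominus>\<^bsub>TF\<^esub> v' \<notin> \<iota> ` \<mm>" if u'v': "u' \<in> \<iota> ` U" "v' \<in> \<iota> ` U" "u' \<noteq> v'" for u' v'
  proof -
    obtain u v where uv: "u \<in> U" "v \<in> U" "u' = \<iota> u" "v' = \<iota> v" "u \<noteq> v" using u'v' by blast
    have c: "u \<in> carrier R" "v \<in> carrier R" using uv U(2) by auto
    then have "u' \<ominus>\<^bsub>TF\<^esub> v' = \<iota> (u \<ominus> v)" using uv by (simp add: embed_diff)
    then show ?thesis
      using U(3)[OF uv(1,2,5)] mx_subset embed_inject c by (auto simp: subset_iff)
  qed
  ultimately show "\<exists>U. infinite U \<and> U \<subseteq> ?A \<and> (\<forall>u\<in>U. \<forall>v\<in>U. u \<noteq> v \<longrightarrow> u \<ominus>\<^bsub>TF\<^esub> v \<notin> \<iota> ` \<mm>)"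
    using U(2) by (intro exI[of _ "\<iota> ` U"]) blast
qed

lemma integral_closure_eq: "integral_closure R = Q.S"
  unfolding integral_closure_def using Q.integral_over_iff_S Q.S_closed by blast

lemma conductor_eq: "conductor R = Q.C"
  unfolding conductor_def Q.C_def integral_closure_eq ..

lemma conductor_ideal_eq: "\<iota> ` conductor_ideal R = Q.C"
proof -
  have "conductor_ideal R = preimage Q.C"
    by (simp add: conductor_ideal_def conductor_eq preimage_def)
  then show ?thesis using image_preimage Q.C_subset_A by simp
qed

lemma conductor_ideal: "ideal (conductor_ideal R) R"
proof -
  have "conductor_ideal R = preimage Q.C"
    by (simp add: conductor_ideal_def conductor_eq preimage_def)
  then show ?thesis using ideal_preimage Q.C_submA by simp
qed

end

section \<open>Quotient modules and finite type\<close>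

context cring
begin

section \<open>Lengths of quotients through chains of ideals\<close>

definition ideal_chain :: "'a set \<Rightarrow> nat \<Rightarrow> bool" where
  "ideal_chain I n \<longleftrightarrow> (\<exists>J :: nat \<Rightarrow> 'a set.
     (\<forall>i\<le>n. ideal (J i) R \<and> I \<subseteq> J i) \<and> (\<forall>i<n. J i \<subset> J (Suc i)))"

lemma ring_module_simps:
  "carrier (ring_module R) = carrier R" "ring.add (ring_module R) = ring.add R"
  "smult (ring_module R) = monoid.mult R" "ring.zero (ring_module R) = ring.zero R"
  by (simp_all add: ring_module_def)

lemma ring_module_a_r_coset: "I +>\<^bsub>ring_module R\<^esub> x = I +> x"
  unfolding a_r_coset_def' ring_module_simps ..

text \<open>The additive structure is that of the factor ring, so the canonical ring homomorphism
  can be used for submodules of the quotient module.\<close>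

lemma quotient_module_simps:
  "carrier (quotient_module R (ring_module R) I) = carrier (R Quot I)"
  "ring.add (quotient_module R (ring_module R) I) = ring.add (R Quot I)"
  "ring.zero (quotient_module R (ring_module R) I) = ring.zero (R Quot I)"
  "smult (quotient_module R (ring_module R) I) = (\<lambda>a U. \<Union>x\<in>U. I +> (a \<otimes> x))"
  unfolding quotient_module_def FactRing_def A_RCOSETS_def' ring_module_a_r_coset set_add_def'[abs_def]
    ring_module_simps by simp_all

lemma quotient_submodule_iff:
  "submodule H R (quotient_module R (ring_module R) I) \<longleftrightarrow>
    subgroup H (add_monoid (R Quot I)) \<and> (\<forall>a\<in>carrier R. \<forall>U\<in>H. (\<Union>x\<in>U. I +> (a \<otimes> x)) \<in> H)"
proof -
  have "subgroup H (add_monoid (quotient_module R (ring_module R) I)) \<longleftrightarrow> subgroup H (add_monoid (R Quot I))"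
    unfolding subgroup_def m_inv_def by (simp add: quotient_module_simps)
  then show ?thesis
    unfolding submodule_def submodule_axioms_def by (auto simp: quotient_module_simps)
qed

lemma smult_coset:
  assumes I: "ideal I R" and ay: "a \<in> carrier R" "y \<in> carrier R"
  shows "(\<Union>x\<in>I +> y. I +> (a \<otimes> x)) = I +> (a \<otimes> y)"
proof -
  interpret I: ideal I R by fact
  have "I +> (a \<otimes> x) = I +> (a \<otimes> y)" if x: "x \<in> I +> y" for x
  proof -
    obtain h where h: "h \<in> I" "x = h \<oplus> y" using x unfolding a_r_coset_def' by blast
    have hc: "h \<in> carrier R" using h I.Icarr by blast
    have "a \<otimes> x \<ominus> a \<otimes> y = a \<otimes> h" unfolding h(2) using hc ay by algebra
    then have "a \<otimes> x \<ominus> a \<otimes> y \<in> I" using I.I_l_closed h ay by simp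
    then show ?thesis
      using quotient_eq_iff_same_a_r_cos[OF I, of "a \<otimes> x" "a \<otimes> y"] hc h ay by simp
  qed
  then show ?thesis using I.a_rcos_self[OF ay(2)] by blast
qed

lemma coset_mem_iff:
  assumes I: "ideal I R" and J: "ideal J R" "I \<subseteq> J" and x: "x \<in> carrier R"
  shows "I +> x \<in> (\<lambda>x. I +> x) ` J \<longleftrightarrow> x \<in> J"
proof
  interpret J: ideal J R by fact
  assume "I +> x \<in> (\<lambda>x. I +> x) ` J"
  then obtain y where y: "y \<in> J" "I +> x = I +> y" by blast
  have yc: "y \<in> carrier R" using y J.Icarr by blast
  have "x \<ominus> y \<in> J" using quotient_eq_iff_same_a_r_cos[OF I x yc] y J(2) by blast
  then have "(x \<ominus> y) \<oplus> y \<in> J" using J.a_closed y by blast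
  moreover have "(x \<ominus> y) \<oplus> y = x" using x yc by algebra
  ultimately show "x \<in> J" by simp
qed auto

lemma submodule_of_ideal:
  assumes I: "ideal I R" and J: "ideal J R" "I \<subseteq> J"
  shows "submodule ((\<lambda>x. I +> x) ` J) R (quotient_module R (ring_module R) I)"
  unfolding quotient_submodule_iff
proof (intro conjI ballI)
  interpret I: ideal I R by fact
  interpret J: ideal J R by fact
  interpret h: ring_hom_ring R "R Quot I" "(+>) I" by (rule I.rcos_ring_hom_ring)
  show "subgroup ((\<lambda>x. I +> x) ` J) (add_monoid (R Quot I))"
  proof (rule h.S.add.subgroupI)
    show "(\<lambda>x. I +> x) ` J \<subseteq> carrier (R Quot I)" using h.hom_closed J.Icarr by blast
    show "(\<lambda>x. I +> x) ` J \<noteq> {}" using J.zero_closed by blast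
  next
    fix U assume "U \<in> (\<lambda>x. I +> x) ` J"
    then obtain x where x: "x \<in> J" "U = I +> x" by blast
    then have "\<ominus>\<^bsub>R Quot I\<^esub> U = I +> (\<ominus> x)" using J.Icarr h.hom_a_inv by simp
    then show "\<ominus>\<^bsub>R Quot I\<^esub> U \<in> (\<lambda>x. I +> x) ` J" using x J.a_inv_closed by blast
    fix V assume "V \<in> (\<lambda>x. I +> x) ` J"
    then obtain y where y: "y \<in> J" "V = I +> y" by blast
    have "U \<oplus>\<^bsub>R Quot I\<^esub> V = I +> (x \<oplus> y)" using x y J.Icarr h.hom_add by simp
    then show "U \<oplus>\<^bsub>R Quot I\<^esub> V \<in> (\<lambda>x. I +> x) ` J" using x y J.a_closed by blast
  qed
  fix a U assume a: "a \<in> carrier R" and "U \<in> (\<lambda>x. I +> x) ` J"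
  then obtain x where x: "x \<in> J" "U = I +> x" by blast
  then show "(\<Union>x\<in>U. I +> (a \<otimes> x)) \<in> (\<lambda>x. I +> x) ` J"
    using smult_coset[OF I a] J.Icarr J.I_l_closed[OF x(1) a] by simp
qed

lemma ideal_of_submodule:
  assumes I: "ideal I R" and H: "submodule H R (quotient_module R (ring_module R) I)"
  shows "ideal {x \<in> carrier R. I +> x \<in> H} R" "I \<subseteq> {x \<in> carrier R. I +> x \<in> H}"
    "H = (\<lambda>x. I +> x) ` {x \<in> carrier R. I +> x \<in> H}"
proof -
  interpret I: ideal I R by fact
  interpret h: ring_hom_ring R "R Quot I" "(+>) I" by (rule I.rcos_ring_hom_ring)
  have Hs: "subgroup H (add_monoid (R Quot I))"
    and smult: "\<And>a U. a \<in> carrier R \<Longrightarrow> U \<in> H \<Longrightarrow> (\<Union>x\<in>U. I +> (a \<otimes> x)) \<in> H"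
    using H unfolding quotient_submodule_iff by auto
  interpret Hs: subgroup H "add_monoid (R Quot I)" by (fact Hs)
  have mult: "I +> (a \<otimes> x) \<in> H" if "a \<in> carrier R" "x \<in> carrier R" "I +> x \<in> H" for a x
    using smult[OF that(1,3)] smult_coset[OF I that(1,2)] by simp
  show "ideal {x \<in> carrier R. I +> x \<in> H} R"
  proof (rule idealI[OF ring_axioms])
    show "subgroup {x \<in> carrier R. I +> x \<in> H} (add_monoid R)"
    proof (rule add.subgroupI)
      have "I +> \<zero> \<in> H" using Hs.one_closed h.hom_zero by simp
      then show "{x \<in> carrier R. I +> x \<in> H} \<noteq> {}" by blast
      fix x assume x: "x \<in> {x \<in> carrier R. I +> x \<in> H}"
      have "I +> (\<ominus> \<one> \<otimes> x) \<in> H" using mult[of "\<ominus> \<one>" x] x by simp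
      then show "\<ominus> x \<in> {x \<in> carrier R. I +> x \<in> H}" using x by (simp add: l_minus)
      fix y assume y: "y \<in> {x \<in> carrier R. I +> x \<in> H}"
      have "(I +> x) \<oplus>\<^bsub>R Quot I\<^esub> (I +> y) \<in> H" using Hs.m_closed[of "I +> x" "I +> y"] x y by simp
      then show "x \<oplus> y \<in> {x \<in> carrier R. I +> x \<in> H}" using x y h.hom_add by simp
    qed auto
    fix a x assume "a \<in> {x \<in> carrier R. I +> x \<in> H}" "x \<in> carrier R"
    then show "x \<otimes> a \<in> {x \<in> carrier R. I +> x \<in> H}" "a \<otimes> x \<in> {x \<in> carrier R. I +> x \<in> H}"
      using mult[of x a] by (simp_all add: m_comm)
  qed
  show "I \<subseteq> {x \<in> carrier R. I +> x \<in> H}"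
  proof
    fix x assume x: "x \<in> I"
    have "I \<in> H" using Hs.one_closed by (simp add: FactRing_zero)
    then show "x \<in> {x \<in> carrier R. I +> x \<in> H}" using x I.Icarr I.a_rcos_const by simp
  qed
  have "U \<in> (\<lambda>x. I +> x) ` {x \<in> carrier R. I +> x \<in> H}" if U: "U \<in> H" for U
  proof -
    have "U \<in> carrier (R Quot I)" using U Hs.subset by auto
    then obtain x where "x \<in> carrier R" "U = I +> x"
      unfolding FactRing_def A_RCOSETS_def' by auto
    then show ?thesis using U by blast
  qed
  then show "H = (\<lambda>x. I +> x) ` {x \<in> carrier R. I +> x \<in> H}" by blast
qed

text \<open>Correspondence between submodules of \<open>R/I\<close> and ideals containing
  \<open>I\<close>, with strict inclusions preserved in both directions.\<close>

lemma quotient_length_eq: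
  assumes I: "ideal I R"
  shows "quotient_length R I = Sup {enat n | n. ideal_chain I n}"
proof -
  let ?M = "quotient_module R (ring_module R) I"
  have "(\<exists>N :: nat \<Rightarrow> 'a set set. (\<forall>i\<le>n. submodule (N i) R ?M) \<and> (\<forall>i<n. N i \<subset> N (Suc i))) \<longleftrightarrow>
      ideal_chain I n" for n
  proof
    assume "\<exists>N :: nat \<Rightarrow> 'a set set. (\<forall>i\<le>n. submodule (N i) R ?M) \<and> (\<forall>i<n. N i \<subset> N (Suc i))"
    then obtain N :: "nat \<Rightarrow> 'a set set" where
      N: "\<forall>i\<le>n. submodule (N i) R ?M" "\<forall>i<n. N i \<subset> N (Suc i)" by blast
    define J where "J i = {x \<in> carrier R. I +> x \<in> N i}" for i
    have J: "ideal (J i) R" "I \<subseteq> J i" "N i = (\<lambda>x. I +> x) ` J i" if "i \<le> n" for i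
      using ideal_of_submodule[OF I, of "N i"] N(1) that unfolding J_def by auto
    have "J i \<subset> J (Suc i)" if "i < n" for i
    proof -
      have s: "N i \<subset> N (Suc i)" using N(2) that by blast
      then have "J i \<subseteq> J (Suc i)" unfolding J_def by blast
      moreover have "J i \<noteq> J (Suc i)" using J(3)[of i] J(3)[of "Suc i"] s that by auto
      ultimately show ?thesis by blast
    qed
    then show "ideal_chain I n" unfolding ideal_chain_def using J by blast
  next
    assume "ideal_chain I n"
    then obtain J where J: "\<forall>i\<le>n. ideal (J i) R \<and> I \<subseteq> J i" "\<forall>i<n. J i \<subset> J (Suc i)"
      unfolding ideal_chain_def by blast
    have "(\<lambda>x. I +> x) ` J i \<subset> (\<lambda>x. I +> x) ` J (Suc i)" if i: "i < n" for i
    proof -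
      have s: "J i \<subset> J (Suc i)" using J(2) i by blast
      then obtain x where x: "x \<in> J (Suc i)" "x \<notin> J i" by blast
      have id: "ideal (J i) R" "I \<subseteq> J i" "ideal (J (Suc i)) R" using J(1) i by auto
      have "x \<in> carrier R" using ideal.Icarr[OF id(3) x(1)] .
      then have "I +> x \<notin> (\<lambda>x. I +> x) ` J i" using coset_mem_iff[OF I id(1,2)] x(2) by simp
      then show ?thesis using s x(1) by blast
    qed
    then show "\<exists>N :: nat \<Rightarrow> 'a set set. (\<forall>i\<le>n. submodule (N i) R ?M) \<and> (\<forall>i<n. N i \<subset> N (Suc i))"
      using submodule_of_ideal[OF I] J(1) by (intro exI[of _ "\<lambda>i. (\<lambda>x. I +> x) ` J i"]) simp
  qed
  then show ?thesis unfolding quotient_length_def module_length_def by simp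
qed

text \<open>The element \<open>a\<close> of an ideal is represented by \<open>{[a]}\<close>, of the type that \<^const>\<open>finite_type\<close> prescribes.\<close>

definition list_module :: "'a set \<Rightarrow> ('a, 'a list set) module" where
  "list_module I = \<lparr>carrier = (\<lambda>a. {[a]}) ` I, monoid.mult = undefined, one = undefined,
     ring.zero = {[\<zero>]}, ring.add = (\<lambda>U V. {[hd (the_elem U) \<oplus> hd (the_elem V)]}),
     smult = (\<lambda>a U. {[a \<otimes> hd (the_elem U)]})\<rparr>"

lemma list_module_simps [simp]:
  "carrier (list_module I) = (\<lambda>a. {[a]}) ` I" "\<zero>\<^bsub>list_module I\<^esub> = {[\<zero>]}"
  "{[x]} \<oplus>\<^bsub>list_module I\<^esub> {[y]} = {[x \<oplus> y]}" "a \<odot>\<^bsub>list_module I\<^esub> {[x]} = {[a \<otimes> x]}"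
  by (simp_all add: list_module_def)

lemma list_module_module:
  assumes I: "ideal I R" shows "module R (list_module I)"
proof (rule moduleI[OF cring_axioms])
  interpret I: ideal I R by fact
  note [simp] = I.Icarr
  show "abelian_group (list_module I)"
  proof (rule abelian_groupI)
    fix x assume "x \<in> carrier (list_module I)"
    then obtain a where a: "a \<in> I" "x = {[a]}" by auto
    then show "\<exists>y\<in>carrier (list_module I). y \<oplus>\<^bsub>list_module I\<^esub> x = \<zero>\<^bsub>list_module I\<^esub>"
      by (intro bexI[of _ "{[\<ominus> a]}"]) (auto simp: l_neg)
  qed (auto simp: a_ac I.a_closed)
qed (auto simp: l_distr r_distr m_assoc ideal.I_l_closed[OF I] ideal.Icarr[OF I])

text \<open>For a submodule \<open>N\<close> containing the images of the generators, the elements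
  of \<open>I\<close> represented in \<open>N\<close> form an ideal; it contains \<open>G\<close>,
  hence all of \<open>I\<close>.\<close>

lemma list_module_finitely_generated:
  assumes I: "ideal I R" and G: "finite G" "G \<subseteq> carrier R" "I = Idl G"
  shows "finitely_generated_module R (list_module I)"
  unfolding finitely_generated_module_def
proof (intro conjI list_module_module[OF I] exI[of _ "(\<lambda>a. {[a]}) ` G"] allI impI)
  have GI: "G \<subseteq> I" using genideal_self[OF G(2)] G(3) by simp
  show "(\<lambda>a. {[a]}) ` G \<subseteq> carrier (list_module I)" using GI by auto
  show "finite ((\<lambda>a. {[a]}) ` G)" using G by simp
  interpret I: ideal I R by fact
  interpret M: module R "list_module I" by (rule list_module_module[OF I])
  fix N assume "submodule N R (list_module I) \<and> (\<lambda>a. {[a]}) ` G \<subseteq> N"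
  then have N: "submodule N R (list_module I)" and GN: "(\<lambda>a. {[a]}) ` G \<subseteq> N" by auto
  interpret N: submodule N R "list_module I" by (fact N)
  have Nsub: "N \<subseteq> carrier (list_module I)" using N.subset by simp
  define J where "J = {a \<in> I. {[a]} \<in> N}"
  have smult: "x \<otimes> a \<in> J" if "x \<in> carrier R" "a \<in> J" for x a
    using that N.smult_closed[of x "{[a]}"] I.I_l_closed by (simp add: J_def)
  have "ideal J R"
  proof (rule idealI[OF ring_axioms])
    show "subgroup J (add_monoid R)"
    proof (rule add.subgroupI)
      show "J \<subseteq> carrier R" using I.Icarr by (auto simp: J_def)
      have "{[\<zero>]} \<in> N" using N.one_closed by simp
      then show "J \<noteq> {}" using I.zero_closed unfolding J_def by blast
      fix a assume a: "a \<in> J"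
      have "\<ominus> \<one> \<otimes> a \<in> J" using smult[OF _ a] by simp
      then show "\<ominus> a \<in> J" using a I.Icarr by (simp add: J_def l_minus)
      fix b assume "b \<in> J"
      then show "a \<oplus> b \<in> J" using a N.m_closed[of "{[a]}" "{[b]}"] I.a_closed by (simp add: J_def)
    qed
    fix a x assume "a \<in> J" "x \<in> carrier R"
    then show "x \<otimes> a \<in> J" "a \<otimes> x \<in> J"
      using smult[of x a] I.Icarr by (simp_all add: J_def m_comm)
  qed
  moreover have "G \<subseteq> J" using GI GN by (auto simp: J_def)
  ultimately have "I \<subseteq> J" unfolding G(3) by (rule genideal_minimal)
  then show "N = carrier (list_module I)" using Nsub by (auto simp: J_def)
qed

text \<open>The finite type condition asks for direct sums; a single summand is used, so the
  elements of the target are the one-element lists \<open>[{[a]}]\<close>.\<close>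

lemma ideal_iso_list_module:
  assumes I: "ideal I R" and J: "ideal J R" and g: "bij_betw g I J"
    and add: "\<And>x y. x \<in> I \<Longrightarrow> y \<in> I \<Longrightarrow> g (x \<oplus> y) = g x \<oplus> g y"
    and smult: "\<And>a x. a \<in> carrier R \<Longrightarrow> x \<in> I \<Longrightarrow> g (a \<otimes> x) = a \<otimes> g x"
  shows "(\<lambda>x\<in>I. [{[g x]}]) \<in> module_iso R (ring_module R\<lparr>carrier := I\<rparr>) (direct_sum R [list_module J])"
proof -
  interpret I: ideal I R by fact
  have gJ: "g x \<in> J" if "x \<in> I" for x using g that by (auto simp: bij_betw_def)
  have car: "carrier (direct_sum R [list_module J]) = (\<lambda>a. [{[a]}]) ` J"
    by (auto simp: direct_sum_def length_Suc_conv image_iff)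
  have "(\<lambda>x\<in>I. [{[g x]}]) \<in> module_hom R (ring_module R\<lparr>carrier := I\<rparr>) (direct_sum R [list_module J])"
    unfolding module_hom_def car
    by (auto simp: ring_module_def gJ direct_sum_def add smult I.a_closed I.I_l_closed)
  moreover have "bij_betw (\<lambda>x\<in>I. [{[g x]}]) I ((\<lambda>a. [{[a]}]) ` J)"
  proof -
    have "inj_on (\<lambda>x. [{[g x]}]) I" using g by (auto simp: bij_betw_def inj_on_def)
    moreover have "(\<lambda>x. [{[g x]}]) ` I = (\<lambda>a. [{[a]}]) ` J" using g by (auto simp: bij_betw_def)
    ultimately show ?thesis by (simp add: bij_betw_def inj_on_def)
  qed
  ultimately show ?thesis unfolding module_iso_def car by (simp add: ring_module_def)
qed

end

context cm_local_dim1
begin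

section \<open>Lengths and powers computed among fractions\<close>

lemma chain_iff_ideal_chain:
  assumes I: "ideal I R"
  shows "Q.chain (\<iota> ` I) (\<iota> ` carrier R) n \<longleftrightarrow> ideal_chain I n"
proof
  have inj: "inj_on \<iota> (carrier R)" using embed_inject by (auto simp: inj_on_def)
  {
    assume "ideal_chain I n"
    then obtain J where J: "\<forall>i\<le>n. ideal (J i) R \<and> I \<subseteq> J i" "\<forall>i<n. J i \<subset> J (Suc i)"
      unfolding ideal_chain_def by blast
    have id: "ideal (J i) R" "I \<subseteq> J i" if "i \<le> n" for i using J(1) that by auto
    have sub: "J i \<subseteq> carrier R" if "i \<le> n" for i using ideal.Icarr[OF id(1)[OF that]] by (rule subsetI)
    have "\<iota> ` J i \<subset> \<iota> ` J (Suc i)" if "i < n" for i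
      using inj_on_image_eq_iff[OF inj sub sub, of i "Suc i"] J(2) that by (auto simp: psubset_eq)
    then show "Q.chain (\<iota> ` I) (\<iota> ` carrier R) n"
      unfolding Q.chain_def
      by (intro exI[of _ "\<lambda>i. \<iota> ` J i"] conjI allI impI image_mono subm_image id sub)
  next
    assume "Q.chain (\<iota> ` I) (\<iota> ` carrier R) n"
    then obtain N where N: "\<forall>i\<le>n. Q.subm (\<iota> ` carrier R) (N i) \<and> \<iota> ` I \<subseteq> N i \<and> N i \<subseteq> \<iota> ` carrier R"
      "\<forall>i<n. N i \<subset> N (Suc i)" unfolding Q.chain_def by (elim exE conjE) (rule that)
    have "preimage (N i) \<subset> preimage (N (Suc i))" if "i < n" for i
    proof -
      have "N i \<subset> N (Suc i)" "N i \<subseteq> \<iota> ` carrier R" "N (Suc i) \<subseteq> \<iota> ` carrier R" using N that by auto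
      moreover have "preimage (N i) \<subseteq> preimage (N (Suc i))"
        using \<open>N i \<subset> N (Suc i)\<close> by (auto simp: preimage_def)
      moreover have "preimage (N i) \<noteq> preimage (N (Suc i))"
        using calculation(1-3) image_preimage by (metis psubset_eq)
      ultimately show ?thesis by (simp add: psubset_eq)
    qed
    moreover have "I \<subseteq> preimage (N i)" if "i \<le> n" for i
      using N(1) that ideal.Icarr[OF I] by (auto simp: preimage_def)
    moreover have "ideal (preimage (N i)) R" if "i \<le> n" for i
      using ideal_preimage N(1) that by simp
    ultimately show "ideal_chain I n"
      unfolding ideal_chain_def by (intro exI[of _ "\<lambda>i. preimage (N i)"] conjI allI impI)
  }
qed

lemma quotient_length_le_imp:
  assumes "ideal I R" "quotient_length R I \<le> enat k"
  shows "\<not> Q.chain (\<iota> ` I) (\<iota> ` carrier R) (Suc k)"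
proof
  assume "Q.chain (\<iota> ` I) (\<iota> ` carrier R) (Suc k)"
  then have "ideal_chain I (Suc k)" using chain_iff_ideal_chain assms(1) by blast
  then have "enat (Suc k) \<le> quotient_length R I"
    unfolding quotient_length_eq[OF assms(1)] by (intro Sup_upper) blast
  then have "enat (Suc k) \<le> enat k" using assms(2) by (rule order_trans)
  then show False by simp
qed

lemma quotient_length_has_length:
  assumes "ideal I R" "Q.has_length (\<iota> ` I) (\<iota> ` carrier R) n"
  shows "quotient_length R I = enat n"
  unfolding quotient_length_eq[OF assms(1)]
proof (rule antisym)
  show "Sup {enat k | k. ideal_chain I k} \<le> enat n"
    using assms(2) chain_iff_ideal_chain[OF assms(1)]
    by (intro Sup_least) (auto simp: Q.has_length_def)
  show "enat n \<le> Sup {enat k | k. ideal_chain I k}"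
    using assms(2) chain_iff_ideal_chain[OF assms(1)]
    by (intro Sup_upper) (auto simp: Q.has_length_def)
qed

lemma embed_ideal_prod:
  assumes I: "ideal I R" and J: "ideal J R"
  shows "\<iota> ` (I \<cdot> J) = Q.product (\<iota> ` I) (\<iota> ` J)"
proof
  have IJ: "ideal (I \<cdot> J) R" by (rule ideal_prod_is_ideal[OF I J])
  have IJc: "\<iota> ` I \<subseteq> carrier TF" "\<iota> ` J \<subseteq> carrier TF"
    using Q.subm_carrier[OF subm_image[OF I]] Q.subm_carrier[OF subm_image[OF J]] by auto
  have "\<iota> x \<in> Q.product (\<iota> ` I) (\<iota> ` J)" if "x \<in> I \<cdot> J" for x
    using that
  proof (induction x rule: ideal_prod.induct)
    case (prod i j)
    then have "\<iota> (i \<otimes> j) = \<iota> i \<otimes>\<^bsub>TF\<^esub> \<iota> j" using embed_mult ideal.Icarr[OF I] ideal.Icarr[OF J] by blast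
    then show ?case using prod Q.product_mem by simp
  next
    case (sum a b)
    then have "\<iota> (a \<oplus> b) = \<iota> a \<oplus>\<^bsub>TF\<^esub> \<iota> b" using embed_add ideal.Icarr[OF IJ] by blast
    then show ?case using sum Q.subm_add[OF Q.product_subm[OF IJc]] by simp
  qed
  then show "\<iota> ` (I \<cdot> J) \<subseteq> Q.product (\<iota> ` I) (\<iota> ` J)" by blast
  show "Q.product (\<iota> ` I) (\<iota> ` J) \<subseteq> \<iota> ` (I \<cdot> J)"
  proof (rule Q.product_least[OF subm_image[OF IJ]])
    fix x y assume "x \<in> \<iota> ` I" "y \<in> \<iota> ` J"
    then obtain i j where ij: "i \<in> I" "j \<in> J" "x = \<iota> i" "y = \<iota> j" by blast
    then have "x \<otimes>\<^bsub>TF\<^esub> y = \<iota> (i \<otimes> j)" using embed_mult ideal.Icarr[OF I] ideal.Icarr[OF J] by simp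
    then show "x \<otimes>\<^bsub>TF\<^esub> y \<in> \<iota> ` (I \<cdot> J)"
      using imageI[OF ideal_prod.prod[OF ij(1,2)]] by (simp only:)
  qed
qed

lemma embed_max_ideal_power:
  "ideal (\<mm> [^]\<^bsub>ideals_set R\<^esub> n) R \<and> \<iota> ` (\<mm> [^]\<^bsub>ideals_set R\<^esub> n) = Q.m_power n" for n :: nat
proof (induction n)
  case 0
  then show ?case using oneideal by (simp add: nat_pow_def ideals_set_def)
next
  case (Suc n)
  have eq: "\<mm> [^]\<^bsub>ideals_set R\<^esub> Suc n = (\<mm> [^]\<^bsub>ideals_set R\<^esub> n) \<cdot> \<mm>"
    by (simp add: nat_pow_def ideals_set_def)
  show ?case
    unfolding eq using Suc ideal_prod_is_ideal[OF _ mx_ideal] embed_ideal_prod[OF _ mx_ideal] by simp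
qed

end

text \<open>From \<open>k\<close> on, \<open>l n\<close> is \<open>n e\<close> plus the constant
  \<open>l k - k e\<close>, and the constant divided by \<open>n\<close> tends to zero.\<close>

lemma eventually_linear_limit:
  fixes l :: "nat \<Rightarrow> nat"
  assumes step: "\<And>n. k \<le> n \<Longrightarrow> l (Suc n) = l n + e"
  shows "(\<lambda>n. real (l n) / real n) \<longlonglongrightarrow> real e"
proof -
  have l: "l (k + j) = l k + j * e" for j
    by (induction j) (use step[of "k + _"] in auto)
  have "(\<lambda>n. (real (l k) - real k * real e) / real n + real e) \<longlonglongrightarrow> 0 + real e"
    by (intro tendsto_add lim_const_over_n tendsto_const)
  moreover have "\<forall>\<^sub>F n in sequentially. (real (l k) - real k * real e) / real n + real e = real (l n) / real n"
  \<comment> \<open>Starting at \<open>Suc k\<close> makes \<open>n\<close> positive, so that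
    division by \<open>n\<close> is harmless.\<close>
  proof (rule eventually_sequentiallyI[of "Suc k"])
    fix n assume n: "Suc k \<le> n"
    then obtain j where j: "n = k + j" "0 < n" by (metis Suc_leD le_iff_add not_gr_zero not_less_eq_eq zero_le)
    have "real (l n) = real (l k) + (real n - real k) * real e" using l[of j] j by simp
    then show "(real (l k) - real k * real e) / real n + real e = real (l n) / real n"
      using j(2) by (simp add: field_simps)
  qed
  ultimately show ?thesis by (simp add: Lim_transform_eventually)
qed

lemma (in cring) embed_image_subset_iff:
  assumes "I \<subseteq> carrier R" "J \<subseteq> carrier R"
  shows "\<iota> ` I \<subseteq> \<iota> ` J \<longleftrightarrow> I \<subseteq> J"
proof
  assume *: "\<iota> ` I \<subseteq> \<iota> ` J"
  show "I \<subseteq> J"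
  proof
    fix x assume x: "x \<in> I"
    then obtain y where "y \<in> J" "\<iota> x = \<iota> y" using * by blast
    then show "x \<in> J" using embed_inject[of x y] x assms by auto
  qed
qed (rule image_mono)

text \<open>Every homomorphism \<open>f\<close> from \<^term>\<open>I\<close> to \<^term>\<open>R\<close> is multiplication by \<open>f s / s\<close>, so \<^term>\<open>q\<close> defines the element
  \<open>f \<mapsto> q \<cdot> f s / s\<close> of the bidual.  It is evaluation at some \<open>x \<in> I\<close>, and the inclusion gives \<open>q = x\<close>.\<close>

lemma (in cring) reflexive_extension:
  assumes I: "ideal I R" and s: "s \<in> I" "s \<in> NZ"
    and refl: "reflexive_module R (ring_module R\<lparr>carrier := I\<rparr>)"
    and q: "q \<in> carrier TF"
    and qd: "\<And>p. p \<in> carrier TF \<Longrightarrow> (\<forall>x\<in>I. p \<otimes>\<^bsub>TF\<^esub> \<iota> x \<in> \<iota> ` carrier R) \<Longrightarrow> q \<otimes>\<^bsub>TF\<^esub> p \<in> \<iota> ` carrier R"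
  shows "q \<in> \<iota> ` I"
proof -
  interpret Q: cring TF by (rule TF_cring)
  interpret I: ideal I R by fact
  let ?M = "ring_module R\<lparr>carrier := I\<rparr>"
  have sc: "s \<in> carrier R" using s I.Icarr by blast
  have su: "\<iota> s \<in> Units TF" using s sc embed_Units_iff by simp
  have isc: "inv\<^bsub>TF\<^esub> \<iota> s \<in> carrier TF" using su by simp
  define H where "H = carrier (dual_module R ?M)"
  have H_iff: "f \<in> H \<longleftrightarrow> f \<in> I \<rightarrow>\<^sub>E carrier R \<and> (\<forall>x\<in>I. \<forall>y\<in>I. f (x \<oplus> y) = f x \<oplus> f y) \<and>
      (\<forall>a\<in>carrier R. \<forall>x\<in>I. f (a \<otimes> x) = a \<otimes> f x)" for f
    by (auto simp: H_def dual_module_def hom_module_def module_hom_def ring_module_def)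
  have HD: "f x \<in> carrier R" "f (a \<otimes> x) = a \<otimes> f x" if "f \<in> H" "x \<in> I" "a \<in> carrier R" for f x a
    using that unfolding H_iff by (auto simp: PiE_iff)
  define p where "p f = inv\<^bsub>TF\<^esub> \<iota> s \<otimes>\<^bsub>TF\<^esub> \<iota> (f s)" for f
  have pc: "p f \<in> carrier TF" if "f \<in> H" for f
    using isc embed_closed HD(1)[OF that s(1) sc] by (simp add: p_def)
  have p_x: "p f \<otimes>\<^bsub>TF\<^esub> \<iota> x = \<iota> (f x)" if f: "f \<in> H" and x: "x \<in> I" for f x
  proof -
    have xc: "x \<in> carrier R" using x I.Icarr by blast
    have fc: "f s \<in> carrier R" "f x \<in> carrier R" using HD(1)[OF f] s x sc by auto
    have "f s \<otimes> x = x \<otimes> f s" using fc xc by (simp add: m_comm)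
    also have "\<dots> = f (x \<otimes> s)" using HD(2)[OF f s(1) xc] by simp
    also have "x \<otimes> s = s \<otimes> x" using xc sc by (simp add: m_comm)
    also have "f (s \<otimes> x) = s \<otimes> f x" using HD(2)[OF f x sc] .
    finally have eq: "\<iota> (f s) \<otimes>\<^bsub>TF\<^esub> \<iota> x = \<iota> s \<otimes>\<^bsub>TF\<^esub> \<iota> (f x)"
      using embed_mult fc xc sc by metis
    have "p f \<otimes>\<^bsub>TF\<^esub> \<iota> x = inv\<^bsub>TF\<^esub> \<iota> s \<otimes>\<^bsub>TF\<^esub> (\<iota> (f s) \<otimes>\<^bsub>TF\<^esub> \<iota> x)"
      unfolding p_def using isc embed_closed fc xc by (simp add: Q.m_assoc)
    also have "\<dots> = \<iota> (f x)"
      unfolding eq using Q.Units_cancel[OF su] embed_closed fc by simp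
    finally show ?thesis .
  qed
  have qp: "q \<otimes>\<^bsub>TF\<^esub> p f \<in> \<iota> ` carrier R" if "f \<in> H" for f
    using qd[OF pc[OF that]] p_x[OF that] HD(1)[OF that] sc by auto
  \<comment> \<open>Elements of the bidual are extensional functions, hence the restriction to
    \<open>H\<close>. The value is pulled back to \<open>R\<close>, which is possible because
    \<open>q\<close> times \<open>p f\<close> lies in the image of \<open>R\<close>.\<close>
  define \<phi> where "\<phi> = (\<lambda>f\<in>H. the_inv_into (carrier R) \<iota> (q \<otimes>\<^bsub>TF\<^esub> p f))"
  have inj: "inj_on \<iota> (carrier R)" using embed_inject by (auto simp: inj_on_def)
  have \<phi>: "\<phi> f \<in> carrier R" "\<iota> (\<phi> f) = q \<otimes>\<^bsub>TF\<^esub> p f" if f: "f \<in> H" for f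
  proof -
    have "\<phi> f = the_inv_into (carrier R) \<iota> (q \<otimes>\<^bsub>TF\<^esub> p f)" using f by (simp add: \<phi>_def)
    then show "\<phi> f \<in> carrier R" "\<iota> (\<phi> f) = q \<otimes>\<^bsub>TF\<^esub> p f"
      using f_the_inv_into_f[OF inj qp[OF f]] the_inv_into_into[OF inj qp[OF f] subset_refl] by simp_all
  qed
  have "\<phi> \<in> carrier (dual_module R (dual_module R ?M))"
  proof -
    let ?D = "dual_module R ?M"
    have addD: "f \<oplus>\<^bsub>?D\<^esub> g = (\<lambda>x\<in>I. f x \<oplus> g x)" and smultD: "a \<odot>\<^bsub>?D\<^esub> f = (\<lambda>x\<in>I. a \<otimes> f x)" for f g a
      by (simp_all add: dual_module_def hom_module_def ring_module_def)
    have add: "\<phi> (f \<oplus>\<^bsub>?D\<^esub> g) = \<phi> f \<oplus> \<phi> g" if f: "f \<in> H" and g: "g \<in> H" for f g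
    proof -
      have fg: "f \<oplus>\<^bsub>?D\<^esub> g \<in> H"
        unfolding H_iff addD using f g I.a_closed I.I_l_closed
        by (auto simp: H_iff PiE_iff I.Icarr a_ac r_distr)
      have c: "f s \<in> carrier R" "g s \<in> carrier R" using HD(1)[OF f] HD(1)[OF g] s sc by auto
      have "p (f \<oplus>\<^bsub>?D\<^esub> g) = p f \<oplus>\<^bsub>TF\<^esub> p g"
        unfolding p_def addD using s(1) c isc by (simp add: embed_add embed_closed Q.r_distr)
      then have "\<iota> (\<phi> (f \<oplus>\<^bsub>?D\<^esub> g)) = \<iota> (\<phi> f \<oplus> \<phi> g)"
        using \<phi>[OF fg] \<phi>[OF f] \<phi>[OF g] pc[OF f] pc[OF g] q by (simp add: embed_add Q.r_distr)
      then show ?thesis using embed_inject \<phi>(1)[OF fg] \<phi>(1)[OF f] \<phi>(1)[OF g] by simp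
    qed
    have smult: "\<phi> (a \<odot>\<^bsub>?D\<^esub> f) = a \<otimes> \<phi> f" if a: "a \<in> carrier R" and f: "f \<in> H" for a f
    proof -
      have af: "a \<odot>\<^bsub>?D\<^esub> f \<in> H"
        unfolding H_iff smultD using a f I.a_closed I.I_l_closed
        by (auto simp: H_iff PiE_iff I.Icarr m_lcomm r_distr)
      have c: "f s \<in> carrier R" using HD(1)[OF f] s sc by auto
      have "p (a \<odot>\<^bsub>?D\<^esub> f) = \<iota> a \<otimes>\<^bsub>TF\<^esub> p f"
        unfolding p_def smultD using s(1) c a isc by (simp add: embed_mult embed_closed Q.m_lcomm)
      then have "\<iota> (\<phi> (a \<odot>\<^bsub>?D\<^esub> f)) = \<iota> (a \<otimes> \<phi> f)"
        using \<phi>[OF af] \<phi>[OF f] pc[OF f] q a by (simp add: embed_mult embed_closed Q.m_lcomm)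
      then show ?thesis using embed_inject \<phi>(1)[OF af] \<phi>(1)[OF f] a by simp
    qed
    have "\<phi> \<in> H \<rightarrow>\<^sub>E carrier R" using \<phi>(1) by (auto simp: \<phi>_def)
    then have "\<phi> \<in> module_hom R ?D (ring_module R)"
      unfolding module_hom_def H_def[symmetric] using add smult by (simp add: ring_module_def)
    then show ?thesis by (simp add: dual_module_def hom_module_def)
  qed
  then obtain x where x: "x \<in> I" "\<phi> = (\<lambda>f\<in>H. f x)"
    using refl unfolding reflexive_module_def module_iso_def bij_betw_def H_def
    by (auto simp: image_iff ring_module_def)
  define j where "j = (\<lambda>x\<in>I. x)"
  have j: "j \<in> H" unfolding H_iff j_def using I.Icarr I.a_closed I.I_l_closed by auto
  have "p j = \<one>\<^bsub>TF\<^esub>" unfolding p_def j_def using s su by simp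
  then have "\<iota> (\<phi> j) = q" using \<phi>(2)[OF j] q by simp
  moreover have "\<phi> j = x" using x j by (simp add: j_def)
  ultimately show ?thesis using x by blast
qed

context cm_local_dim1
begin

section \<open>Minimal multiplicity, and passage to isomorphism classes\<close>

text \<open>In dimension one the Hilbert-Samuel limit is the eventual increment \<open>e\<close> of
  the lengths, so the hypothesis says that \<open>e\<close> is the minimal number of generators of
  the maximal ideal. That number is also the length of a chain between \<open>m^2\<close> and
  \<open>m\<close>, which is what the growth argument requires.\<close>

lemma minimal_multiplicity_imp:
  assumes C: "Q.C \<inter> Units TF \<noteq> {}" and mm: "minimal_multiplicity R"
  obtains y where "y \<in> \<iota> ` \<mm>" "y \<in> Units TF"
    "\<And>a b. a \<in> \<iota> ` \<mm> \<Longrightarrow> b \<in> \<iota> ` \<mm> \<Longrightarrow> a \<otimes>\<^bsub>TF\<^esub> b \<in> Q.scale y (\<iota> ` \<mm>)"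
proof -
  interpret N: finite_normalization TF "\<iota> ` carrier R" "\<iota> ` \<mm>"
    by unfold_locales (rule C)
  show ?thesis
  proof (rule N.hilbert_samuel)
  fix y e l k
  assume y: "y \<in> \<iota> ` \<mm>" "y \<in> Units TF"
    and l: "\<And>n. Q.has_length (Q.m_power n) (\<iota> ` carrier R) (l n)"
    and l_Suc: "\<And>n. k \<le> n \<Longrightarrow> l (Suc n) = l n + e"
    and main: "\<And>\<mu> a b. Q.chain (Q.m_power (Suc (Suc 0))) (\<iota> ` \<mm>) \<mu> \<Longrightarrow> e \<le> \<mu> \<Longrightarrow>
      a \<in> \<iota> ` \<mm> \<Longrightarrow> b \<in> \<iota> ` \<mm> \<Longrightarrow> a \<otimes>\<^bsub>TF\<^esub> b \<in> Q.scale y (\<iota> ` \<mm>)"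
  have "quotient_length R (\<mm> [^]\<^bsub>ideals_set R\<^esub> n) = enat (l n)" for n :: nat
    using quotient_length_has_length l embed_max_ideal_power by simp
  then have "hilbert_samuel_multiplicity R = lim (\<lambda>n. real (l n) / real n)"
    by (simp add: hilbert_samuel_multiplicity_def dim_one one_enat_def)
  also have "\<dots> = real e" using eventually_linear_limit[of k l e] l_Suc by (intro limI) blast
  finally have e: "e = min_generators R \<mm>" using mm by (simp add: minimal_multiplicity_def)
  have inj: "inj_on \<iota> (carrier R)" using embed_inject by (auto simp: inj_on_def)
  have gen_iff: "N.generates_m (\<iota> ` G) \<longleftrightarrow> Idl G = \<mm>" if G: "G \<subseteq> carrier R" for G
  proof
    assume g: "N.generates_m (\<iota> ` G)"
    have sub: "\<iota> ` \<mm> \<subseteq> \<iota> ` (Idl G)"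
      using g subm_image[OF genideal_ideal[OF G]] genideal_self[OF G] image_mono
      unfolding N.generates_m_def by metis
    have "Idl G \<subseteq> carrier R" using ideal.Icarr[OF genideal_ideal[OF G]] by (rule subsetI)
    then have "\<mm> \<subseteq> Idl G" using sub by (simp add: embed_image_subset_iff mx_subset)
    moreover have "\<iota> ` G \<subseteq> \<iota> ` \<mm>" using g by (simp add: N.generates_m_def)
    then have "G \<subseteq> \<mm>" by (simp add: embed_image_subset_iff mx_subset G)
    then have "Idl G \<subseteq> \<mm>" by (rule genideal_minimal[OF mx_ideal])
    ultimately show "Idl G = \<mm>" by (rule subset_antisym[rotated])
  next
    assume g: "Idl G = \<mm>"
    show "N.generates_m (\<iota> ` G)"
      unfolding N.generates_m_def
    proof (intro conjI allI impI)
      show "\<iota> ` G \<subseteq> \<iota> ` \<mm>" using g genideal_self[OF G] by blast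
      fix Z assume Z: "Q.subm (\<iota> ` carrier R) Z" "\<iota> ` G \<subseteq> Z"
      have "G \<subseteq> preimage Z" using Z(2) G by (auto simp: preimage_def)
      then have "\<mm> \<subseteq> preimage Z" using genideal_minimal[OF ideal_preimage[OF Z(1)]] g by blast
      then show "\<iota> ` \<mm> \<subseteq> Z" by (auto simp: preimage_def)
    qed
  qed
  let ?P = "\<lambda>n. \<exists>A \<subseteq> carrier R. finite A \<and> card A = n \<and> Idl A = \<mm>"
  have "\<exists>n. ?P n"
    using finetely_gen[OF mx_ideal] by metis
  then have "?P (min_generators R \<mm>)"
    unfolding min_generators_def by (rule LeastI_ex)
  then obtain G where G: "G \<subseteq> carrier R" "finite G" "card G = min_generators R \<mm>" "Idl G = \<mm>" by blast
  have cardG: "card (\<iota> ` G) = e" using card_image[OF inj_on_subset[OF inj G(1)]] G(3) e by simp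
  have "Q.chain (Q.m_power (Suc (Suc 0))) (\<iota> ` \<mm>) (card (\<iota> ` G))"
  proof (rule N.minimal_generators_chain)
    show "finite (\<iota> ` G)" using G by simp
    show "N.generates_m (\<iota> ` G)" using gen_iff G by blast
    fix H assume H: "finite H" "N.generates_m H"
    then have "H \<subseteq> \<iota> ` carrier R" using image_mono[OF mx_subset, of \<iota>] unfolding N.generates_m_def by blast
    then obtain K where K: "K \<subseteq> carrier R" "H = \<iota> ` K" by (auto simp: subset_image_iff)
    have injK: "inj_on \<iota> K" using inj_on_subset[OF inj K(1)] .
    have "finite K" using H(1) K(2) finite_image_iff[OF injK] by simp
    moreover have "Idl K = \<mm>" using gen_iff[OF K(1)] H(2) K(2) by simp
    ultimately have "?P (card K)" using K(1) by blast
    then have "min_generators R \<mm> \<le> card K" unfolding min_generators_def by (rule Least_le)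
    then show "card (\<iota> ` G) \<le> card H" using cardG e K(2) card_image[OF injK] by simp
  qed
  then show thesis using that[OF y main] cardG by simp
  qed
qed

lemma regular_reflexive_dual:
  assumes "regular_ideal R I" "reflexive_module R (ring_module R\<lparr>carrier := I\<rparr>)"
  shows "Q.dual (Q.dual (\<iota> ` I)) \<subseteq> \<iota> ` I"
proof
  have I: "ideal I R" using assms by (simp add: regular_ideal_def)
  obtain s where s: "s \<in> I" "s \<in> NZ" using assms by (auto simp: regular_ideal_def)
  fix q assume q: "q \<in> Q.dual (Q.dual (\<iota> ` I))"
  then have qc: "q \<in> carrier TF" using Q.dual_carrier by blast
  show "q \<in> \<iota> ` I"
  proof (rule reflexive_extension[OF I s assms(2) qc])
    fix p assume "p \<in> carrier TF" "\<forall>x\<in>I. p \<otimes>\<^bsub>TF\<^esub> \<iota> x \<in> \<iota> ` carrier R"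
    then have "p \<in> Q.dual (\<iota> ` I)" by (auto simp: Q.dual_def)
    then show "q \<otimes>\<^bsub>TF\<^esub> p \<in> \<iota> ` carrier R" using q by (simp add: Q.dual_def)
  qed
qed

lemma scaled_ideal_iso:
  assumes I: "ideal I R" and J: "ideal J R" and w: "w \<in> Units TF" and eq: "Q.scale w (\<iota> ` I) = \<iota> ` J"
  shows "module_iso R (ring_module R\<lparr>carrier := I\<rparr>) (direct_sum R [list_module J]) \<noteq> {}"
proof -
  interpret I: ideal I R by fact
  interpret J: ideal J R by fact
  have inj: "inj_on \<iota> (carrier R)" using embed_inject by (auto simp: inj_on_def)
  have wc: "w \<in> carrier TF" using w by blast
  have Jsub: "J \<subseteq> carrier R" using J.Icarr by blast
  define g where "g x = the_inv_into J \<iota> (w \<otimes>\<^bsub>TF\<^esub> \<iota> x)" for x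
  have wI: "w \<otimes>\<^bsub>TF\<^esub> \<iota> x \<in> \<iota> ` J" if "x \<in> I" for x
    unfolding eq[symmetric] Q.scale_def using that by blast
  have injJ: "inj_on \<iota> J" using inj_on_subset[OF inj Jsub] .
  have g: "g x \<in> J" "\<iota> (g x) = w \<otimes>\<^bsub>TF\<^esub> \<iota> x" if x: "x \<in> I" for x
    unfolding g_def using the_inv_into_into[OF injJ wI[OF x] subset_refl] f_the_inv_into_f[OF injJ wI[OF x]] by auto
  have \<iota>c: "\<iota> x \<in> carrier TF" if "x \<in> I" for x using embed_closed I.Icarr that by blast
  have gc: "g x \<in> carrier R" if "x \<in> I" for x using g(1)[OF that] Jsub by blast
  have "bij_betw g I J"
    unfolding bij_betw_def
  proof
    show "inj_on g I"
    proof (rule inj_onI)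
      fix x y assume xy: "x \<in> I" "y \<in> I" "g x = g y"
      then have "w \<otimes>\<^bsub>TF\<^esub> \<iota> x = w \<otimes>\<^bsub>TF\<^esub> \<iota> y" using g(2) by metis
      then have "\<iota> x = \<iota> y" using Q.Units_l_cancel[OF w \<iota>c \<iota>c] xy by simp
      then show "x = y" using embed_inject I.Icarr xy by simp
    qed
    show "g ` I = J"
    proof
      show "g ` I \<subseteq> J" using g(1) by blast
      show "J \<subseteq> g ` I"
      proof
        fix y assume y: "y \<in> J"
        then have "\<iota> y \<in> Q.scale w (\<iota> ` I)" unfolding eq by blast
        then obtain x where x: "x \<in> I" "\<iota> y = w \<otimes>\<^bsub>TF\<^esub> \<iota> x" unfolding Q.scale_def by blast
        then have "\<iota> y = \<iota> (g x)" using g(2) by simp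
        then have "y = g x" using embed_inject gc[OF x(1)] y Jsub by blast
        then show "y \<in> g ` I" using x by blast
      qed
    qed
  qed
  moreover have "g (x \<oplus> y) = g x \<oplus> g y" if x: "x \<in> I" and y: "y \<in> I" for x y
  proof -
    have "\<iota> (g (x \<oplus> y)) = \<iota> (g x \<oplus> g y)"
      using g(2)[OF x] g(2)[OF y] g(2)[OF I.a_closed[OF x y]] gc x y wc
      by (simp add: embed_add I.Icarr Q.r_distr embed_closed)
    then show ?thesis using embed_inject gc[OF I.a_closed[OF x y]] gc[OF x] gc[OF y] by simp
  qed
  moreover have "g (a \<otimes> x) = a \<otimes> g x" if a: "a \<in> carrier R" and x: "x \<in> I" for a x
  proof -
    have "\<iota> (g (a \<otimes> x)) = \<iota> (a \<otimes> g x)"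
      using g(2)[OF x] g(2)[OF I.I_l_closed[OF x a]] gc[OF x] a x wc
      by (simp add: embed_mult I.Icarr Q.m_lcomm embed_closed)
    then show ?thesis using embed_inject gc[OF I.I_l_closed[OF x a]] gc[OF x] a by simp
  qed
  ultimately show ?thesis using ideal_iso_list_module[OF I J] by blast
qed

text \<open>The sets in \<open>F\<close> need not be images of ideals. For each one that some ideal
  of the class is scaled to, such an ideal is chosen as representative; if \<open>u\<close> scales
  \<open>I\<close> and \<open>v\<close> scales the representative to the same set, then
  \<open>v^-1 u\<close> carries \<open>I\<close> onto the representative.\<close>

lemma finite_type_of_scaling:
  assumes F: "finite F" and cls: "\<And>I. I \<in> \<I> \<Longrightarrow> ideal I R \<and> (\<exists>u\<in>Units TF. Q.scale u (\<iota> ` I) \<in> F)"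
  shows "finite_type R {ring_module R\<lparr>carrier := I\<rparr> | I. I \<in> \<I>}"
proof -
  define hit where "hit = {E \<in> F. \<exists>I\<in>\<I>. \<exists>u\<in>Units TF. Q.scale u (\<iota> ` I) = E}"
  have "\<forall>E\<in>hit. \<exists>I. I \<in> \<I> \<and> (\<exists>u\<in>Units TF. Q.scale u (\<iota> ` I) = E)" by (auto simp: hit_def)
  then obtain rep where rep: "\<And>E. E \<in> hit \<Longrightarrow> rep E \<in> \<I>"
    "\<And>E. E \<in> hit \<Longrightarrow> \<exists>u\<in>Units TF. Q.scale u (\<iota> ` rep E) = E" by metis
  show ?thesis
    unfolding finite_type_def
  proof (intro exI[of _ "(\<lambda>E. list_module (rep E)) ` hit"] conjI ballI)
    show "finite ((\<lambda>E. list_module (rep E)) ` hit)" using F by (simp add: hit_def)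
    fix N assume "N \<in> (\<lambda>E. list_module (rep E)) ` hit"
    then obtain E where E: "E \<in> hit" "N = list_module (rep E)" by blast
    have id: "ideal (rep E) R" using rep(1)[OF E(1)] cls by blast
    then obtain G where "G \<subseteq> carrier R" "finite G" "rep E = Idl G" using finetely_gen by metis
    then show "finitely_generated_module R N"
      unfolding E(2) by (intro list_module_finitely_generated[OF id])
  next
    fix M assume "M \<in> {ring_module R\<lparr>carrier := I\<rparr> | I. I \<in> \<I>}"
    then obtain I where I: "I \<in> \<I>" "M = ring_module R\<lparr>carrier := I\<rparr>" by blast
    obtain u where u: "u \<in> Units TF" "Q.scale u (\<iota> ` I) \<in> F" using cls[OF I(1)] by blast
    define E where "E = Q.scale u (\<iota> ` I)"
    have E: "E \<in> hit" using u I(1) by (auto simp: hit_def E_def)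
    obtain v where v: "v \<in> Units TF" "Q.scale v (\<iota> ` rep E) = E" using rep(2)[OF E] by blast
    have id: "ideal I R" "ideal (rep E) R" using cls[OF I(1)] cls[OF rep(1)[OF E]] by auto
    have c: "\<iota> ` I \<subseteq> carrier TF" "\<iota> ` rep E \<subseteq> carrier TF"
      using Q.subm_carrier[OF subm_image[OF id(1)]] Q.subm_carrier[OF subm_image[OF id(2)]] by auto
    have "Q.scale (inv\<^bsub>TF\<^esub> v \<otimes>\<^bsub>TF\<^esub> u) (\<iota> ` I) = Q.scale (inv\<^bsub>TF\<^esub> v) E"
      unfolding E_def using Q.scale_scale[of "inv\<^bsub>TF\<^esub> v" u "\<iota> ` I"] u v c by (simp add: Q.Units_closed)
    also have "\<dots> = \<iota> ` rep E"
      using Q.scale_inv_cancel(2)[OF v(1) c(2)] by (simp only: v(2))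
    finally have "module_iso R M (direct_sum R [list_module (rep E)]) \<noteq> {}"
      unfolding I(2) using u v by (intro scaled_ideal_iso[OF id]) auto
    then show "\<exists>Ns. set Ns \<subseteq> (\<lambda>E. list_module (rep E)) ` hit \<and> module_iso R M (direct_sum R Ns) \<noteq> {}"
      using E by (intro exI[of _ "[list_module (rep E)]"]) auto
  qed
qed

lemma finite_type_regular_reflexive_ideals:
  assumes "quotient_length R (conductor_ideal R) \<le> 3 \<or>
    quotient_length R (conductor_ideal R) = 4 \<and> minimal_multiplicity R"
  shows "finite_type R (regular_reflexive_ideals R)"
proof -
  have nochain: "\<not> Q.chain Q.C (\<iota> ` carrier R) (Suc k)"
    if "quotient_length R (conductor_ideal R) \<le> enat k" for k
    using quotient_length_le_imp[OF conductor_ideal that] by (simp add: conductor_ideal_eq)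
  have n: "(3::enat) = enat 3" "(4::enat) = enat 4" by (simp_all add: numeral_eq_enat)
  \<comment> \<open>Length at most \<open>k\<close> excludes \<open>k + 1\<close> strict steps,
    which turns the two cases into the absence of chains of length 4 and 5.\<close>
  have bound: "\<not> Q.chain Q.C (\<iota> ` carrier R) 4 \<or>
      \<not> Q.chain Q.C (\<iota> ` carrier R) 5 \<and> minimal_multiplicity R"
    using assms nochain[of 3] nochain[of 4] by (auto simp: n)
  then have C: "Q.C \<inter> Units TF \<noteq> {}" using Q.no_chain_imp_C_regular by blast
  interpret N: finite_normalization TF "\<iota> ` carrier R" "\<iota> ` \<mm>"
    by unfold_locales (rule C)
  let ?\<K> = "{K. Q.subm (\<iota> ` carrier R) K \<and> Q.C \<subseteq> K \<and> K \<subseteq> \<iota> ` carrier R \<and> Q.dual (Q.dual K) \<subseteq> K}"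
  have "N.finite_up_to_scaling ?\<K>"
    using bound
  proof
    assume "\<not> Q.chain Q.C (\<iota> ` carrier R) 4"
    then show ?thesis
      by (rule N.finite_up_to_scaling_subset[OF N.length_three_classification]) blast
  next
    assume *: "\<not> Q.chain Q.C (\<iota> ` carrier R) 5 \<and> minimal_multiplicity R"
    then obtain y where y: "y \<in> \<iota> ` \<mm>" "y \<in> Units TF"
      "\<And>a b. a \<in> \<iota> ` \<mm> \<Longrightarrow> b \<in> \<iota> ` \<mm> \<Longrightarrow> a \<otimes>\<^bsub>TF\<^esub> b \<in> Q.scale y (\<iota> ` \<mm>)"
      using minimal_multiplicity_imp[OF C] by blast
    show ?thesis using N.length_four_classification[OF y] * by blast
  qed
  note fin = N.reflexive_classes[OF this]
  obtain F where F: "finite F"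
    "\<forall>I\<in>{I. Q.subm (\<iota> ` carrier R) I \<and> I \<subseteq> \<iota> ` carrier R \<and> I \<inter> Units TF \<noteq> {} \<and>
      Q.dual (Q.dual I) \<subseteq> I}. \<exists>u\<in>Units TF. Q.scale u I \<in> F"
    using fin unfolding N.finite_up_to_scaling_def by (elim exE conjE) (rule that)
  define \<I> where "\<I> = {I. regular_ideal R I \<and> reflexive_module R (ring_module R\<lparr>carrier := I\<rparr>)}"
  have "ideal I R \<and> (\<exists>u\<in>Units TF. Q.scale u (\<iota> ` I) \<in> F)" if "I \<in> \<I>" for I
  proof -
    have reg: "regular_ideal R I" and refl: "reflexive_module R (ring_module R\<lparr>carrier := I\<rparr>)"
      using that by (auto simp: \<I>_def)
    have I: "ideal I R" using reg by (simp add: regular_ideal_def)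
    obtain s where s: "s \<in> I" "s \<in> NZ" using reg by (auto simp: regular_ideal_def)
    have "\<iota> s \<in> Units TF" using embed_Units_iff NZ_closed s by blast
    then have "\<iota> ` I \<inter> Units TF \<noteq> {}" using s by blast
    moreover have "\<iota> ` I \<subseteq> \<iota> ` carrier R" using ideal.Icarr[OF I] by blast
    ultimately show ?thesis
      using I F(2) subm_image[OF I] regular_reflexive_dual[OF reg refl] by simp
  qed
  then have "finite_type R {ring_module R\<lparr>carrier := I\<rparr> | I. I \<in> \<I>}"
    by (rule finite_type_of_scaling[OF F(1)])
  then show ?thesis by (simp add: regular_reflexive_ideals_def \<I>_def)
qed

end

theorem theorem2:
  fixes R :: "('a, 'r) ring_scheme"
  assumes "cohen_macaulay_local_ring R"
    and "krull_dim R = 1"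
    and "infinite (carrier (residue_field R))"
    and "quotient_length R (conductor_ideal R) \<le> 3 \<or>
         quotient_length R (conductor_ideal R) = 4 \<and> minimal_multiplicity R"
  shows "finite_type R (regular_reflexive_ideals R)"
proof -
  have "cring R" using assms(1) by (simp add: cohen_macaulay_local_ring_def local_ring_def)
  then interpret cm_local_dim1 R
    by (intro cm_local_dim1.intro cm_local_dim1_axioms.intro assms(1-3))
  show ?thesis by (rule finite_type_regular_reflexive_ideals[OF assms(4)])
qed

end
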